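(* Let $\alpha\in\{0,1\}$. Given $v_1,h_1>0$, let $E=E^l\cup E^c\cup E^r\in\mathcal A(v_1,0,h_1,0)$ be a regular solution, with partitioning point $x_0>0$, of the problem $$\inf\{\mathscr P_\alpha(F):F\in\mathcal A(v_1,0,h_1,0)\}$$ such that $\mathrm{tr}^x_{x_0-}E=[-h_1,h_1]$. Then $$E^c=\{(x,y)\in\mathbb R^2 : |y|<f(x),\ |x|<x_0\},$$ where the function $f$ is given by $$f(r)=\lambda^{\alpha+1}\varphi_\alpha\Big(\frac r\lambda\Big)+\bar y,$$ for some $\lambda=\lambda(\alpha,v_1,h_1)>0$ and $\bar y=\bar y(\alpha,v_1,h_1)\le 0$ such that $\bar y=0$ if and only if $\alpha=0$.
   Context: **$\alpha$-perimeter.** For $\alpha\ge0$ and a Lebesgue measurable set $E\subset\mathbb R^2$ the $\alpha$-perimeter is $$P_\alpha(E)=\sup\Big\{\int_E(\partial_x\varphi_1+|x|^\alpha\partial_y\varphi_2)\,dx\,dy : \varphi_1,\varphi_2\in C^1_c(\mathbb R^2),\ \max_{\mathbb R^2}(\varphi_1^2+\varphi_2^2)^{1/2}\le 1\Big\}.$$ $\mathcal L^2$ denotes Lebesgue measure on $\mathbb R^2$. **Symmetric sets.** $E\subset\mathbb R^2$ is $x$-symmetric if $(x,y)\in E$ implies $(-x,y)\in E$, and $y$-symmetric if $(x,y)\in E$ implies $(x,-y)\in E$. It is $y$-convex if the section $E_x=\{y\in\mathbb R:(x,y)\in E\}$ is an interval for every $x\in\mathbb R$, and $y$-Schwarz symmetric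 if it is $y$-symmetric and $y$-convex. $\mathscr S_x$ is the class of $\mathcal L^2$-measurable $x$-symmetric sets, $\mathscr S_y^*$ the class of $\mathcal L^2$-measurable $y$-Schwarz symmetric sets. **Traces.** For $E\in\mathscr S_y^*$ with finite $\alpha$-perimeter and $x_0\in\mathbb R$, the left trace $\mathrm{tr}^x_{x_0-}E=[-y^-,y^-]$ and the right trace $\mathrm{tr}^x_{x_0+}E=[-y^+,y^+]$ (with $y^\pm\ge 0$) are the symmetric intervals such that $\lim_{x\to x_0^\pm}\int_{\mathbb R}|\chi_E(x,y)-\chi_{[-y^\pm,y^\pm]}(y)|\,dy=0$. **The class $\mathcal A$.** For $v_1,v_2,h_1,h_2\ge0$, $\mathcal A(v_1,v_2,h_1,h_2)$ is the class of all $E\in\mathscr S_x\cap\mathscr S_y^*$ such that for some $x_0>0$, called the partitioning point of $E$, the sets $E^l=\{(x,y)\in E:x<-x_0\}$, $E^c=\{(x,y)\in E:|x|<x_0\}$, $E^r=\{(x,y)\in E:x>x_0\}$ satisfy $\mathcal L^2(E^c)=v_1$, $\mathcal L^2(E^l)=\mathcal L^2(E^r)=v_2/2$, and $[-h_1,h_1]\subset\mathrm{tr}^x_{x_0-}E$, $[-h_2,h_2]\subset\mathrm{tr}^x_{x_0+}E$. **Functional and regular solutions.** For $E\in\mathcal A(v_1,v_2,h_1,h_2)$ with partitioning point $x_0$ and associated sets $E^l,E^c,E^r$, $$\mathscr P_\alpha(E)=\tfrac12\big\{P_\alpha(\mathbb R^2\setminus E)+P_\alpha(E^l)+P_\alpha(E^c)+P_\alpha(E^r)\big\}.$$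 A regular solution is a minimizer $E=E^l\cup E^c\cup E^r$ of $\mathscr P_\alpha$ in the class $\mathcal A(v_1,v_2,h_1,h_2)$ such that $E^c$ is convex and $E^l,E^r$ have Lipschitz boundaries. **Profile $\varphi_\alpha$.** $\displaystyle\varphi_\alpha(x)=\int_{\arcsin|x|}^{\pi/2}(\sin t)^{\alpha+1}\,dt$ for $x\in[-1,1]$.
   Formalization: The formal statement identifies the interior of E^c, rather than E^c itself, with {|y|<f(x), |x|<x_0}: adding boundary points (e.g. |y|≤f(x)) gives another regular solution, so equality holds only up to a null set, and literally when E^c is open; x_0≤λ is also asserted. *)

theory Defs
  imports "HOL-Analysis.Analysis"
begin

section \<open>The perimeter\<close>

definition partial_x :: "(real \<times> real \<Rightarrow> real) \<Rightarrow> real \<times> real \<Rightarrow> real" where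
  "partial_x \<phi> = (\<lambda>(x, y). deriv (\<lambda>s. \<phi> (s, y)) x)"

definition partial_y :: "(real \<times> real \<Rightarrow> real) \<Rightarrow> real \<times> real \<Rightarrow> real" where
  "partial_y \<phi> = (\<lambda>(x, y). deriv (\<lambda>s. \<phi> (x, s)) y)"

definition C1_compact_support :: "(real \<times> real \<Rightarrow> real) set" where
  "C1_compact_support = {\<phi>. \<phi> differentiable_on UNIV
     \<and> continuous_on UNIV (partial_x \<phi>) \<and> continuous_on UNIV (partial_y \<phi>)
     \<and> compact (closure {p. \<phi> p \<noteq> 0})}"

text \<open>The weight is the power of \<open>\<bar>x\<bar>\<close> with exponent \<open>\<alpha> \<ge> 0\<close>. The case
  distinction is needed because \<open>0 powr 0 = 0\<close>.\<close>

definition weight :: "real \<Rightarrow> real \<Rightarrow> real" where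
  "weight \<alpha> x = (if \<alpha> = 0 then 1 else \<bar>x\<bar> powr \<alpha>)"

definition perimeter :: "real \<Rightarrow> (real \<times> real) set \<Rightarrow> ereal" where
  "perimeter \<alpha> E =
     (SUP (\<phi>\<^sub>1, \<phi>\<^sub>2) \<in> {(\<phi>\<^sub>1, \<phi>\<^sub>2). \<phi>\<^sub>1 \<in> C1_compact_support \<and> \<phi>\<^sub>2 \<in> C1_compact_support
                          \<and> (\<forall>p. sqrt ((\<phi>\<^sub>1 p)\<^sup>2 + (\<phi>\<^sub>2 p)\<^sup>2) \<le> 1)}.
        ereal (LINT p:E|lebesgue. partial_x \<phi>\<^sub>1 p + weight \<alpha> (fst p) * partial_y \<phi>\<^sub>2 p))"


section \<open>Symmetric sets and traces\<close>

definition x_symmetric :: "(real \<times> real) set \<Rightarrow> bool" where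
  "x_symmetric E \<longleftrightarrow> (\<forall>x y. (x, y) \<in> E \<longrightarrow> (- x, y) \<in> E)"

definition y_symmetric :: "(real \<times> real) set \<Rightarrow> bool" where
  "y_symmetric E \<longleftrightarrow> (\<forall>x y. (x, y) \<in> E \<longrightarrow> (x, - y) \<in> E)"

definition y_convex :: "(real \<times> real) set \<Rightarrow> bool" where
  "y_convex E \<longleftrightarrow> (\<forall>x. is_interval {y. (x, y) \<in> E})"

definition y_Schwarz_symmetric :: "(real \<times> real) set \<Rightarrow> bool" where
  "y_Schwarz_symmetric E \<longleftrightarrow> y_symmetric E \<and> y_convex E"

definition Sx :: "(real \<times> real) set set" where
  "Sx = {E \<in> sets lebesgue. x_symmetric E}"

definition Sy_star :: "(real \<times> real) set set" where
  "Sy_star = {E \<in> sets lebesgue. y_Schwarz_symmetric E}"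

text \<open>\<open>is_left_trace E a T\<close> says that the left trace of \<open>E\<close> at \<open>a\<close> exists and is the set \<open>T\<close>.
  The distance to \<open>T\<close> is a nonnegative integral, so that an infinite distance is not
  mistaken for \<open>0\<close>.\<close>

definition is_left_trace :: "(real \<times> real) set \<Rightarrow> real \<Rightarrow> real set \<Rightarrow> bool" where
  "is_left_trace E a T \<longleftrightarrow> (\<exists>b\<ge>0. T = {- b..b}) \<and>
     ((\<lambda>x. \<integral>\<^sup>+ y. ennreal \<bar>indicator E (x, y) - indicator T y\<bar> \<partial>lborel) \<longlongrightarrow> 0) (at_left a)"

definition is_right_trace :: "(real \<times> real) set \<Rightarrow> real \<Rightarrow> real set \<Rightarrow> bool" where
  "is_right_trace E a T \<longleftrightarrow> (\<exists>b\<ge>0. T = {- b..b}) \<and>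
     ((\<lambda>x. \<integral>\<^sup>+ y. ennreal \<bar>indicator E (x, y) - indicator T y\<bar> \<partial>lborel) \<longlongrightarrow> 0) (at_right a)"


section \<open>The partitioning problem\<close>

definition left_part :: "(real \<times> real) set \<Rightarrow> real \<Rightarrow> (real \<times> real) set" where
  "left_part E x\<^sub>0 = {(x, y). (x, y) \<in> E \<and> x < - x\<^sub>0}"

definition center_part :: "(real \<times> real) set \<Rightarrow> real \<Rightarrow> (real \<times> real) set" where
  "center_part E x\<^sub>0 = {(x, y). (x, y) \<in> E \<and> \<bar>x\<bar> < x\<^sub>0}"

definition right_part :: "(real \<times> real) set \<Rightarrow> real \<Rightarrow> (real \<times> real) set" where
  "right_part E x\<^sub>0 = {(x, y). (x, y) \<in> E \<and> x > x\<^sub>0}"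

text \<open>Traces are only considered for sets of finite perimeter, which is why finiteness of the
  perimeter is part of the definition.\<close>

definition is_partitioning_point ::
  "real \<Rightarrow> real \<Rightarrow> real \<Rightarrow> real \<Rightarrow> real \<Rightarrow> (real \<times> real) set \<Rightarrow> real \<Rightarrow> bool" where
  "is_partitioning_point \<alpha> v\<^sub>1 v\<^sub>2 h\<^sub>1 h\<^sub>2 E x\<^sub>0 \<longleftrightarrow>
     x\<^sub>0 > 0 \<and> perimeter \<alpha> E < \<infinity>
     \<and> emeasure lebesgue (center_part E x\<^sub>0) = ennreal v\<^sub>1
     \<and> emeasure lebesgue (left_part E x\<^sub>0) = ennreal (v\<^sub>2 / 2)
     \<and> emeasure lebesgue (right_part E x\<^sub>0) = ennreal (v\<^sub>2 / 2)
     \<and> (\<exists>T. is_left_trace E x\<^sub>0 T \<and> {- h\<^sub>1..h\<^sub>1} \<subseteq> T)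
     \<and> (\<exists>T. is_right_trace E x\<^sub>0 T \<and> {- h\<^sub>2..h\<^sub>2} \<subseteq> T)"

definition class_A ::
  "real \<Rightarrow> real \<Rightarrow> real \<Rightarrow> real \<Rightarrow> real \<Rightarrow> (real \<times> real) set set" where
  "class_A \<alpha> v\<^sub>1 v\<^sub>2 h\<^sub>1 h\<^sub>2 =
     {E \<in> Sx \<inter> Sy_star. \<exists>x\<^sub>0. is_partitioning_point \<alpha> v\<^sub>1 v\<^sub>2 h\<^sub>1 h\<^sub>2 E x\<^sub>0}"

definition partition_perimeter :: "real \<Rightarrow> (real \<times> real) set \<Rightarrow> real \<Rightarrow> ereal" where
  "partition_perimeter \<alpha> E x\<^sub>0 =
     (perimeter \<alpha> (- E) + perimeter \<alpha> (left_part E x\<^sub>0)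
       + perimeter \<alpha> (center_part E x\<^sub>0) + perimeter \<alpha> (right_part E x\<^sub>0)) / 2"

text \<open>A set has Lipschitz boundary if, near each boundary point and in a suitable orthonormal
  frame \<open>(u, w)\<close>, its boundary is the graph of a Lipschitz function and its interior is the
  region below that graph. The set need be neither open nor closed. The empty set qualifies.\<close>

definition Lipschitz_boundary :: "(real \<times> real) set \<Rightarrow> bool" where
  "Lipschitz_boundary S \<longleftrightarrow>
     (\<forall>p \<in> frontier S. \<exists>r>0. \<exists>u w. \<exists>g::real \<Rightarrow> real. \<exists>L.
        norm u = 1 \<and> norm w = 1 \<and> u \<bullet> w = 0 \<and> L-lipschitz_on UNIV g
        \<and> frontier S \<inter> ball p r = {q \<in> ball p r. (q - p) \<bullet> w = g ((q - p) \<bullet> u)}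
        \<and> interior S \<inter> ball p r = {q \<in> ball p r. (q - p) \<bullet> w < g ((q - p) \<bullet> u)})"

text \<open>The functional depends on the set and on its partitioning point, so the minimization is
  over all admissible sets together with all their partitioning points.\<close>

definition regular_solution ::
  "real \<Rightarrow> real \<Rightarrow> real \<Rightarrow> real \<Rightarrow> real \<Rightarrow> (real \<times> real) set \<Rightarrow> real \<Rightarrow> bool" where
  "regular_solution \<alpha> v\<^sub>1 v\<^sub>2 h\<^sub>1 h\<^sub>2 E x\<^sub>0 \<longleftrightarrow>
     E \<in> class_A \<alpha> v\<^sub>1 v\<^sub>2 h\<^sub>1 h\<^sub>2 \<and> is_partitioning_point \<alpha> v\<^sub>1 v\<^sub>2 h\<^sub>1 h\<^sub>2 E x\<^sub>0
     \<and> (\<forall>F \<in> class_A \<alpha> v\<^sub>1 v\<^sub>2 h\<^sub>1 h\<^sub>2. \<forall>z. is_partitioning_point \<alpha> v\<^sub>1 v\<^sub>2 h\<^sub>1 h\<^sub>2 F z \<longrightarrow>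
           partition_perimeter \<alpha> E x\<^sub>0 \<le> partition_perimeter \<alpha> F z)
     \<and> convex (center_part E x\<^sub>0)
     \<and> Lipschitz_boundary (left_part E x\<^sub>0) \<and> Lipschitz_boundary (right_part E x\<^sub>0)"


section \<open>The profile function\<close>

text \<open>Only meaningful for \<open>\<bar>x\<bar> \<le> 1\<close>.\<close>

definition profile :: "real \<Rightarrow> real \<Rightarrow> real" where
  "profile \<alpha> x = integral {arcsin \<bar>x\<bar>..pi / 2} (\<lambda>t. sin t powr (\<alpha> + 1))"

end

theory Submission
  imports Defs
begin

text \<open>
  The center of a regular solution is, up to a null set, the region \<open>\<bar>y\<bar> < f x\<close>, \<open>\<bar>x\<bar> < x\<^sub>0\<close>
  below a concave graph of boundary height \<open>h\<^sub>1\<close>. Fields whose horizontal component is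
  \<open>g x = s x / x\<^sub>0\<close> bound its perimeter from below by an explicit function of \<open>x\<^sub>0\<close>; keeping the
  boundary value \<open>s\<close> of \<open>g\<close> fixed instead of its slope makes this function have a
  unique minimum \<open>X\<close>. The parameters \<open>s\<close> and \<open>X\<close> can be chosen such that the extremal graph,
  whose unit normal is the field, has the prescribed area, meets the vertical
  sides in a stationary way, and attains the bound. Hence every regular solution has \<open>x\<^sub>0 = X\<close> and its
  perimeter equals the bound, and a perturbation of the field shows that \<open>f\<close> is the
  extremal graph.
\<close>

section \<open>Test fields and the perimeter\<close>

text \<open>Since the outer volume is 0, the outer parts are null sets and the functional reduces to
  the \<alpha>-perimeter of the center. Competitors may differ in width, so a field on the strip of
  half-width Z has to give a bound that depends on the competitor through Z alone. This is why the
  horizontal component is linear: its constant slope multiplies the area, which is prescribed. If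
  the slope were kept at s / X for every Z, the bound for \<alpha> = 0 would be concave in Z with
  critical point X, so X would be its maximum, and the field would exist only up to Z = X / s.

  The vertical sides count with their full length, although the field crosses them with component s
  < 1 only. The lower bound therefore needs a boundary layer in which the field turns horizontal.

  A concave f is not known to be C1 up to the sides, so uniqueness is not read off from equality in
  Cauchy-Schwarz along the graph; the field is varied instead of the graph.\<close>

lemma weight_nat: "weight (real m) x = \<bar>x\<bar> ^ m"
  by (cases "x = 0") (auto simp: weight_def powr_realpow)

lemma C1_continuous:
  assumes "\<phi> \<in> C1_compact_support"
  shows "continuous_on UNIV \<phi>" "continuous_on UNIV (partial_x \<phi>)" "continuous_on UNIV (partial_y \<phi>)"
  using assms differentiable_imp_continuous_on by (auto simp: C1_compact_support_def)

lemma has_derivative_partials: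
  assumes "(\<phi> has_derivative D) (at (x, y))"
  shows "partial_x \<phi> (x, y) = D (1, 0)" "partial_y \<phi> (x, y) = D (0, 1)"
proof -
  have "((\<lambda>s. \<phi> (s, y)) has_derivative (\<lambda>s. D (s, 0))) (at x)"
    using assms by (auto intro!: derivative_eq_intros has_derivative_compose[where g=\<phi>])
  moreover have "(\<lambda>s. D (s, 0)) = (*) (D (1, 0))"
  proof (rule ext)
    fix s :: real
    have "D (s *\<^sub>R (1, 0)) = D (1, 0) * s"
      unfolding linear_cmul[OF has_derivative_linear[OF assms]] by simp
    then show "D (s, 0) = D (1, 0) * s" by (simp only: scaleR_Pair real_scaleR_def mult_1_right mult_zero_right)
  qed
  ultimately have "((\<lambda>s. \<phi> (s, y)) has_real_derivative D (1, 0)) (at x)"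
    by (simp only: has_field_derivative_def)
  then show "partial_x \<phi> (x, y) = D (1, 0)"
    by (simp add: partial_x_def DERIV_imp_deriv)
  have "((\<lambda>s. \<phi> (x, s)) has_derivative (\<lambda>s. D (0, s))) (at y)"
    using assms by (auto intro!: derivative_eq_intros has_derivative_compose[where g=\<phi>])
  moreover have "(\<lambda>s. D (0, s)) = (*) (D (0, 1))"
  proof (rule ext)
    fix s :: real
    have "D (s *\<^sub>R (0, 1)) = D (0, 1) * s"
      unfolding linear_cmul[OF has_derivative_linear[OF assms]] by simp
    then show "D (0, s) = D (0, 1) * s" by (simp only: scaleR_Pair real_scaleR_def mult_1_right mult_zero_right)
  qed
  ultimately have "((\<lambda>s. \<phi> (x, s)) has_real_derivative D (0, 1)) (at y)"
    by (simp only: has_field_derivative_def)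
  then show "partial_y \<phi> (x, y) = D (0, 1)"
    by (simp add: partial_y_def DERIV_imp_deriv)
qed

lemma C1_has_derivative:
  assumes "\<phi> \<in> C1_compact_support"
  shows "(\<phi> has_derivative (\<lambda>(u, v). partial_x \<phi> p * u + partial_y \<phi> p * v)) (at p)"
proof -
  obtain x y where p: "p = (x, y)" by (cases p)
  obtain D where D: "(\<phi> has_derivative D) (at p)"
    using assms unfolding p by (auto simp: C1_compact_support_def differentiable_on_def differentiable_def)
  have "D (u, v) = partial_x \<phi> p * u + partial_y \<phi> p * v" for u v
  proof -
    have "D (u, v) = D (u *\<^sub>R (1, 0) + v *\<^sub>R (0, 1))" by simp
    also have "\<dots> = u *\<^sub>R D (1, 0) + v *\<^sub>R D (0, 1)"
      using has_derivative_linear[OF D] by (simp only: linear_add linear_cmul)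
    finally show ?thesis using has_derivative_partials D p by simp
  qed
  then have "D = (\<lambda>(u, v). partial_x \<phi> p * u + partial_y \<phi> p * v)" by auto
  with D show ?thesis by simp
qed

lemma C1_chain:
  assumes "\<phi> \<in> C1_compact_support"
    and "(a has_real_derivative a') (at t within S)" "(b has_real_derivative b') (at t within S)"
  shows "((\<lambda>t. \<phi> (a t, b t)) has_real_derivative
    partial_x \<phi> (a t, b t) * a' + partial_y \<phi> (a t, b t) * b') (at t within S)"
proof -
  have "((\<lambda>t. (a t, b t)) has_derivative (\<lambda>h. (a' * h, b' * h))) (at t within S)"
    using assms(2,3) by (intro has_derivative_Pair) (auto simp: has_field_derivative_def)
  from has_derivative_compose[OF this C1_has_derivative[OF assms(1)]]
  have "((\<lambda>t. \<phi> (a t, b t)) has_derivative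
     (\<lambda>h. partial_x \<phi> (a t, b t) * (a' * h) + partial_y \<phi> (a t, b t) * (b' * h))) (at t within S)"
    by simp
  then show ?thesis
    unfolding has_field_derivative_def by (rule has_derivative_eq_rhs) (auto simp: algebra_simps)
qed

lemma C1_zero: "(\<lambda>p. 0) \<in> C1_compact_support"
  by (auto simp: C1_compact_support_def partial_x_def partial_y_def case_prod_beta)

lemma C1_uminus:
  assumes "\<phi> \<in> C1_compact_support"
  shows "(\<lambda>p. - \<phi> p) \<in> C1_compact_support"
    and "partial_x (\<lambda>p. - \<phi> p) p = - partial_x \<phi> p"
    and "partial_y (\<lambda>p. - \<phi> p) p = - partial_y \<phi> p"
proof -
  have D: "((\<lambda>p. - \<phi> p) has_derivative (\<lambda>(u, v). - partial_x \<phi> p * u - partial_y \<phi> p * v)) (at p)" for p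
    using has_derivative_minus[OF C1_has_derivative[OF assms, of p]]
    by (rule has_derivative_eq_rhs) auto
  have px: "partial_x (\<lambda>p. - \<phi> p) p = - partial_x \<phi> p" for p
    using has_derivative_partials(1)[OF D[of "(fst p, snd p)"]] by simp
  have py: "partial_y (\<lambda>p. - \<phi> p) p = - partial_y \<phi> p" for p
    using has_derivative_partials(2)[OF D[of "(fst p, snd p)"]] by simp
  show "partial_x (\<lambda>p. - \<phi> p) p = - partial_x \<phi> p" "partial_y (\<lambda>p. - \<phi> p) p = - partial_y \<phi> p"
    by fact+
  have "partial_x (\<lambda>p. - \<phi> p) = (\<lambda>p. - partial_x \<phi> p)" "partial_y (\<lambda>p. - \<phi> p) = (\<lambda>p. - partial_y \<phi> p)"
    using px py by auto
  moreover have "(\<lambda>p. - \<phi> p) differentiable_on UNIV"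
    using D by (auto simp: differentiable_on_def differentiable_def)
  ultimately show "(\<lambda>p. - \<phi> p) \<in> C1_compact_support"
    using assms by (auto simp: C1_compact_support_def intro!: continuous_intros)
qed

text \<open>The exponent is a natural number from here on, so that \<open>0 ^ 0 = 1\<close> absorbs
  the case distinction in \<open>weight\<close>.\<close>

definition wdiv :: "nat \<Rightarrow> (real \<times> real \<Rightarrow> real) \<Rightarrow> (real \<times> real \<Rightarrow> real) \<Rightarrow> real \<times> real \<Rightarrow> real" where
  "wdiv m \<phi>\<^sub>1 \<phi>\<^sub>2 p = partial_x \<phi>\<^sub>1 p + \<bar>fst p\<bar> ^ m * partial_y \<phi>\<^sub>2 p"

definition test_fields :: "((real \<times> real \<Rightarrow> real) \<times> (real \<times> real \<Rightarrow> real)) set" where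
  "test_fields = {(\<phi>\<^sub>1, \<phi>\<^sub>2). \<phi>\<^sub>1 \<in> C1_compact_support \<and> \<phi>\<^sub>2 \<in> C1_compact_support
                          \<and> (\<forall>p. sqrt ((\<phi>\<^sub>1 p)\<^sup>2 + (\<phi>\<^sub>2 p)\<^sup>2) \<le> 1)}"

lemma perimeter_altdef:
  "perimeter (real m) E = (SUP (\<phi>\<^sub>1, \<phi>\<^sub>2) \<in> test_fields. ereal (LINT p:E|lebesgue. wdiv m \<phi>\<^sub>1 \<phi>\<^sub>2 p))"
  unfolding perimeter_def test_fields_def wdiv_def weight_nat by simp

lemma perimeter_geI:
  assumes "(\<phi>\<^sub>1, \<phi>\<^sub>2) \<in> test_fields"
  shows "ereal (LINT p:E|lebesgue. wdiv m \<phi>\<^sub>1 \<phi>\<^sub>2 p) \<le> perimeter (real m) E"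
  unfolding perimeter_altdef using assms by (intro SUP_upper2) auto

lemma perimeter_leI:
  assumes "\<And>\<phi>\<^sub>1 \<phi>\<^sub>2. (\<phi>\<^sub>1, \<phi>\<^sub>2) \<in> test_fields \<Longrightarrow> ereal (LINT p:E|lebesgue. wdiv m \<phi>\<^sub>1 \<phi>\<^sub>2 p) \<le> c"
  shows "perimeter (real m) E \<le> c"
  unfolding perimeter_altdef using assms by (auto intro!: SUP_least)

lemma continuous_wdiv:
  assumes "\<phi>\<^sub>1 \<in> C1_compact_support" "\<phi>\<^sub>2 \<in> C1_compact_support"
  shows "continuous_on UNIV (wdiv m \<phi>\<^sub>1 \<phi>\<^sub>2)"
  unfolding wdiv_def using C1_continuous[OF assms(1)] C1_continuous[OF assms(2)]
  by (intro continuous_intros) (auto simp: eta_contract_eq)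

lemma perimeter_nonneg: "0 \<le> perimeter (real m) E"
proof -
  have "(\<lambda>p. 0, \<lambda>p. 0) \<in> test_fields" by (auto simp: test_fields_def C1_zero)
  from perimeter_geI[OF this, of E m] show ?thesis
    by (auto simp: wdiv_def partial_x_def partial_y_def case_prod_beta zero_ereal_def
          set_lebesgue_integral_def)
qed

text \<open>Each test integral ignores null sets. This is what later allows a set to be replaced by
  the open interior of its convex center.\<close>

lemma perimeter_mono_null:
  assumes "A \<in> sets lebesgue" "B \<in> sets lebesgue" "A - B \<union> (B - A) \<in> null_sets lebesgue"
  shows "perimeter (real m) A \<le> perimeter (real m) B"
proof (rule perimeter_leI)
  fix \<phi>\<^sub>1 \<phi>\<^sub>2 assume t: "(\<phi>\<^sub>1, \<phi>\<^sub>2) \<in> test_fields"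
  then have "continuous_on UNIV (wdiv m \<phi>\<^sub>1 \<phi>\<^sub>2)" by (auto intro: continuous_wdiv simp: test_fields_def)
  then have m: "wdiv m \<phi>\<^sub>1 \<phi>\<^sub>2 \<in> borel_measurable lebesgue"
    by (simp add: borel_measurable_continuous_onI measurable_completion)
  have "(LINT p:A|lebesgue. wdiv m \<phi>\<^sub>1 \<phi>\<^sub>2 p) = (LINT p:B|lebesgue. wdiv m \<phi>\<^sub>1 \<phi>\<^sub>2 p)"
    unfolding set_lebesgue_integral_def
  proof (rule integral_cong_AE)
    show "AE x in lebesgue. indicator A x *\<^sub>R wdiv m \<phi>\<^sub>1 \<phi>\<^sub>2 x = indicator B x *\<^sub>R wdiv m \<phi>\<^sub>1 \<phi>\<^sub>2 x"
      by (rule AE_I'[OF assms(3)]) (auto split: split_indicator)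
  qed (use m assms in measurable)
  with perimeter_geI[OF t, of B m] show "ereal (LINT p:A|lebesgue. wdiv m \<phi>\<^sub>1 \<phi>\<^sub>2 p) \<le> perimeter (real m) B"
    by simp
qed

lemma perimeter_cong_null:
  assumes "A \<in> sets lebesgue" "B \<in> sets lebesgue" "A - B \<union> (B - A) \<in> null_sets lebesgue"
  shows "perimeter (real m) A = perimeter (real m) B"
  using perimeter_mono_null[OF assms, of m] perimeter_mono_null[OF assms(2,1), of m] assms(3)
  by (simp add: Un_commute antisym)

lemma perimeter_empty: "perimeter (real m) {} = 0"
  by (intro antisym perimeter_nonneg perimeter_leI)
     (auto simp: set_lebesgue_integral_def zero_ereal_def)

section \<open>Divergence theorem between a graph and its mirror image\<close>

definition subgraph :: "real \<Rightarrow> (real \<Rightarrow> real) \<Rightarrow> (real \<times> real) set" where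
  "subgraph X f = {(x, y). \<bar>x\<bar> < X \<and> \<bar>y\<bar> < f x}"

lemma open_subgraph:
  assumes "continuous_on {-X..X} f"
  shows "open (subgraph X f)"
proof (cases "X \<ge> 0")
  case True
  \<comment> \<open>Clamping the argument extends \<open>f\<close> continuously to the line, so that
    both constraints become open conditions on the plane.\<close>
  define F where "F x = f (max (-X) (min X x))" for x
  have "continuous_on UNIV F"
    unfolding F_def using True
    by (intro continuous_on_compose2[OF assms] continuous_intros) auto
  then have "open {p :: real \<times> real. \<bar>fst p\<bar> < X}" "open {p. \<bar>snd p\<bar> < F (fst p)}"
    by (auto intro!: open_Collect_less continuous_intros continuous_on_compose2[of UNIV F])
  moreover have "subgraph X f = {p. \<bar>fst p\<bar> < X} \<inter> {p. \<bar>snd p\<bar> < F (fst p)}"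
    by (auto simp: subgraph_def F_def max_def min_def)
  ultimately show ?thesis by auto
next
  case False
  then have "subgraph X f = {}" by (auto simp: subgraph_def)
  then show ?thesis by simp
qed

lemma integral_subgraph:
  assumes X: "X > 0" and f: "continuous_on {-X..X} f" and D: "continuous_on UNIV (D :: real \<times> real \<Rightarrow> real)"
  shows "set_integrable lebesgue (subgraph X f) D" (is ?A)
    and "(LINT p:subgraph X f|lebesgue. D p)
       = integral {-X..X} (\<lambda>x. integral {- f x..f x} (\<lambda>y. D (x, y)))" (is ?B)
proof -
  let ?U = "subgraph X f"
  have U: "?U \<in> sets borel" using open_subgraph[OF f] by auto
  have "bounded (f ` {-X..X})"
    by (intro compact_imp_bounded compact_continuous_image f compact_Icc)
  then obtain M where "\<forall>y\<in>f ` {-X..X}. norm y \<le> M" unfolding bounded_iff by blast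
  then have M: "\<bar>f x\<bar> \<le> M" if "x \<in> {-X..X}" for x using that by simp
  have "compact ({-X..X} \<times> {-M..M})" by (intro compact_Times compact_Icc)
  then have "set_integrable lborel ({-X..X} \<times> {-M..M}) D"
    unfolding set_integrable_def
    using borel_integrable_compact continuous_on_subset[OF D] by blast
  moreover have "?U \<subseteq> {-X..X} \<times> {-M..M}"
  proof clarify
    fix x y assume "(x, y) \<in> ?U"
    then have *: "x \<in> {-X..X}" "\<bar>y\<bar> < f x" by (auto simp: subgraph_def)
    with M[OF *(1)] have "\<bar>y\<bar> \<le> M" by linarith
    with * show "x \<in> {-X..X} \<and> y \<in> {-M..M}" by auto
  qed
  ultimately have int: "set_integrable lborel ?U D"
    using U by (intro set_integrable_subset[of lborel _ D ?U]) auto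
  then show ?A
    unfolding set_integrable_def
    by (subst integrable_completion) auto
  define H where "H p = indicator ?U p *\<^sub>R D p" for p
  have intH: "integrable (lborel \<Otimes>\<^sub>M lborel) H"
    using int unfolding set_integrable_def lborel_prod H_def[abs_def] by simp
  define I where "I x = integral {- f x..f x} (\<lambda>y. D (x, y))" for x
  have inner: "(LINT y|lborel. H (x, y)) = indicator {-X<..<X} x *\<^sub>R I x" for x
  proof (cases "\<bar>x\<bar> < X")
    case True
    have "set_integrable lborel {- f x..f x} (\<lambda>y. D (x, y))"
      unfolding set_integrable_def
      by (intro borel_integrable_compact compact_Icc continuous_on_compose2[OF D] continuous_intros) auto
    then have "set_integrable lborel {- f x<..<f x} (\<lambda>y. D (x, y))"
      by (rule set_integrable_subset) auto
    note set_borel_integral_eq_integral(2)[OF this]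
    moreover have "H (x, y) = indicator {- f x<..<f x} y *\<^sub>R D (x, y)" for y
      using True by (auto simp: H_def subgraph_def split: split_indicator)
    moreover have "indicator {-X<..<X} x = (1::real)" using True by (simp add: indicator_def abs_less_iff)
    ultimately show ?thesis
      by (simp add: set_lebesgue_integral_def I_def integral_open_interval_real)
  next
    case False
    then have "H (x, y) = 0" for y by (auto simp: H_def subgraph_def)
    moreover have "indicator {-X<..<X} x = (0::real)" using False by (auto simp: indicator_def)
    ultimately show ?thesis by simp
  qed
  have "set_integrable lborel {-X<..<X} I"
    using lborel_pair.integrable_fst'[OF intH] unfolding inner set_integrable_def .
  from set_borel_integral_eq_integral(2)[OF this]
  have outer: "(LINT x|lborel. indicator {-X<..<X} x *\<^sub>R I x) = integral {-X..X} I"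
    unfolding set_lebesgue_integral_def integral_open_interval_real .
  have "(LINT p:?U|lebesgue. D p) = integral\<^sup>L (lborel \<Otimes>\<^sub>M lborel) H"
    unfolding set_lebesgue_integral_def lborel_prod H_def[abs_def]
    by (rule integral_completion) (use int in \<open>auto simp: set_integrable_def\<close>)
  also have "\<dots> = integral {-X..X} I"
    unfolding lborel_pair.integral_fst'[OF intH, symmetric] inner outer ..
  finally show ?B unfolding I_def[abs_def] .
qed

text \<open>The substitution \<open>y = f x * t\<close> replaces the varying sections by the fixed
  interval \<open>{-1..1}\<close>. The x-derivative \<open>h x t\<close> of
  \<open>f x * \<phi>\<^sub>1 (x, f x * t)\<close> is integrated over the resulting rectangle in
  both orders: \<open>x\<close> first leaves the vertical sides, \<open>t\<close> first leaves the
  sections and the graph. This avoids differentiating an integral with moving limits.\<close>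

lemma divergence_subgraph:
  assumes X: "X > 0"
    and f: "\<And>x. x \<in> {-X..X} \<Longrightarrow> (f has_real_derivative f' x) (at x within {-X..X})"
    and f': "continuous_on {-X..X} f'" and pos: "\<And>x. x \<in> {-X..X} \<Longrightarrow> f x > 0"
    and \<phi>\<^sub>1: "\<phi>\<^sub>1 \<in> C1_compact_support" and \<phi>\<^sub>2: "\<phi>\<^sub>2 \<in> C1_compact_support"
  shows "(LINT p:subgraph X f|lebesgue. wdiv m \<phi>\<^sub>1 \<phi>\<^sub>2 p) =
     integral {-1..1} (\<lambda>t. f X * \<phi>\<^sub>1 (X, f X * t) - f (-X) * \<phi>\<^sub>1 (-X, f (-X) * t))
     + integral {-X..X} (\<lambda>x. \<bar>x\<bar> ^ m * (\<phi>\<^sub>2 (x, f x) - \<phi>\<^sub>2 (x, - f x))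
                              - f' x * (\<phi>\<^sub>1 (x, f x) + \<phi>\<^sub>1 (x, - f x)))"
proof -
  let ?I = "{-X..X}" and ?J = "{-1..1::real}"
  note c1 = C1_continuous[OF \<phi>\<^sub>1] and c2 = C1_continuous[OF \<phi>\<^sub>2]
  note comp = continuous_on_compose2[OF c1(1)] continuous_on_compose2[OF c1(2)] continuous_on_compose2[OF c1(3)]
    continuous_on_compose2[OF c2(1)] continuous_on_compose2[OF c2(2)] continuous_on_compose2[OF c2(3)]
  have fc: "continuous_on ?I f" using f by (rule DERIV_continuous_on)
  define A where "A x = integral ?J (\<lambda>t. f x * partial_x \<phi>\<^sub>1 (x, f x * t))" for x
  define h where "h x t = f' x * \<phi>\<^sub>1 (x, f x * t)
     + f x * (partial_x \<phi>\<^sub>1 (x, f x * t) + partial_y \<phi>\<^sub>1 (x, f x * t) * (f' x * t))" for x t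
  have fst_c: "continuous_on (?I \<times> ?J) (\<lambda>p. f (fst p))" "continuous_on (?I \<times> ?J) (\<lambda>p. f' (fst p))"
    by (auto intro!: continuous_on_compose2[OF fc] continuous_on_compose2[OF f'] continuous_on_fst continuous_on_id)
  then have pc: "continuous_on (?I \<times> ?J) (\<lambda>p. (fst p, f (fst p) * snd p))"
    by (intro continuous_on_Pair continuous_on_mult continuous_on_fst continuous_on_snd continuous_on_id)
  have hc: "continuous_on (?I \<times> ?J) (\<lambda>p. h (fst p) (snd p))"
    unfolding h_def
    by (intro continuous_on_add continuous_on_mult continuous_on_snd continuous_on_id fst_c
          continuous_on_compose2[OF c1(1) pc subset_UNIV] continuous_on_compose2[OF c1(2) pc subset_UNIV]
          continuous_on_compose2[OF c1(3) pc subset_UNIV])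
  have inner: "integral {- f x..f x} (\<lambda>y. wdiv m \<phi>\<^sub>1 \<phi>\<^sub>2 (x, y))
      = A x + \<bar>x\<bar> ^ m * (\<phi>\<^sub>2 (x, f x) - \<phi>\<^sub>2 (x, - f x))" if x: "x \<in> ?I" for x
  proof -
    have "((\<lambda>t. f x *\<^sub>R partial_x \<phi>\<^sub>1 (x, f x * t)) has_integral
       integral {f x * -1..f x * 1} (\<lambda>y. partial_x \<phi>\<^sub>1 (x, y))) ?J"
    proof (rule has_integral_substitution[where g="\<lambda>t. f x * t" and g'="\<lambda>_. f x"
          and f="\<lambda>y. partial_x \<phi>\<^sub>1 (x, y)" and a="-1" and b=1 and c="- f x" and d="f x"])
      show "(\<lambda>t. f x * t) ` ?J \<subseteq> {- f x..f x}"
      proof clarify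
        fix t :: real assume "t \<in> ?J"
        then have "f x * \<bar>t\<bar> \<le> f x * 1" using pos[OF x] by (intro mult_left_mono) auto
        then have "\<bar>f x * t\<bar> \<le> f x" using pos[OF x] by (simp add: abs_mult)
        then show "f x * t \<in> {- f x..f x}" by (simp add: abs_le_iff)
      qed
      show "continuous_on {- f x..f x} (\<lambda>y. partial_x \<phi>\<^sub>1 (x, y))"
        by (intro continuous_on_compose2[OF c1(2)] continuous_intros) auto
      show "((\<lambda>t. f x * t) has_real_derivative f x) (at t within ?J)" for t
        by (auto intro!: derivative_eq_intros)
    qed (use pos[OF x] in auto)
    from integral_unique[OF this] have 1: "integral {- f x..f x} (\<lambda>y. partial_x \<phi>\<^sub>1 (x, y)) = A x"
      by (simp add: A_def)
    have "((\<lambda>y. partial_y \<phi>\<^sub>2 (x, y)) has_integral \<phi>\<^sub>2 (x, f x) - \<phi>\<^sub>2 (x, - f x)) {- f x..f x}"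
    proof (rule fundamental_theorem_of_calculus)
      fix y
      show "((\<lambda>y. \<phi>\<^sub>2 (x, y)) has_vector_derivative partial_y \<phi>\<^sub>2 (x, y)) (at y within {- f x..f x})"
        using C1_chain[OF \<phi>\<^sub>2, of "\<lambda>_. x" 0 y "{- f x..f x}" "\<lambda>y. y" 1]
        by (simp add: has_real_derivative_iff_has_vector_derivative)
    qed (use pos[OF x] in simp)
    then have 2: "((\<lambda>y. \<bar>x\<bar>^m * partial_y \<phi>\<^sub>2 (x, y)) has_integral \<bar>x\<bar>^m * (\<phi>\<^sub>2 (x, f x) - \<phi>\<^sub>2 (x, - f x))) {- f x..f x}"
      by (intro has_integral_mult_right)
    have "(\<lambda>y. partial_x \<phi>\<^sub>1 (x, y)) integrable_on {- f x..f x}"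
      by (intro integrable_continuous_interval continuous_on_compose2[OF c1(2)] continuous_intros) auto
    with 1 have "((\<lambda>y. partial_x \<phi>\<^sub>1 (x, y)) has_integral A x) {- f x..f x}"
      by (simp add: has_integral_iff)
    from has_integral_add[OF this 2] show ?thesis
      by (simp add: wdiv_def integral_unique)
  qed
  have int_t: "integral ?J (h x) = A x + f' x * (\<phi>\<^sub>1 (x, f x) + \<phi>\<^sub>1 (x, - f x))" if x: "x \<in> ?I" for x
  proof -
    \<comment> \<open>The bracket is the t-derivative of
      \<open>t * \<phi>\<^sub>1 (x, f x * t)\<close>, so only the values at \<open>t = 1\<close> and
      \<open>t = -1\<close> remain.\<close>
    have "((\<lambda>t. f' x * (\<phi>\<^sub>1 (x, f x * t) + t * (partial_y \<phi>\<^sub>1 (x, f x * t) * f x)))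
       has_integral f' x * (1 * \<phi>\<^sub>1 (x, f x * 1)) - f' x * (-1 * \<phi>\<^sub>1 (x, f x * -1))) ?J"
    proof (rule fundamental_theorem_of_calculus)
      fix t :: real
      have "((\<lambda>t. \<phi>\<^sub>1 (x, f x * t)) has_real_derivative partial_y \<phi>\<^sub>1 (x, f x * t) * f x) (at t within ?J)"
        using C1_chain[OF \<phi>\<^sub>1, of "\<lambda>_. x" 0 t ?J "\<lambda>t. f x * t" "f x"]
        by (auto intro: derivative_eq_intros)
      then show "((\<lambda>t. f' x * (t * \<phi>\<^sub>1 (x, f x * t))) has_vector_derivative
         f' x * (\<phi>\<^sub>1 (x, f x * t) + t * (partial_y \<phi>\<^sub>1 (x, f x * t) * f x))) (at t within ?J)"
        unfolding has_real_derivative_iff_has_vector_derivative[symmetric]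
        by (auto intro!: derivative_eq_intros)
    qed simp
    moreover have "((\<lambda>t. f x * partial_x \<phi>\<^sub>1 (x, f x * t)) has_integral A x) ?J"
      unfolding A_def
      by (intro integrable_integral integrable_continuous_interval continuous_on_mult continuous_on_const
            continuous_on_compose2[OF c1(2)] continuous_intros) auto
    ultimately have "((\<lambda>t. f x * partial_x \<phi>\<^sub>1 (x, f x * t) +
         f' x * (\<phi>\<^sub>1 (x, f x * t) + t * (partial_y \<phi>\<^sub>1 (x, f x * t) * f x)))
       has_integral A x + (f' x * (1 * \<phi>\<^sub>1 (x, f x * 1)) - f' x * (-1 * \<phi>\<^sub>1 (x, f x * -1)))) ?J"
      by (intro has_integral_add)
    moreover have "(\<lambda>t. f x * partial_x \<phi>\<^sub>1 (x, f x * t) +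
         f' x * (\<phi>\<^sub>1 (x, f x * t) + t * (partial_y \<phi>\<^sub>1 (x, f x * t) * f x))) = h x"
      by (auto simp: h_def algebra_simps)
    ultimately show ?thesis by (simp add: integral_unique algebra_simps)
  qed
  have int_x: "integral ?I (\<lambda>x. h x t) = f X * \<phi>\<^sub>1 (X, f X * t) - f (-X) * \<phi>\<^sub>1 (-X, f (-X) * t)" for t
  proof (rule integral_unique, rule fundamental_theorem_of_calculus)
    fix x assume x: "x \<in> ?I"
    have "((\<lambda>x. \<phi>\<^sub>1 (x, f x * t)) has_real_derivative
       partial_x \<phi>\<^sub>1 (x, f x * t) * 1 + partial_y \<phi>\<^sub>1 (x, f x * t) * (f' x * t)) (at x within ?I)"
      using f[OF x] by (intro C1_chain[OF \<phi>\<^sub>1]) (auto intro!: derivative_eq_intros)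
    with f[OF x] show "((\<lambda>x. f x * \<phi>\<^sub>1 (x, f x * t)) has_vector_derivative h x t) (at x within ?I)"
      unfolding has_real_derivative_iff_has_vector_derivative[symmetric]
      by (auto intro!: derivative_eq_intros simp: h_def algebra_simps)
  qed (use X in simp)
  have "integral ?I (\<lambda>x. A x + f' x * (\<phi>\<^sub>1 (x, f x) + \<phi>\<^sub>1 (x, - f x)))
      = integral ?I (\<lambda>x. integral ?J (h x))"
    by (intro integral_cong) (simp add: int_t)
  also have "\<dots> = integral ?J (\<lambda>t. integral ?I (\<lambda>x. h x t))"
    using integral_swap_continuous[of "-X" "-1" X 1 h] hc
    by (simp add: cbox_Pair_eq case_prod_unfold)
  finally have sw: "integral ?I (\<lambda>x. A x + f' x * (\<phi>\<^sub>1 (x, f x) + \<phi>\<^sub>1 (x, - f x))) =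
      integral ?J (\<lambda>t. f X * \<phi>\<^sub>1 (X, f X * t) - f (-X) * \<phi>\<^sub>1 (-X, f (-X) * t))"
    unfolding int_x .
  let ?q = "\<lambda>x. f' x * (\<phi>\<^sub>1 (x, f x) + \<phi>\<^sub>1 (x, - f x))" and ?r = "\<lambda>x. \<bar>x\<bar> ^ m * (\<phi>\<^sub>2 (x, f x) - \<phi>\<^sub>2 (x, - f x))"
  have qr: "continuous_on ?I ?q" "continuous_on ?I ?r"
    by (intro continuous_intros comp fc f'; simp)+
  \<comment> \<open>Continuity of \<open>A\<close> is read off from \<open>int_t\<close>, which
    writes it as a difference of continuous functions.\<close>
  have "continuous_on ?I (\<lambda>x. integral ?J (h x))"
    using integral_continuous_on_param[of ?I "-1" 1 "\<lambda>x. h x"] hc by (simp add: case_prod_unfold)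
  then have "continuous_on ?I (\<lambda>x. integral ?J (h x) - ?q x)" by (intro continuous_intros qr)
  then have "continuous_on ?I A" by (rule continuous_on_eq) (simp add: int_t)
  note ci = this[THEN integrable_continuous_interval] qr[THEN integrable_continuous_interval]
  have "integral ?I (\<lambda>x. integral {- f x..f x} (\<lambda>y. wdiv m \<phi>\<^sub>1 \<phi>\<^sub>2 (x, y))) = integral ?I (\<lambda>x. A x + ?r x)"
    by (intro integral_cong inner)
  also have "\<dots> = integral ?I (\<lambda>x. A x + ?q x) + integral ?I (\<lambda>x. ?r x - ?q x)"
    using ci by (simp add: integral_add integral_diff)
  finally show ?thesis
    unfolding integral_subgraph(2)[OF X fc continuous_wdiv[OF \<phi>\<^sub>1 \<phi>\<^sub>2]] sw .
qed

section \<open>Perimeter of complements\<close>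

lemma C1_bounded_support:
  assumes "\<phi> \<in> C1_compact_support"
  obtains R where "R > 0"
    "\<And>p. \<bar>fst p\<bar> \<ge> R \<or> \<bar>snd p\<bar> \<ge> R \<Longrightarrow> \<phi> p = 0 \<and> partial_x \<phi> p = 0 \<and> partial_y \<phi> p = 0"
proof -
  have "compact (closure {p. \<phi> p \<noteq> 0})" using assms by (simp add: C1_compact_support_def)
  then have "bounded (closure {p. \<phi> p \<noteq> 0})" by (rule compact_imp_bounded)
  then obtain B where B: "\<forall>p\<in>closure {p. \<phi> p \<noteq> 0}. norm p \<le> B"
    unfolding bounded_iff by blast
  have "\<phi> p = 0 \<and> partial_x \<phi> p = 0 \<and> partial_y \<phi> p = 0"
    if "\<bar>fst p\<bar> \<ge> \<bar>B\<bar> + 1 \<or> \<bar>snd p\<bar> \<ge> \<bar>B\<bar> + 1" for p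
  proof -
    have "norm p > B"
      using that norm_fst_le[of "fst p" "snd p"] norm_snd_le[of "snd p" "fst p"] by auto
    then have p: "p \<in> - closure {p. \<phi> p \<noteq> 0}" using B by auto
    have "((\<lambda>_. 0) has_derivative (\<lambda>_. 0)) (at p)" by simp
    then have "(\<phi> has_derivative (\<lambda>_. 0)) (at p)"
      by (rule has_derivative_transform_within_open[OF _ _ p])
         (use closure_subset[of "{p. \<phi> p \<noteq> 0}"] in auto)
    then have "partial_x \<phi> p = 0" "partial_y \<phi> p = 0"
      using has_derivative_partials[of \<phi> _ "fst p" "snd p"] by auto
    with p closure_subset[of "{p. \<phi> p \<noteq> 0}"] show ?thesis by auto
  qed
  then show ?thesis using that[of "\<bar>B\<bar> + 1"] by auto
qed

text \<open>Both components vanish outside a large square, so all boundary terms of the divergence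
  theorem on that square are 0.\<close>

lemma wdiv_integral_UNIV:
  assumes \<phi>\<^sub>1: "\<phi>\<^sub>1 \<in> C1_compact_support" and \<phi>\<^sub>2: "\<phi>\<^sub>2 \<in> C1_compact_support"
  shows "integrable lebesgue (wdiv m \<phi>\<^sub>1 \<phi>\<^sub>2)" "integral\<^sup>L lebesgue (wdiv m \<phi>\<^sub>1 \<phi>\<^sub>2) = 0"
proof -
  obtain R\<^sub>1 where R1: "R\<^sub>1 > 0"
    "\<And>p. \<bar>fst p\<bar> \<ge> R\<^sub>1 \<or> \<bar>snd p\<bar> \<ge> R\<^sub>1 \<Longrightarrow> \<phi>\<^sub>1 p = 0 \<and> partial_x \<phi>\<^sub>1 p = 0 \<and> partial_y \<phi>\<^sub>1 p = 0"
    using C1_bounded_support[OF \<phi>\<^sub>1] by blast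
  obtain R\<^sub>2 where R2: "R\<^sub>2 > 0"
    "\<And>p. \<bar>fst p\<bar> \<ge> R\<^sub>2 \<or> \<bar>snd p\<bar> \<ge> R\<^sub>2 \<Longrightarrow> \<phi>\<^sub>2 p = 0 \<and> partial_x \<phi>\<^sub>2 p = 0 \<and> partial_y \<phi>\<^sub>2 p = 0"
    using C1_bounded_support[OF \<phi>\<^sub>2] by blast
  define R where "R = max R\<^sub>1 R\<^sub>2"
  have R: "R > 0" "R \<ge> R\<^sub>1" "R \<ge> R\<^sub>2" using R1 R2 by (auto simp: R_def)
  let ?U = "subgraph R (\<lambda>_. R)"
  have eq: "indicator ?U p *\<^sub>R wdiv m \<phi>\<^sub>1 \<phi>\<^sub>2 p = wdiv m \<phi>\<^sub>1 \<phi>\<^sub>2 p" for p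
  proof (cases "p \<in> ?U")
    case False
    then have "\<bar>fst p\<bar> \<ge> R \<or> \<bar>snd p\<bar> \<ge> R" by (cases p) (auto simp: subgraph_def)
    with R1(2)[of p] R2(2)[of p] R show ?thesis by (auto simp: wdiv_def)
  qed simp
  have "set_integrable lebesgue ?U (wdiv m \<phi>\<^sub>1 \<phi>\<^sub>2)"
    by (rule integral_subgraph(1)[OF R(1) _ continuous_wdiv[OF \<phi>\<^sub>1 \<phi>\<^sub>2]]) simp
  then show "integrable lebesgue (wdiv m \<phi>\<^sub>1 \<phi>\<^sub>2)"
    unfolding set_integrable_def eq .
  have "(LINT p:?U|lebesgue. wdiv m \<phi>\<^sub>1 \<phi>\<^sub>2 p) =
     integral {-1..1} (\<lambda>t. R * \<phi>\<^sub>1 (R, R * t) - R * \<phi>\<^sub>1 (-R, R * t))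
     + integral {-R..R} (\<lambda>x. \<bar>x\<bar> ^ m * (\<phi>\<^sub>2 (x, R) - \<phi>\<^sub>2 (x, - R)) - 0 * (\<phi>\<^sub>1 (x, R) + \<phi>\<^sub>1 (x, - R)))"
    by (rule divergence_subgraph[OF R(1) _ _ _ \<phi>\<^sub>1 \<phi>\<^sub>2]) (use R in auto)
  also have "\<dots> = 0" using R1(2) R2(2) R by simp
  finally show "integral\<^sup>L lebesgue (wdiv m \<phi>\<^sub>1 \<phi>\<^sub>2) = 0"
    unfolding set_lebesgue_integral_def eq .
qed

text \<open>The integral over the whole plane vanishes, so a field tests the complement exactly as
  the opposite field tests the set. The integrands are integrable on the plane, hence
  \<open>E\<close> may have infinite measure, as it does when the roles of \<open>E\<close> and
  \<open>- E\<close> are exchanged.\<close>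

lemma perimeter_Compl_le:
  assumes E: "E \<in> sets lebesgue"
  shows "perimeter (real m) (- E) \<le> perimeter (real m) E"
proof (rule perimeter_leI)
  fix \<phi>\<^sub>1 \<phi>\<^sub>2 assume t: "(\<phi>\<^sub>1, \<phi>\<^sub>2) \<in> test_fields"
  then have \<phi>: "\<phi>\<^sub>1 \<in> C1_compact_support" "\<phi>\<^sub>2 \<in> C1_compact_support" by (auto simp: test_fields_def)
  note I = wdiv_integral_UNIV[OF \<phi>, of m]
  have iE: "integrable lebesgue (\<lambda>p. indicator E p *\<^sub>R wdiv m \<phi>\<^sub>1 \<phi>\<^sub>2 p)"
    using I(1) E by (rule integrable_mult_indicator[rotated])
  have "(LINT p:-E|lebesgue. wdiv m \<phi>\<^sub>1 \<phi>\<^sub>2 p) = (LINT p|lebesgue. wdiv m \<phi>\<^sub>1 \<phi>\<^sub>2 p - indicator E p *\<^sub>R wdiv m \<phi>\<^sub>1 \<phi>\<^sub>2 p)"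
    unfolding set_lebesgue_integral_def by (intro Bochner_Integration.integral_cong) (auto split: split_indicator)
  also have "\<dots> = - (LINT p:E|lebesgue. wdiv m \<phi>\<^sub>1 \<phi>\<^sub>2 p)"
    using I iE by (simp add: Bochner_Integration.integral_diff set_lebesgue_integral_def)
  also have "\<dots> = (LINT p:E|lebesgue. wdiv m (\<lambda>p. - \<phi>\<^sub>1 p) (\<lambda>p. - \<phi>\<^sub>2 p) p)"
  proof -
    have "wdiv m (\<lambda>p. - \<phi>\<^sub>1 p) (\<lambda>p. - \<phi>\<^sub>2 p) p = - wdiv m \<phi>\<^sub>1 \<phi>\<^sub>2 p" for p
      using C1_uminus(2,3)[OF \<phi>(1)] C1_uminus(2,3)[OF \<phi>(2)] by (simp add: wdiv_def)
    then show ?thesis by (simp add: set_lebesgue_integral_def)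
  qed
  finally show "ereal (LINT p:-E|lebesgue. wdiv m \<phi>\<^sub>1 \<phi>\<^sub>2 p) \<le> perimeter (real m) E"
    using perimeter_geI[of "\<lambda>p. - \<phi>\<^sub>1 p" "\<lambda>p. - \<phi>\<^sub>2 p" E m] t C1_uminus(1) by (auto simp: test_fields_def)
qed

lemma perimeter_Compl:
  assumes "E \<in> sets lebesgue"
  shows "perimeter (real m) (- E) = perimeter (real m) E"
  using perimeter_Compl_le[OF assms, of m] perimeter_Compl_le[of "- E" m] assms
  by (simp add: antisym Compl_in_sets_lebesgue)

section \<open>Lower bound by calibrations\<close>

definition smoothstep :: "real \<Rightarrow> real" where
  "smoothstep t = 2 * (max 0 t)\<^sup>2 - 4 * (max 0 (t - 1/2))\<^sup>2 + 2 * (max 0 (t - 1))\<^sup>2"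

text \<open>A tent of height 2 and area 1 over \<open>{0..1}\<close>. Its primitive is a C1
  transition from 0 to 1, which is all the regularity that test fields ask for.\<close>

definition smoothstep' :: "real \<Rightarrow> real" where
  "smoothstep' t = 4 * max 0 t - 8 * max 0 (t - 1/2) + 4 * max 0 (t - 1)"

lemma DERIV_max_square: "((\<lambda>t::real. (max 0 t)\<^sup>2) has_real_derivative 2 * max 0 t) (at t)"
proof -
  consider "t < 0" | "t = 0" | "t > 0" by linarith
  then show ?thesis
  proof cases
    case 1
    have "((\<lambda>t::real. 0) has_real_derivative 0) (at t)" by simp
    then have "((\<lambda>t::real. (max 0 t)\<^sup>2) has_real_derivative 0) (at t)"
      by (rule has_field_derivative_transform_within_open[where S="{..<0}"]) (use 1 in auto)
    with 1 show ?thesis by (simp add: max_def)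
  next
    case 2
    have "isCont (max 0) (0::real)" by (intro continuous_intros)
    then have "((\<lambda>t::real. (max 0 t)\<^sup>2) has_real_derivative 0) (at 0)"
      unfolding CARAT_DERIV
      by (intro exI[of _ "max 0"]) (auto simp: max_def power2_eq_square)
    with 2 show ?thesis by simp
  next
    case 3
    have "((\<lambda>t::real. t\<^sup>2) has_real_derivative 2 * t) (at t)"
      by (auto intro!: derivative_eq_intros)
    then have "((\<lambda>t::real. (max 0 t)\<^sup>2) has_real_derivative 2 * t) (at t)"
      by (rule has_field_derivative_transform_within_open[where S="{0<..}"]) (use 3 in auto)
    with 3 show ?thesis by (simp add: max_def)
  qed
qed

lemma DERIV_max_square_shift:
  "((\<lambda>t::real. (max 0 (t - c))\<^sup>2) has_real_derivative 2 * max 0 (t - c)) (at t)"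
  using DERIV_shift[of "\<lambda>t. (max 0 t)\<^sup>2" "2 * max 0 (t - c)" t "- c"] DERIV_max_square[of "t - c"] by simp

lemma DERIV_smoothstep: "(smoothstep has_real_derivative smoothstep' t) (at t)"
  unfolding smoothstep_def[abs_def] smoothstep'_def
  by (rule derivative_eq_intros DERIV_max_square DERIV_max_square_shift refl)+ simp

lemmas DERIV_smoothstep_compose [derivative_intros] =
  DERIV_chain2[OF DERIV_smoothstep]

lemma continuous_smoothstep' [continuous_intros]:
  "continuous_on S F \<Longrightarrow> continuous_on S (\<lambda>x. smoothstep' (F x))"
  unfolding smoothstep'_def by (intro continuous_intros)

lemma smoothstep_0: "t \<le> 0 \<Longrightarrow> smoothstep t = 0" "t \<le> 0 \<Longrightarrow> smoothstep' t = 0"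
  by (simp_all add: smoothstep_def smoothstep'_def max_def)

lemma smoothstep_1: "t \<ge> 1 \<Longrightarrow> smoothstep t = 1"
  by (simp add: smoothstep_def max_def power2_eq_square algebra_simps)

lemma smoothstep'_1: "t \<ge> 1 \<Longrightarrow> smoothstep' t = 0"
  by (simp add: smoothstep'_def max_def)

lemma smoothstep'_nonneg: "smoothstep' t \<ge> 0"
  by (simp add: smoothstep'_def max_def)

lemma smoothstep_bounds: "0 \<le> smoothstep t" "smoothstep t \<le> 1"
proof -
  have mono: "smoothstep a \<le> smoothstep b" if "a \<le> b" for a b
    using DERIV_nonneg_imp_nondecreasing[OF that, of smoothstep] DERIV_smoothstep smoothstep'_nonneg by blast
  show "0 \<le> smoothstep t"
    using mono[of "min 0 t" t] smoothstep_0(1)[of "min 0 t"] by simp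
  show "smoothstep t \<le> 1"
    using mono[of t "max 1 t"] smoothstep_1[of "max 1 t"] by simp
qed

lemma C1_product:
  assumes A: "\<And>x. (A has_real_derivative A' x) (at x)" and A': "continuous_on UNIV A'"
    and B: "\<And>x. (B has_real_derivative B' x) (at x)" and B': "continuous_on UNIV B'"
    and A0: "\<And>x. \<bar>x\<bar> \<ge> R \<Longrightarrow> A x = 0" and B0: "\<And>x. \<bar>x\<bar> \<ge> R \<Longrightarrow> B x = 0"
  shows "(\<lambda>(x, y). A x * B y) \<in> C1_compact_support"
    and "partial_x (\<lambda>(x, y). A x * B y) = (\<lambda>(x, y). A' x * B y)"
    and "partial_y (\<lambda>(x, y). A x * B y) = (\<lambda>(x, y). A x * B' y)"
proof -
  let ?\<phi> = "\<lambda>(x, y). A x * B y"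
  have D: "(?\<phi> has_derivative (\<lambda>(u, v). A' x * B y * u + A x * B' y * v)) (at (x, y))" for x y
  proof -
    have "((\<lambda>p. A (fst p)) has_derivative (\<lambda>p. A' x * fst p)) (at (x, y))"
      using has_derivative_compose[OF has_derivative_fst[OF has_derivative_ident], of A "(*) (A' x)" "(x, y)" UNIV]
        A[of x] by (simp add: has_field_derivative_def)
    moreover have "((\<lambda>p. B (snd p)) has_derivative (\<lambda>p. B' y * snd p)) (at (x, y))"
      using has_derivative_compose[OF has_derivative_snd[OF has_derivative_ident], of B "(*) (B' y)" "(x, y)" UNIV]
        B[of y] by (simp add: has_field_derivative_def)
    ultimately have "((\<lambda>p. A (fst p) * B (snd p)) has_derivative
       (\<lambda>p. A (fst (x, y)) * (B' y * snd p) + A' x * fst p * B (snd (x, y)))) (at (x, y))"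
      by (rule has_derivative_mult)
    then show ?thesis by (simp add: case_prod_unfold algebra_simps)
  qed
  show px: "partial_x ?\<phi> = (\<lambda>(x, y). A' x * B y)"
    using has_derivative_partials(1)[OF D] by auto
  show py: "partial_y ?\<phi> = (\<lambda>(x, y). A x * B' y)"
    using has_derivative_partials(2)[OF D] by auto
  have Ac: "continuous_on UNIV A" "continuous_on UNIV B"
    using A B by (auto intro!: DERIV_continuous_on)
  note cc = continuous_on_compose2[OF Ac(1)] continuous_on_compose2[OF Ac(2)]
    continuous_on_compose2[OF A'] continuous_on_compose2[OF B']
  have "continuous_on UNIV (partial_x ?\<phi>)" "continuous_on UNIV (partial_y ?\<phi>)"
    unfolding px py
    by (auto simp: case_prod_unfold intro!: continuous_on_mult cc continuous_on_fst continuous_on_snd continuous_on_id)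
  moreover have "?\<phi> differentiable_on UNIV"
    using D by (auto simp: differentiable_on_def differentiable_def)
  moreover have "{p. ?\<phi> p \<noteq> 0} \<subseteq> {-R..R} \<times> {-R..R}"
  proof clarify
    fix x y assume "A x * B y \<noteq> 0"
    then have "\<not> \<bar>x\<bar> \<ge> R" "\<not> \<bar>y\<bar> \<ge> R" using A0[of x] B0[of y] by auto
    then show "x \<in> {-R..R} \<and> y \<in> {-R..R}" by auto
  qed
  then have "bounded {p. ?\<phi> p \<noteq> 0}"
    using bounded_subset compact_imp_bounded[OF compact_Times[OF compact_Icc compact_Icc]] by metis
  ultimately show "?\<phi> \<in> C1_compact_support"
    by (simp add: C1_compact_support_def compact_eq_bounded_closed bounded_closure)
qed

text \<open>Test fields live on the whole plane. Extending the derivative by constants and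
  integrating it gives a C1 extension without any gluing at the end points.\<close>

lemma C1_extend:
  fixes g :: "real \<Rightarrow> real"
  assumes X: "X > 0" and g: "\<And>x. x \<in> {-X..X} \<Longrightarrow> (g has_real_derivative g' x) (at x within {-X..X})"
    and g': "continuous_on {-X..X} g'"
  obtains G G' where "\<And>x. (G has_real_derivative G' x) (at x)" "continuous_on UNIV G'"
    "\<And>x. x \<in> {-X..X} \<Longrightarrow> G x = g x" "\<And>x. x \<in> {-X..X} \<Longrightarrow> G' x = g' x"
proof -
  define G' where "G' x = g' (max (-X) (min X x))" for x
  \<comment> \<open>An integral over a reversed interval is 0, so the difference is the oriented
    integral from 0 to \<open>x\<close>.\<close>
  define G where "G x = g 0 + (integral {0..x} G' - integral {x..0} G')" for x
  have cG': "continuous_on UNIV G'"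
    unfolding G'_def using X by (intro continuous_on_compose2[OF g'] continuous_intros) auto
  then have cG: "continuous_on S G'" for S by (rule continuous_on_subset) simp
  have int: "G' integrable_on {a..b}" for a b by (intro integrable_continuous_interval cG)
  have eqG: "G y = (g 0 - integral {-L..0} G') + integral {-L..y} G'" if "y \<in> {-L..L}" "L > 0" for y L
  proof (cases "y \<ge> 0")
    case True
    then show ?thesis
      using Henstock_Kurzweil_Integration.integral_combine[of "-L" 0 y G'] int that
      by (cases "y = 0") (auto simp: G_def)
  next
    case False
    then show ?thesis
      using Henstock_Kurzweil_Integration.integral_combine[of "-L" y 0 G'] int that by (auto simp: G_def)
  qed
  have dG: "(G has_real_derivative G' x) (at x)" for x
  proof -
    define L where "L = \<bar>x\<bar> + 1"
    have x: "x \<in> {-L<..<L}" and L: "L > 0" by (auto simp: L_def)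
    have "((\<lambda>y. integral {-L..y} G') has_real_derivative G' x) (at x within {-L..L})"
      by (rule integral_has_real_derivative[OF cG]) (use x in auto)
    then have "((\<lambda>y. integral {-L..y} G') has_real_derivative G' x) (at x)"
      using x by (simp add: at_within_Icc_at)
    then have "((\<lambda>y. (g 0 - integral {-L..0} G') + integral {-L..y} G') has_real_derivative G' x) (at x)"
      by (auto intro!: derivative_eq_intros)
    then show ?thesis
    proof (rule has_field_derivative_transform_within_open[where S="{-L<..<L}"])
      fix y assume "y \<in> {-L<..<L}"
      then show "g 0 - integral {- L..0} G' + integral {- L..y} G' = G y"
        using eqG[of y L] L by simp
    qed (use x in auto)
  qed
  have eq': "G' x = g' x" if "x \<in> {-X..X}" for x using that by (simp add: G'_def)
  have "G x = g x" if x: "x \<in> {-X..X}" for x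
  proof -
    have "((\<lambda>x. G x - g x) has_real_derivative 0) (at z within {-X..X})" if z: "z \<in> {-X..X}" for z
      using DERIV_diff[OF has_field_derivative_at_within[OF dG] g[OF z]] eq'[OF z] by simp
    then obtain c where c: "\<And>z. z \<in> {-X..X} \<Longrightarrow> G z - g z = c"
      using has_field_derivative_zero_constant[of "{-X..X}" "\<lambda>x. G x - g x"] by auto
    have "G x - g x = G 0 - g 0" using c[OF x] c[of 0] X by simp
    then show ?thesis by (simp add: G_def)
  qed
  with dG cG' eq' show ?thesis using that by blast
qed

text \<open>The weights are nonnegative, have integral 1 for large \<open>n\<close> and live on a
  strip of width \<open>1 / n\<close> inside \<open>X\<close>: a one-sided approximate identity at
  the end point.\<close>

lemma integral_smoothstep_limit:
  assumes X: "X > 0" and q: "continuous_on {-X..X} (q :: real \<Rightarrow> real)"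
  shows "(\<lambda>n. integral {-X..X} (\<lambda>x. real n * smoothstep' (1 - real n * (X - x)) * q x)) \<longlonglongrightarrow> q X"
proof (rule LIMSEQ_I)
  fix r :: real assume r: "r > 0"
  have "\<exists>d>0. \<forall>x\<in>{-X..X}. dist x X < d \<longrightarrow> dist (q x) (q X) < r / 2"
    using q[unfolded continuous_on_iff, rule_format, of X "r / 2"] X r by simp
  then obtain d where d: "d > 0" "\<And>x. x \<in> {-X..X} \<Longrightarrow> dist x X < d \<Longrightarrow> dist (q x) (q X) < r / 2"
    by blast
  \<comment> \<open>Here \<open>d\<close> controls the oscillation of \<open>q\<close>, and
    \<open>X\<close> keeps the strip inside the interval so that its whole mass is counted.\<close>
  obtain N :: nat where N: "1 / min d X < real N" using reals_Archimedean2 by blast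
  have "norm (integral {-X..X} (\<lambda>x. real n * smoothstep' (1 - real n * (X - x)) * q x) - q X) < r" if n: "n \<ge> N" for n
  proof -
    have mp: "min d X > 0" using d X by simp
    have nN: "1 / min d X < real n" using N n by linarith
    have n0: "real n > 0" using nN mp by (meson divide_pos_pos less_trans zero_less_one)
    have n1: "1 < real n * d" "1 < real n * X"
    proof -
      have "1 < real n * min d X" using nN mp by (simp add: divide_less_eq)
      moreover have "real n * min d X \<le> real n * d" "real n * min d X \<le> real n * X"
        using n0 by (auto intro!: mult_left_mono)
      ultimately show "1 < real n * d" "1 < real n * X" by linarith+
    qed
    let ?w = "\<lambda>x. real n * smoothstep' (1 - real n * (X - x))"
    have wc: "continuous_on {-X..X} ?w" by (intro continuous_intros)
    have "(?w has_integral smoothstep (1 - real n * (X - X)) - smoothstep (1 - real n * (X - - X))) {-X..X}"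
      by (rule fundamental_theorem_of_calculus)
         (use X in \<open>auto simp flip: has_real_derivative_iff_has_vector_derivative intro!: derivative_eq_intros\<close>)
    then have w1: "(?w has_integral 1) {-X..X}"
      using n1(2) by (simp add: smoothstep_0 smoothstep_1)
    have "((\<lambda>x. ?w x * q x) has_integral integral {-X..X} (\<lambda>x. ?w x * q x)) {-X..X}"
      by (intro integrable_integral integrable_continuous_interval continuous_on_mult wc q)
    from has_integral_diff[OF this has_integral_mult_left[OF w1, of "q X"]]
    have "((\<lambda>x. ?w x * (q x - q X)) has_integral integral {-X..X} (\<lambda>x. ?w x * q x) - q X) {-X..X}"
      by (simp add: algebra_simps)
    then have I1: "(\<lambda>x. ?w x * (q x - q X)) integrable_on {-X..X}"
      "integral {-X..X} (\<lambda>x. ?w x * (q x - q X)) = integral {-X..X} (\<lambda>x. ?w x * q x) - q X"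
      by (simp_all only: has_integral_iff)
    have "((\<lambda>x. ?w x * (r / 2)) has_integral 1 * (r / 2)) {-X..X}"
      by (intro has_integral_mult_left w1)
    then have I2: "(\<lambda>x. ?w x * (r / 2)) integrable_on {-X..X}"
      "integral {-X..X} (\<lambda>x. ?w x * (r / 2)) = r / 2"
      by (simp_all only: has_integral_iff mult_1_left)
    have "norm (?w x * (q x - q X)) \<le> ?w x * (r / 2)" if x: "x \<in> {-X..X}" for x
    proof (cases "dist x X < d")
      case True
      have "norm (?w x * (q x - q X)) = ?w x * dist (q x) (q X)"
        by (simp add: abs_mult dist_real_def smoothstep'_nonneg)
      also have "\<dots> \<le> ?w x * (r / 2)"
        using d(2)[OF x True] by (intro mult_left_mono) (auto simp: smoothstep'_nonneg)
      finally show ?thesis .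
    next
      case False
      then have "d \<le> X - x" using x by (auto simp: dist_real_def)
      then have "real n * d \<le> real n * (X - x)" using n0 by (intro mult_left_mono) auto
      then have "smoothstep' (1 - real n * (X - x)) = 0" using n1 by (intro smoothstep_0) auto
      then show ?thesis by simp
    qed
    from integral_norm_bound_integral[OF I1(1) I2(1) this]
    have "norm (integral {-X..X} (\<lambda>x. ?w x * q x) - q X) \<le> r / 2"
      unfolding I1(2) I2(2) .
    then show ?thesis using r by simp
  qed
  then show "\<exists>N. \<forall>n\<ge>N. norm (integral {-X..X} (\<lambda>x. real n * smoothstep' (1 - real n * (X - x)) * q x) - q X) < r"
    by blast
qed

text \<open>The horizontal and vertical components of a calibrating field in the upper half plane are
  \<open>g\<close> and \<open>k\<close>, functions of \<open>x\<close> alone. Then \<open>f X + f (-X) + calib m X f g g' k\<close> is half of the flux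
  through the boundary of the subgraph, with \<open>g\<close> replaced by \<open>1\<close> and \<open>-1\<close> on the vertical sides.\<close>

definition calib :: "nat \<Rightarrow> real \<Rightarrow> (real \<Rightarrow> real) \<Rightarrow> (real \<Rightarrow> real) \<Rightarrow> (real \<Rightarrow> real) \<Rightarrow> (real \<Rightarrow> real) \<Rightarrow> real" where
  "calib m X f g g' k = integral {-X..X} (\<lambda>x. g' x * f x + \<bar>x\<bar> ^ m * k x) - (g X * f X - g (-X) * f (-X))"

text \<open>Near the vertical sides the field is deformed into \<open>(1, 0)\<close> and \<open>(-1, 0)\<close> on strips of width
  \<open>1 / n\<close>, so that in the limit these sides count with their full length.\<close>

lemma perimeter_subgraph_ge:
  assumes X: "X > 0" and h: "h > 0"
    and f: "continuous_on {-X..X} f" and fh: "\<And>x. x \<in> {-X..X} \<Longrightarrow> h \<le> f x"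
    and g: "\<And>x. x \<in> {-X..X} \<Longrightarrow> (g has_real_derivative g' x) (at x within {-X..X})"
    and g': "continuous_on {-X..X} g'"
    and k: "\<And>x. x \<in> {-X..X} \<Longrightarrow> (k has_real_derivative k' x) (at x within {-X..X})"
    and k': "continuous_on {-X..X} k'"
    and gk: "\<And>x. x \<in> {-X..X} \<Longrightarrow> (g x)\<^sup>2 + (k x)\<^sup>2 \<le> 1"
  shows "ereal (2 * (f X + f (-X) + calib m X f g g' k)) \<le> perimeter (real m) (subgraph X f)"
proof -
  let ?I = "{-X..X}"
  obtain G G' where G: "\<And>x. (G has_real_derivative G' x) (at x)" "continuous_on UNIV G'"
    "\<And>x. x \<in> ?I \<Longrightarrow> G x = g x" "\<And>x. x \<in> ?I \<Longrightarrow> G' x = g' x"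
    using C1_extend[OF X g g'] by blast
  obtain K K' where K: "\<And>x. (K has_real_derivative K' x) (at x)" "continuous_on UNIV K'"
    "\<And>x. x \<in> ?I \<Longrightarrow> K x = k x" "\<And>x. x \<in> ?I \<Longrightarrow> K' x = k' x"
    using C1_extend[OF X k k'] by blast
  have GKc: "continuous_on UNIV G" "continuous_on UNIV K"
    by (rule DERIV_continuous_on[OF G(1)] DERIV_continuous_on[OF K(1)])+
  have "bounded (f ` ?I)" by (intro compact_imp_bounded compact_continuous_image f compact_Icc)
  then obtain M where "\<forall>y\<in>f ` ?I. norm y \<le> M" unfolding bounded_iff by blast
  then have M: "f x \<le> M" if "x \<in> ?I" for x using that by force
  define a where "a n x = smoothstep (1 - real n * (X - x))" for n x
  define a' where "a' n x = real n * smoothstep' (1 - real n * (X - x))" for n x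
  have da: "(a n has_real_derivative a' n x) (at x)" for n x
    unfolding a_def[abs_def] a'_def by (auto intro!: derivative_eq_intros)
  have db: "((\<lambda>x. a n (- x)) has_real_derivative - a' n (- x)) (at x)" for n x
    using DERIV_chain2[of "a n" _ uminus x "-1" UNIV, OF da[of n "- x"]] DERIV_minus[OF DERIV_ident, of x] by simp
  have ca': "continuous_on S (a' n)" "continuous_on S (\<lambda>x. a' n (- x))" for n S
    unfolding a'_def[abs_def] by (intro continuous_intros)+
  have a01: "0 \<le> a n x" "a n x \<le> 1" for n x by (simp_all add: a_def smoothstep_bounds)
  \<comment> \<open>The weights \<open>ch n x\<close>, \<open>a n x\<close> and
    \<open>a n (- x)\<close> sum to 1 and mix the fields \<open>(G, K)\<close>,
    \<open>(1, 0)\<close> and \<open>(-1, 0)\<close>.\<close>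
  define ch where "ch n x = 1 - a n x - a n (- x)" for n x
  define P where "P n x = ch n x * G x + a n x - a n (- x)" for n x
  define P' where "P' n x = a' n x * (1 - G x) + a' n (- x) * (1 + G x) + ch n x * G' x" for n x
  define Q where "Q n x = ch n x * K x" for n x
  define Q' where "Q' n x = (a' n (- x) - a' n x) * K x + ch n x * K' x" for n x
  have dch: "(ch n has_real_derivative a' n (- x) - a' n x) (at x)" for n x
    unfolding ch_def[abs_def]
    by (rule DERIV_cong[OF DERIV_diff[OF DERIV_diff[OF DERIV_const da] db]]) simp
  have dP: "(P n has_real_derivative P' n x) (at x)" for n x
    unfolding P_def[abs_def]
    by (rule DERIV_cong[OF DERIV_diff[OF DERIV_add[OF DERIV_mult[OF dch G(1)] da] db]])
       (simp add: P'_def algebra_simps)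
  have dQ: "(Q n has_real_derivative Q' n x) (at x)" for n x
    unfolding Q_def[abs_def]
    by (rule DERIV_cong[OF DERIV_mult[OF dch K(1)]]) (simp add: Q'_def algebra_simps)
  have cch: "continuous_on S (ch n)" for n S
    by (rule DERIV_continuous_on[OF has_field_derivative_at_within[OF dch]])
  have cP': "continuous_on UNIV (P' n)" and cQ': "continuous_on UNIV (Q' n)" for n
    unfolding P'_def[abs_def] Q'_def[abs_def] by (intro continuous_intros ca' cch GKc G(2) K(2))+
  define C where "C R x = smoothstep (R + 1 - x) * smoothstep (R + 1 + x)" for R x :: real
  define C' where "C' R x = smoothstep (R + 1 - x) * smoothstep' (R + 1 + x)
      - smoothstep' (R + 1 - x) * smoothstep (R + 1 + x)" for R x :: real
  have dC: "(C R has_real_derivative C' R x) (at x)" for R x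
    unfolding C_def[abs_def] C'_def by (auto intro!: derivative_eq_intros simp: algebra_simps)
  have cs: "continuous_on UNIV smoothstep"
    by (rule DERIV_continuous_on[OF DERIV_smoothstep])
  have cC': "continuous_on UNIV (C' R)" for R
    unfolding C'_def[abs_def] by (intro continuous_intros continuous_on_compose2[OF cs]) auto
  have C0: "C R x = 0" if "\<bar>x\<bar> \<ge> R + 1" for R x
    using that smoothstep_0(1)[of "R + 1 - x"] smoothstep_0(1)[of "R + 1 + x"] by (auto simp: C_def abs_if split: if_splits)
  have C1: "C R x = 1" if "\<bar>x\<bar> \<le> R" for R x
    using that smoothstep_1[of "R + 1 - x"] smoothstep_1[of "R + 1 + x"] by (auto simp: C_def)
  have C'0: "C' R x = 0" if "\<bar>x\<bar> \<le> R" for R x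
    using that smoothstep'_1[of "R + 1 - x"] smoothstep'_1[of "R + 1 + x"] by (auto simp: C'_def)
  have C01: "0 \<le> C R x" "C R x \<le> 1" for R x
    by (auto simp: C_def smoothstep_bounds intro!: mult_le_one)
  \<comment> \<open>A smooth sign: the vertical component has to be opposite on the upper and the
    lower graph. The change happens for \<open>y\<close> between \<open>- h\<close> and
    \<open>h\<close>, and \<open>h \<le> f x\<close> leaves room for it inside the region.\<close>
  define S where "S y = 2 * smoothstep ((y / h + 1) / 2) - 1" for y
  define S' where "S' y = smoothstep' ((y / h + 1) / 2) / h" for y
  have dS: "(S has_real_derivative S' y) (at y)" for y
    unfolding S_def[abs_def] S'_def using h by (auto intro!: derivative_eq_intros)
  have cS': "continuous_on UNIV S'"
    unfolding S'_def[abs_def] using h by (intro continuous_intros) auto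
  have S1: "S y = 1" if "y \<ge> h" for y
    using that h smoothstep_1[of "(y / h + 1) / 2"] by (auto simp: S_def field_simps)
  have Sm1: "S y = -1" if "y \<le> -h" for y
    using that h smoothstep_0(1)[of "(y / h + 1) / 2"] by (auto simp: S_def field_simps)
  have Sb: "\<bar>S y\<bar> \<le> 1" for y
    using smoothstep_bounds[of "(y / h + 1) / 2"] by (auto simp: S_def abs_le_iff)
  \<comment> \<open>The condition on \<open>n\<close> keeps the two strips disjoint, which makes
    \<open>ch n\<close> nonnegative.\<close>
  have bound: "perimeter (real m) (subgraph X f) \<ge>
      ereal (2 * integral ?I (\<lambda>x. P' n x * f x + \<bar>x\<bar> ^ m * Q n x))" if n: "real n * X \<ge> 1" for n
  proof -
    define R where "R = max X M + 1"
    have a0: "a n x = 0" if "x \<le> 0" for x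
    proof -
      have "real n * X \<le> real n * (X - x)" using that by (intro mult_left_mono) auto
      then show ?thesis using n by (auto simp: a_def intro!: smoothstep_0)
    qed
    have a1: "a n x = 1" if "x \<ge> X" for x
      using that by (auto simp: a_def mult_le_0_iff intro!: smoothstep_1)
    have ch: "ch n x = 0" if "\<bar>x\<bar> \<ge> X" for x
      using that a0[of x] a0[of "-x"] a1[of x] a1[of "-x"] X by (cases "x \<ge> 0") (auto simp: ch_def)
    have ch2: "ch n x \<ge> 0" for x
      using a0[of x] a0[of "-x"] a01[of n x] a01[of n "-x"] by (cases "x \<ge> 0") (auto simp: ch_def)
    define A where "A x = P n x * C X x" for x
    define A' where "A' x = P n x * C' X x + P' n x * C X x" for x
    define B where "B y = S y * C M y" for y
    define B' where "B' y = S y * C' M y + S' y * C M y" for y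
    have dA: "(A has_real_derivative A' x) (at x)" for x
      unfolding A_def[abs_def] A'_def by (rule DERIV_cong[OF DERIV_mult[OF dP dC]]) simp
    have dB: "(B has_real_derivative B' x) (at x)" for x
      unfolding B_def[abs_def] B'_def by (rule DERIV_cong[OF DERIV_mult[OF dS dC]]) simp
    have cPC: "continuous_on UNIV (P n)" "continuous_on UNIV S" "continuous_on UNIV (C r)" for r
      by (rule DERIV_continuous_on[OF dP] DERIV_continuous_on[OF dS] DERIV_continuous_on[OF dC])+
    have cA': "continuous_on UNIV A'" and cB': "continuous_on UNIV B'"
      unfolding A'_def[abs_def] B'_def[abs_def] by (intro continuous_intros cPC cP' cC' cS')+
    have A0: "A x = 0" if "\<bar>x\<bar> \<ge> R" for x using that by (simp add: A_def C0 R_def)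
    have Q0: "Q n x = 0" if "\<bar>x\<bar> \<ge> R" for x using that ch[of x] by (simp add: Q_def R_def)
    have B0: "B y = 0" if "\<bar>y\<bar> \<ge> R" for y using that by (simp add: B_def C0 R_def)
    have CM0: "C M y = 0" if "\<bar>y\<bar> \<ge> R" for y using that by (simp add: C0 R_def)
    note \<phi>\<^sub>1 = C1_product[OF dA cA' dC cC' A0 CM0] and \<phi>\<^sub>2 = C1_product[OF dQ cQ' dB cB' Q0 B0]
    let ?\<phi>\<^sub>1 = "\<lambda>(x, y). A x * C M y" and ?\<phi>\<^sub>2 = "\<lambda>(x, y). Q n x * B y"
    \<comment> \<open>Triangle inequality: for \<open>x\<close> in the strip the field is
      \<open>ch n x\<close> times a vector of length at most 1 plus the horizontal vector
      \<open>e\<close>.\<close>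
    have PQ: "(P n x)\<^sup>2 + (Q n x)\<^sup>2 \<le> 1" for x
    proof -
      define e where "e = a n x - a n (- x)"
      have e: "ch n x + \<bar>e\<bar> \<le> 1" using a01[of n x] a01[of n "-x"] by (auto simp: ch_def e_def)
      have "(P n x)\<^sup>2 + (Q n x)\<^sup>2 \<le> (ch n x + \<bar>e\<bar>)\<^sup>2"
      proof (cases "\<bar>x\<bar> \<ge> X")
        case True
        then show ?thesis by (simp add: P_def Q_def ch e_def)
      next
        case False
        then have x: "x \<in> ?I" by auto
        have "(g x)\<^sup>2 \<le> 1" using gk[OF x] zero_le_power2[of "k x"] by linarith
        then have "\<bar>g x\<bar> \<le> 1" by (simp add: abs_square_le_1)
        then have "\<bar>g x\<bar> * \<bar>e\<bar> \<le> 1 * \<bar>e\<bar>" by (intro mult_right_mono) auto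
        then have "g x * e \<le> \<bar>e\<bar>" by (metis abs_ge_self abs_mult mult_1 order_trans)
        then have "ch n x * (g x * e) \<le> ch n x * \<bar>e\<bar>" by (intro mult_left_mono ch2)
        moreover have "(ch n x)\<^sup>2 * ((g x)\<^sup>2 + (k x)\<^sup>2) \<le> (ch n x)\<^sup>2 * 1"
          by (intro mult_left_mono gk x) auto
        moreover have "P n x = ch n x * g x + e" "Q n x = ch n x * k x"
          using G(3)[OF x] K(3)[OF x] by (auto simp: P_def Q_def e_def)
        ultimately show ?thesis
          by (simp add: power2_sum power_mult_distrib algebra_simps)
      qed
      also have "\<dots> \<le> 1\<^sup>2" using e ch2[of x] by (intro power_mono) auto
      finally show ?thesis by simp
    qed
    have sq: "(u * v)\<^sup>2 \<le> u\<^sup>2" if "\<bar>v\<bar> \<le> 1" for u v :: real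
    proof -
      have "u\<^sup>2 * v\<^sup>2 \<le> u\<^sup>2 * 1" using that by (intro mult_left_mono) (auto simp: abs_square_le_1)
      then show ?thesis by (simp add: power_mult_distrib)
    qed
    have "(A x * C M y)\<^sup>2 + (Q n x * B y)\<^sup>2 \<le> 1" for x y
    proof -
      have "\<bar>C X x\<bar> \<le> 1" "\<bar>C M y\<bar> \<le> 1" using C01 by (simp_all add: abs_le_iff order_trans[of "- _" 0 1])
      then have "\<bar>C X x * C M y\<bar> \<le> 1" "\<bar>B y\<bar> \<le> 1"
        using Sb[of y] by (auto simp: abs_mult B_def intro!: mult_le_one)
      from sq[OF this(1), of "P n x"] sq[OF this(2), of "Q n x"] PQ[of x] show ?thesis
        by (simp add: A_def mult.assoc)
    qed
    then have "(?\<phi>\<^sub>1, ?\<phi>\<^sub>2) \<in> test_fields"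
      using \<phi>\<^sub>1(1) \<phi>\<^sub>2(1) by (auto simp: test_fields_def)
    note ge = perimeter_geI[OF this, of "subgraph X f" m]
    define D where "D = (\<lambda>p. P' n (fst p) + \<bar>fst p\<bar> ^ m * (Q n (fst p) * B' (snd p)))"
    have cQ: "continuous_on UNIV (Q n)" by (rule DERIV_continuous_on[OF dQ])
    have cD: "continuous_on UNIV D"
      unfolding D_def
      by (intro continuous_on_add continuous_on_mult continuous_on_power continuous_on_rabs
          continuous_on_fst continuous_on_snd continuous_on_id
          continuous_on_compose2[OF cP', of _ fst] continuous_on_compose2[OF cQ, of _ fst]
          continuous_on_compose2[OF cB', of _ snd] subset_UNIV)
    have "subgraph X f \<in> sets lebesgue" using open_subgraph[OF f] by (intro sets_completionI_sets) auto
    then have "(LINT p:subgraph X f|lebesgue. wdiv m ?\<phi>\<^sub>1 ?\<phi>\<^sub>2 p) = (LINT p:subgraph X f|lebesgue. D p)"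
    proof (rule set_lebesgue_integral_cong, intro allI impI)
      fix p assume p: "p \<in> subgraph X f"
      obtain x y where xy: "p = (x, y)" by (cases p)
      with p have x: "\<bar>x\<bar> < X" and y: "\<bar>y\<bar> < f x" by (auto simp: subgraph_def)
      then have "\<bar>y\<bar> \<le> M" using M[of x] by (auto simp: abs_less_iff)
      with x show "wdiv m ?\<phi>\<^sub>1 ?\<phi>\<^sub>2 p = D p"
        by (simp add: wdiv_def D_def xy \<phi>\<^sub>1(2) \<phi>\<^sub>2(3) C1 C'0 A'_def)
    qed
    also have "\<dots> = integral ?I (\<lambda>x. integral {- f x..f x} (\<lambda>y. D (x, y)))"
      by (rule integral_subgraph(2)[OF X f cD])
    also have "\<dots> = integral ?I (\<lambda>x. 2 * (P' n x * f x + \<bar>x\<bar> ^ m * Q n x))"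
    proof (rule integral_cong)
      fix x assume x: "x \<in> ?I"
      \<comment> \<open>\<open>D (x, y)\<close> is an exact y-derivative, so only the values
        \<open>1\<close> and \<open>-1\<close> of \<open>B\<close> on the two graphs
        survive.\<close>
      let ?F = "\<lambda>y. y * P' n x + \<bar>x\<bar> ^ m * (Q n x * B y)"
      have "((\<lambda>y. D (x, y)) has_integral ?F (f x) - ?F (- f x)) {- f x..f x}"
      proof (rule fundamental_theorem_of_calculus)
        show "(?F has_vector_derivative D (x, y)) (at y within {- f x..f x})" for y
          unfolding has_real_derivative_iff_has_vector_derivative[symmetric] D_def
          by (auto intro!: derivative_eq_intros has_field_derivative_at_within[OF dB])
      qed (use fh[OF x] h in simp)
      moreover have "B (f x) = 1" "B (- f x) = -1"
        using fh[OF x] M[OF x] h S1[of "f x"] Sm1[of "- f x"] by (auto simp: B_def C1)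
      ultimately show "integral {- f x..f x} (\<lambda>y. D (x, y)) = 2 * (P' n x * f x + \<bar>x\<bar> ^ m * Q n x)"
        by (auto simp: has_integral_iff algebra_simps)
    qed
    also have "\<dots> = 2 * integral ?I (\<lambda>x. P' n x * f x + \<bar>x\<bar> ^ m * Q n x)"
      by (rule integral_mult_right)
    finally show ?thesis using ge by (simp only:)
  qed
  have lim: "(\<lambda>n. integral ?I (\<lambda>x. P' n x * f x + \<bar>x\<bar> ^ m * Q n x)) \<longlonglongrightarrow> f X + f (-X) + calib m X f g g' k"
  proof -
    let ?r = "\<lambda>x. G' x * f x + \<bar>x\<bar> ^ m * K x"
    have cr: "continuous_on ?I ?r"
      by (intro continuous_intros f continuous_on_subset[OF G(2)] continuous_on_subset[OF GKc(2)]) auto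
    have cq: "continuous_on ?I (\<lambda>x. (1 - G x) * f x)" "continuous_on ?I (\<lambda>x. (1 + G x) * f x)"
      by (intro continuous_intros f continuous_on_subset[OF GKc(1)]; simp)+
    have cq2: "continuous_on ?I (\<lambda>x. (1 + G (- x)) * f (- x))"
      by (rule continuous_on_compose2[OF cq(2), of ?I uminus]) (auto intro!: continuous_intros)
    \<comment> \<open>At the end points \<open>ch n\<close> tends to 0 instead of 1, hence the open
      interval.\<close>
    have "(\<lambda>n. integral {-X<..<X} (\<lambda>x. ch n x * ?r x)) \<longlonglongrightarrow> integral {-X<..<X} ?r"
    proof (rule dominated_convergence)
      show "(\<lambda>x. ch n x * ?r x) integrable_on {-X<..<X}" for n
        unfolding integrable_on_open_interval_real
        by (intro integrable_continuous_interval continuous_on_mult cch cr)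
      show "(\<lambda>x. \<bar>?r x\<bar>) integrable_on {-X<..<X}"
        unfolding integrable_on_open_interval_real
        by (intro integrable_continuous_interval continuous_on_rabs cr)
      show "norm (ch n x * ?r x) \<le> \<bar>?r x\<bar>" for n x
      proof -
        have "\<bar>ch n x\<bar> \<le> 1" using a01[of n x] a01[of n "- x"] by (auto simp: ch_def)
        then have "\<bar>ch n x\<bar> * \<bar>?r x\<bar> \<le> 1 * \<bar>?r x\<bar>" by (intro mult_right_mono) auto
        then show ?thesis by (simp add: abs_mult)
      qed
      show "(\<lambda>n. ch n x * ?r x) \<longlonglongrightarrow> ?r x" if x: "x \<in> {-X<..<X}" for x
      proof -
        have x': "X - \<bar>x\<bar> > 0" using x by auto
        obtain N :: nat where N: "1 / (X - \<bar>x\<bar>) < real N" using reals_Archimedean2 by blast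
        have "ch n x = 1" if n: "n \<ge> N" for n
        proof -
          have "1 < real N * (X - \<bar>x\<bar>)" using N x' by (simp add: divide_less_eq)
          also have "\<dots> \<le> real n * (X - \<bar>x\<bar>)" using n x' by (intro mult_right_mono) auto
          finally have 1: "1 < real n * (X - \<bar>x\<bar>)" .
          have "real n * (X - \<bar>x\<bar>) \<le> real n * (X - x)" "real n * (X - \<bar>x\<bar>) \<le> real n * (X - (- x))"
            by (intro mult_left_mono; simp)+
          with 1 show ?thesis by (simp add: ch_def a_def smoothstep_0)
        qed
        then have "eventually (\<lambda>n. ch n x * ?r x = ?r x) sequentially"
          by (auto simp: eventually_sequentially intro!: exI[of _ N])
        then show ?thesis by (rule tendsto_eventually)
      qed
    qed
    then have 1: "(\<lambda>n. integral ?I (\<lambda>x. ch n x * ?r x)) \<longlonglongrightarrow> integral ?I ?r"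
      by (simp only: integral_open_interval_real)
    \<comment> \<open>The strips supply exactly the flux that the field misses on the sides:
      \<open>(1 - G X) * f X\<close> on the right and \<open>(1 + G (- X)) * f (- X)\<close> on the
      left.\<close>
    have 2: "(\<lambda>n. integral ?I (\<lambda>x. a' n x * ((1 - G x) * f x))) \<longlonglongrightarrow> (1 - G X) * f X"
      using integral_smoothstep_limit[OF X cq(1)] by (simp add: a'_def)
    have "(\<lambda>n. integral ?I (\<lambda>x. a' n x * ((1 + G (- x)) * f (- x)))) \<longlonglongrightarrow> (1 + G (- X)) * f (- X)"
      using integral_smoothstep_limit[OF X cq2] by (simp add: a'_def)
    moreover have "integral ?I (\<lambda>x. a' n x * ((1 + G (- x)) * f (- x)))
      = integral ?I (\<lambda>x. a' n (- x) * ((1 + G x) * f x))" for n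
      using Henstock_Kurzweil_Integration.integral_reflect_real[of X "-X"
          "\<lambda>x. a' n (- x) * ((1 + G x) * f x)"] by simp
    ultimately have 3: "(\<lambda>n. integral ?I (\<lambda>x. a' n (- x) * ((1 + G x) * f x))) \<longlonglongrightarrow> (1 + G (- X)) * f (- X)"
      by simp
    have "integral ?I (\<lambda>x. P' n x * f x + \<bar>x\<bar> ^ m * Q n x) = integral ?I (\<lambda>x. ch n x * ?r x)
       + integral ?I (\<lambda>x. a' n x * ((1 - G x) * f x)) + integral ?I (\<lambda>x. a' n (- x) * ((1 + G x) * f x))" for n
    proof -
      have i: "(\<lambda>x. ch n x * ?r x) integrable_on ?I" "(\<lambda>x. a' n x * ((1 - G x) * f x)) integrable_on ?I"
        "(\<lambda>x. a' n (- x) * ((1 + G x) * f x)) integrable_on ?I"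
        by (intro integrable_continuous_interval continuous_on_mult[OF _ cr] continuous_on_mult[OF _ cq(1)]
            continuous_on_mult[OF _ cq(2)] cch ca')+
      have "integral ?I (\<lambda>x. P' n x * f x + \<bar>x\<bar> ^ m * Q n x) = integral ?I (\<lambda>x. ch n x * ?r x
         + a' n x * ((1 - G x) * f x) + a' n (- x) * ((1 + G x) * f x))"
        by (intro integral_cong) (simp add: P'_def Q_def algebra_simps)
      then show ?thesis using i by (simp only: integral_add integrable_add)
    qed
    moreover have "integral ?I ?r = integral ?I (\<lambda>x. g' x * f x + \<bar>x\<bar> ^ m * k x)"
      by (intro integral_cong) (simp add: G K)
    then have "f X + f (-X) + calib m X f g g' k
      = integral ?I ?r + (1 - G X) * f X + (1 + G (- X)) * f (- X)"
      using G(3)[of X] G(3)[of "-X"] X by (simp add: calib_def algebra_simps)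
    ultimately show ?thesis using tendsto_add[OF tendsto_add[OF 1 2] 3] by simp
  qed
  have "(\<lambda>n. ereal (2 * integral ?I (\<lambda>x. P' n x * f x + \<bar>x\<bar> ^ m * Q n x)))
     \<longlonglongrightarrow> ereal (2 * (f X + f (-X) + calib m X f g g' k))"
    by (intro tendsto_intros lim)
  moreover obtain N :: nat where "1 / X < real N" using reals_Archimedean2 by blast
  then have "real n * X \<ge> 1" if "n \<ge> N" for n
    using X that by (smt (verit) divide_less_eq of_nat_mono mult_right_mono)
  ultimately show ?thesis
    using bound by (intro LIMSEQ_le_const2) blast+
qed

section \<open>Upper bound and the profile function\<close>

text \<open>Cauchy-Schwarz in the boundary integrals of \<open>divergence_subgraph\<close>. The
  bound serves for the extremal graph, which is C1 up to the vertical sides, so the set does not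
  have to be approximated.\<close>

lemma perimeter_subgraph_le:
  assumes X: "X > 0"
    and f: "\<And>x. x \<in> {-X..X} \<Longrightarrow> (f has_real_derivative f' x) (at x within {-X..X})"
    and f': "continuous_on {-X..X} f'" and pos: "\<And>x. x \<in> {-X..X} \<Longrightarrow> f x > 0"
  shows "perimeter (real m) (subgraph X f)
    \<le> ereal (2 * (f X + f (-X) + integral {-X..X} (\<lambda>x. sqrt ((f' x)\<^sup>2 + (\<bar>x\<bar> ^ m)\<^sup>2))))"
proof (rule perimeter_leI)
  fix \<phi>\<^sub>1 \<phi>\<^sub>2 assume t: "(\<phi>\<^sub>1, \<phi>\<^sub>2) \<in> test_fields"
  then have \<phi>\<^sub>1: "\<phi>\<^sub>1 \<in> C1_compact_support" and \<phi>\<^sub>2: "\<phi>\<^sub>2 \<in> C1_compact_support"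
    and n: "(\<phi>\<^sub>1 p)\<^sup>2 + (\<phi>\<^sub>2 p)\<^sup>2 \<le> 1" for p
    by (cases p; auto simp: test_fields_def)+
  let ?I = "{-X..X}"
  have fc: "continuous_on ?I f" using f by (rule DERIV_continuous_on)
  note c1 = continuous_on_compose2[OF C1_continuous(1)[OF \<phi>\<^sub>1] _ subset_UNIV]
    and c2 = continuous_on_compose2[OF C1_continuous(1)[OF \<phi>\<^sub>2] _ subset_UNIV]
  have b: "\<bar>\<phi>\<^sub>1 p\<bar> \<le> 1" for p
  proof -
    have "(\<phi>\<^sub>1 p)\<^sup>2 \<le> 1" using n[of p] zero_le_power2[of "\<phi>\<^sub>2 p"] by linarith
    then show ?thesis by (simp add: abs_square_le_1)
  qed
  have cs: "u * \<phi>\<^sub>1 p + v * \<phi>\<^sub>2 p \<le> sqrt (u\<^sup>2 + v\<^sup>2)" for u v p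
  proof -
    have "(u * \<phi>\<^sub>1 p + v * \<phi>\<^sub>2 p)\<^sup>2 \<le> (u\<^sup>2 + v\<^sup>2) * ((\<phi>\<^sub>1 p)\<^sup>2 + (\<phi>\<^sub>2 p)\<^sup>2)"
      using zero_le_power2[of "u * \<phi>\<^sub>2 p - v * \<phi>\<^sub>1 p"] by (simp add: power2_eq_square algebra_simps)
    also have "\<dots> \<le> (u\<^sup>2 + v\<^sup>2) * 1" using n by (intro mult_left_mono) auto
    finally show ?thesis by (intro real_le_rsqrt) simp
  qed
  have "f X * \<phi>\<^sub>1 (X, f X * t) - f (-X) * \<phi>\<^sub>1 (-X, f (-X) * t) \<le> f X + f (-X)" for t
  proof -
    have "f X * \<phi>\<^sub>1 (X, f X * t) \<le> f X * 1" "f (-X) * (- \<phi>\<^sub>1 (-X, f (-X) * t)) \<le> f (-X) * 1"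
      using b[of "(X, f X * t)"] b[of "(-X, f (-X) * t)"] pos[of X] pos[of "-X"] X
      by (intro mult_left_mono; auto)+
    then show ?thesis by simp
  qed
  then have I1: "integral {-1..1} (\<lambda>t. f X * \<phi>\<^sub>1 (X, f X * t) - f (-X) * \<phi>\<^sub>1 (-X, f (-X) * t))
     \<le> integral {-1..1} (\<lambda>t::real. f X + f (-X))"
    by (intro integral_le integrable_continuous_interval continuous_on_diff continuous_on_mult
        continuous_on_const c1 continuous_on_Pair continuous_on_id) auto
  have I2: "integral ?I (\<lambda>x. \<bar>x\<bar> ^ m * (\<phi>\<^sub>2 (x, f x) - \<phi>\<^sub>2 (x, - f x)) - f' x * (\<phi>\<^sub>1 (x, f x) + \<phi>\<^sub>1 (x, - f x)))
    \<le> integral ?I (\<lambda>x. 2 * sqrt ((f' x)\<^sup>2 + (\<bar>x\<bar> ^ m)\<^sup>2))"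
  proof (rule integral_le)
    show "\<bar>x\<bar> ^ m * (\<phi>\<^sub>2 (x, f x) - \<phi>\<^sub>2 (x, - f x)) - f' x * (\<phi>\<^sub>1 (x, f x) + \<phi>\<^sub>1 (x, - f x))
      \<le> 2 * sqrt ((f' x)\<^sup>2 + (\<bar>x\<bar> ^ m)\<^sup>2)" for x
      using cs[of "- f' x" "(x, f x)" "\<bar>x\<bar> ^ m"] cs[of "- f' x" "(x, - f x)" "- (\<bar>x\<bar> ^ m)"]
      by (simp add: algebra_simps)
    show "(\<lambda>x. \<bar>x\<bar> ^ m * (\<phi>\<^sub>2 (x, f x) - \<phi>\<^sub>2 (x, - f x)) - f' x * (\<phi>\<^sub>1 (x, f x) + \<phi>\<^sub>1 (x, - f x))) integrable_on ?I"
      by (intro integrable_continuous_interval continuous_on_diff continuous_on_mult continuous_on_add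
        continuous_on_power continuous_on_rabs c1 c2 continuous_on_Pair continuous_on_id continuous_on_minus fc f')
    show "(\<lambda>x. 2 * sqrt ((f' x)\<^sup>2 + (\<bar>x\<bar> ^ m)\<^sup>2)) integrable_on ?I"
      by (intro integrable_continuous_interval continuous_intros f')
  qed
  have I3: "integral {-1..1} (\<lambda>t::real. f X + f (-X)) = 2 * (f X + f (-X))" by simp
  have "(LINT p:subgraph X f|lebesgue. wdiv m \<phi>\<^sub>1 \<phi>\<^sub>2 p) =
     integral {-1..1} (\<lambda>t. f X * \<phi>\<^sub>1 (X, f X * t) - f (-X) * \<phi>\<^sub>1 (-X, f (-X) * t))
     + integral ?I (\<lambda>x. \<bar>x\<bar> ^ m * (\<phi>\<^sub>2 (x, f x) - \<phi>\<^sub>2 (x, - f x))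
                              - f' x * (\<phi>\<^sub>1 (x, f x) + \<phi>\<^sub>1 (x, - f x)))"
    by (rule divergence_subgraph[OF X f f' pos \<phi>\<^sub>1 \<phi>\<^sub>2])
  also have "\<dots> \<le> 2 * (f X + f (-X)) + 2 * integral ?I (\<lambda>x. sqrt ((f' x)\<^sup>2 + (\<bar>x\<bar> ^ m)\<^sup>2))"
    by (rule add_mono[OF I1[unfolded I3] I2[unfolded integral_mult_right]])
  finally show "ereal (LINT p:subgraph X f|lebesgue. wdiv m \<phi>\<^sub>1 \<phi>\<^sub>2 p)
      \<le> ereal (2 * (f X + f (-X) + integral ?I (\<lambda>x. sqrt ((f' x)\<^sup>2 + (\<bar>x\<bar> ^ m)\<^sup>2))))"
    unfolding ereal_less_eq distrib_left .
qed

section \<open>The profile function: derivative and closed forms\<close>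

lemma profile_nat:
  assumes "\<bar>z\<bar> \<le> 1"
  shows "profile (real m) z = integral {arcsin \<bar>z\<bar>..pi / 2} (\<lambda>t. sin t ^ (m + 1))"
  unfolding profile_def
proof (rule integral_cong)
  fix t assume "t \<in> {arcsin \<bar>z\<bar>..pi / 2}"
  moreover have "0 \<le> arcsin \<bar>z\<bar>" using arcsin_le_arcsin[of 0 "\<bar>z\<bar>"] assms by simp
  ultimately have "sin t \<ge> 0" by (intro sin_ge_zero) auto
  then show "sin t powr (real m + 1) = sin t ^ (m + 1)"
    using powr_realpow[of "sin t" "m + 1"] by (cases "sin t = 0") (auto simp: algebra_simps)
qed

text \<open>Up to sign, the difference quotient of \<open>q \<bar>x\<bar>\<close> is that of
  \<open>q\<close> at \<open>\<bar>x\<bar>\<close>; the limit 0 survives this sign, and with it the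
  kink of the absolute value.\<close>

lemma DERIV_even_at_0:
  assumes "(q has_real_derivative 0) (at 0)"
  shows "((\<lambda>x. q \<bar>x\<bar>) has_real_derivative 0) (at 0)"
proof -
  have "((\<lambda>y. (q y - q 0) / (y - 0)) \<longlongrightarrow> 0) (at 0)"
    using assms by (simp add: has_field_derivative_iff)
  then have "((\<lambda>y. (q y - q 0) / y) \<longlongrightarrow> 0) (at 0)" by simp
  then have "((\<lambda>y. \<bar>(q y - q 0) / y\<bar>) \<longlongrightarrow> 0) (at 0)"
    by (rule tendsto_rabs_zero)
  moreover have "filterlim (\<lambda>x::real. \<bar>x\<bar>) (at 0) (at 0)"
    unfolding filterlim_at by (auto simp: eventually_at_filter intro!: tendsto_eq_intros)
  ultimately have "((\<lambda>x. \<bar>(q \<bar>x\<bar> - q 0) / \<bar>x\<bar>\<bar>) \<longlongrightarrow> 0) (at 0)"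
    by (rule filterlim_compose)
  then have "((\<lambda>x. \<bar>(q \<bar>x\<bar> - q 0) / x\<bar>) \<longlongrightarrow> 0) (at 0)" by simp
  then have "((\<lambda>x. (q \<bar>x\<bar> - q 0) / x) \<longlongrightarrow> 0) (at 0)" by (rule tendsto_rabs_zero_cancel)
  then show ?thesis by (simp add: has_field_derivative_iff)
qed

lemma DERIV_profile:
  assumes z: "\<bar>z\<bar> < 1"
  shows "(profile (real m) has_real_derivative - (\<bar>z\<bar> ^ m * z / sqrt (1 - z\<^sup>2))) (at z)"
proof -
  let ?s = "\<lambda>t::real. sin t ^ (m + 1)"
  \<comment> \<open>For \<open>z \<ge> 0\<close> this is the profile, but unlike the formula with
    \<open>\<bar>z\<bar>\<close> it is visibly differentiable across 0. Starting the integral at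
    \<open>- pi / 2\<close> makes \<open>arcsin z\<close> an interior point.\<close>
  define q where "q z = integral {- pi / 2..pi / 2} ?s - integral {- pi / 2..arcsin z} ?s" for z
  have dq: "(q has_real_derivative - (z ^ (m + 1) / sqrt (1 - z\<^sup>2))) (at z)" if z: "\<bar>z\<bar> < 1" for z
  proof -
    have az: "arcsin z \<in> {- pi / 2<..<pi / 2}"
      using arcsin_lt_bounded[of z] z by auto
    have "((\<lambda>u. integral {- pi / 2..u} ?s) has_real_derivative ?s (arcsin z)) (at (arcsin z) within {- pi / 2..pi / 2})"
      using az by (intro integral_has_real_derivative continuous_intros) auto
    then have *: "((\<lambda>u. integral {- pi / 2..u} ?s) has_real_derivative ?s (arcsin z)) (at (arcsin z))"
      using az by (simp add: at_within_Icc_at)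
    have z': "-1 < z" "z < 1" using z by auto
    have **: "((\<lambda>z. integral {- pi / 2..arcsin z} ?s) has_real_derivative ?s (arcsin z) * inverse (sqrt (1 - z\<^sup>2))) (at z)"
      by (rule DERIV_chain2[OF * DERIV_arcsin[OF z']])
    have "sin (arcsin z) = z" using z' by simp
    then show ?thesis
      unfolding q_def[abs_def]
      by (intro DERIV_diff[OF DERIV_const **, THEN DERIV_cong]) (simp add: divide_inverse)
  qed
  have q: "profile (real m) z = q \<bar>z\<bar>" if z: "\<bar>z\<bar> < 1" for z
  proof -
    have "?s integrable_on {- pi / 2..pi / 2}" by (intro integrable_continuous_interval continuous_intros)
    then have "integral {- pi / 2..arcsin \<bar>z\<bar>} ?s + integral {arcsin \<bar>z\<bar>..pi / 2} ?s = integral {- pi / 2..pi / 2} ?s"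
      using arcsin_bounded[of "\<bar>z\<bar>"] z by (intro Henstock_Kurzweil_Integration.integral_combine) auto
    with z show ?thesis by (simp add: profile_nat q_def)
  qed
  have "((\<lambda>z. q \<bar>z\<bar>) has_real_derivative - (\<bar>z\<bar> ^ m * z / sqrt (1 - z\<^sup>2))) (at z)"
  proof -
    consider "z > 0" | "z = 0" | "z < 0" by linarith
    then show ?thesis
    proof cases
      case 1
      have "(q has_real_derivative - (\<bar>z\<bar> ^ m * z / sqrt (1 - z\<^sup>2))) (at z)"
        using dq[OF z] 1 by (simp add: mult.commute)
      then show ?thesis
        by (rule has_field_derivative_transform_within_open[where S="{0<..}"]) (use 1 in auto)
    next
      case 2
      then show ?thesis using DERIV_even_at_0[of q] dq[of 0] by simp
    next
      case 3
      have "((\<lambda>z. q (- z)) has_real_derivative - ((- z) ^ (m + 1) / sqrt (1 - (- z)\<^sup>2)) * -1) (at z)"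
        by (rule DERIV_chain2[OF dq]) (use z in \<open>auto intro!: derivative_eq_intros\<close>)
      then have "((\<lambda>z. q (- z)) has_real_derivative - (\<bar>z\<bar> ^ m * z / sqrt (1 - z\<^sup>2))) (at z)"
        using 3 by (simp add: mult.commute)
      then show ?thesis
        by (rule has_field_derivative_transform_within_open[where S="{..<0}"]) (use 3 in auto)
    qed
  qed
  then show ?thesis
    by (rule has_field_derivative_transform_within_open[where S="{-1<..<1}"]) (use z q in auto)
qed

lemma profile_mono:
  assumes "\<bar>z\<bar> \<le> \<bar>w\<bar>" "\<bar>w\<bar> \<le> 1"
  shows "profile (real m) w \<le> profile (real m) z"
proof -
  have z: "\<bar>z\<bar> \<le> 1" using assms by linarith
  have a: "0 \<le> arcsin \<bar>z\<bar>" "arcsin \<bar>z\<bar> \<le> arcsin \<bar>w\<bar>"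
    using arcsin_le_arcsin[of 0 "\<bar>z\<bar>"] arcsin_le_arcsin[of "\<bar>z\<bar>" "\<bar>w\<bar>"] assms by auto
  show ?thesis
    unfolding profile_nat[OF z] profile_nat[OF assms(2)]
  proof (rule integral_subset_le)
    show "\<forall>t\<in>{arcsin \<bar>z\<bar>..pi / 2}. 0 \<le> sin t ^ (m + 1)"
      using a by (intro ballI zero_le_power sin_ge_zero) auto
  qed (use a in \<open>auto intro!: integrable_continuous_interval continuous_intros\<close>)
qed

lemma profile_uminus: "profile \<alpha> (- z) = profile \<alpha> z"
  by (simp add: profile_def)

text \<open>The closed forms for the two exponents are what decides the sign of the constant
  \<open>ybar\<close>.\<close>

lemma profile_0:
  assumes "0 \<le> s" "s \<le> 1"
  shows "profile 0 s = sqrt (1 - s\<^sup>2)"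
proof -
  have "((\<lambda>t. sin t) has_integral - cos (pi / 2) - - cos (arcsin s)) {arcsin s..pi / 2}"
    using assms arcsin_bounded[of s]
    by (intro fundamental_theorem_of_calculus)
       (auto simp flip: has_real_derivative_iff_has_vector_derivative intro!: derivative_eq_intros)
  then show ?thesis
    using profile_nat[of s 0] assms by (simp add: cos_arcsin has_integral_iff)
qed

lemma profile_1:
  assumes "0 \<le> s" "s \<le> 1"
  shows "profile 1 s = (pi / 2 - arcsin s + s * sqrt (1 - s\<^sup>2)) / 2"
proof -
  have "((\<lambda>t. sin t ^ 2) has_integral (pi / 2 - sin (pi / 2) * cos (pi / 2)) / 2
      - (arcsin s - sin (arcsin s) * cos (arcsin s)) / 2) {arcsin s..pi / 2}"
  proof (rule fundamental_theorem_of_calculus)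
    fix t
    have "((\<lambda>t. (t - sin t * cos t) / 2) has_real_derivative
       (1 - (cos t * cos t - sin t * sin t)) / 2) (at t within {arcsin s..pi / 2})"
      by (auto intro!: derivative_eq_intros)
    moreover have "(1 - (cos t * cos t - sin t * sin t)) / 2 = sin t ^ 2"
      using sin_cos_squared_add[of t] by (simp add: power2_eq_square)
    ultimately show "((\<lambda>t. (t - sin t * cos t) / 2) has_vector_derivative sin t ^ 2) (at t within {arcsin s..pi / 2})"
      by (simp add: has_real_derivative_iff_has_vector_derivative)
  qed (use assms arcsin_bounded[of s] in auto)
  then show ?thesis
    using profile_nat[of s 1] assms
    by (simp add: cos_arcsin has_integral_iff power2_eq_square field_simps)
qed

text \<open>The odd power stays differentiable at 0 for \<open>m = 1\<close>, where
  \<open>\<bar>x\<bar>\<close> is not. It enters the primitive used in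
  \<open>integral_extremal\<close>.\<close>

lemma DERIV_mult_abs_power:
  "((\<lambda>x::real. x * \<bar>x\<bar> ^ m) has_real_derivative (real m + 1) * \<bar>x\<bar> ^ m) (at x)"
proof -
  consider "x < 0" | "x = 0" | "x > 0" by linarith
  then show ?thesis
  proof cases
    case 1
    have "((\<lambda>x::real. - ((- x) ^ Suc m)) has_real_derivative (real m + 1) * \<bar>x\<bar> ^ m) (at x)"
      by (rule DERIV_cong[OF DERIV_minus[OF DERIV_power_Suc[OF DERIV_minus[OF DERIV_ident]]]])
         (use 1 in simp)
    then show ?thesis
      by (rule has_field_derivative_transform_within_open[where S="{..<0}"]) (use 1 in auto)
  next
    case 2
    have "isCont (\<lambda>x. \<bar>x\<bar> ^ m) (0::real)" by (intro continuous_intros)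
    then show ?thesis
      unfolding CARAT_DERIV 2 by (intro exI[of _ "\<lambda>x. \<bar>x\<bar> ^ m"]) (auto simp: power_0_left)
  next
    case 3
    have "((\<lambda>x::real. x ^ Suc m) has_real_derivative (real m + 1) * \<bar>x\<bar> ^ m) (at x)"
      by (rule DERIV_cong[OF DERIV_power_Suc[OF DERIV_ident]]) (use 3 in simp)
    then show ?thesis
      by (rule has_field_derivative_transform_within_open[where S="{0<..}"]) (use 3 in auto)
  qed
qed

section \<open>The extremal graph\<close>

definition calib_x :: "real \<Rightarrow> real \<Rightarrow> real \<Rightarrow> real" where
  "calib_x s X x = s * x / X"

definition calib_y :: "real \<Rightarrow> real \<Rightarrow> real \<Rightarrow> real" where
  "calib_y s X x = sqrt (1 - (calib_x s X x)\<^sup>2)"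

text \<open>In the variable \<open>x = X * t\<close> the field depends on \<open>s\<close> alone.
  The weighted integral of \<open>calib_y\<close> over a strip of half-width \<open>X\<close> is
  therefore this constant times \<open>X ^ (m + 1)\<close>.\<close>

definition weight_moment :: "nat \<Rightarrow> real \<Rightarrow> real" where
  "weight_moment m s = integral {-1..1} (\<lambda>t. \<bar>t\<bar> ^ m * sqrt (1 - (s * t)\<^sup>2))"

lemma abs_calib_x_le:
  assumes "0 < s" "0 < X" "x \<in> {-X..X}"
  shows "\<bar>calib_x s X x\<bar> \<le> s"
proof -
  have "s * \<bar>x\<bar> \<le> s * X" using assms by (intro mult_left_mono) auto
  then show ?thesis using assms by (simp add: calib_x_def abs_mult divide_le_eq)
qed

lemma calib_y_ge:
  assumes "0 < s" "s < 1" "0 < X" "x \<in> {-X..X}"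
  shows "calib_y s X x \<ge> sqrt (1 - s\<^sup>2)" "calib_y s X x > 0" "(calib_x s X x)\<^sup>2 + (calib_y s X x)\<^sup>2 = 1"
    "(calib_x s X x)\<^sup>2 < 1"
proof -
  have 1: "(calib_x s X x)\<^sup>2 \<le> s\<^sup>2"
    using abs_calib_x_le[OF assms(1,3,4)] assms(1) by (simp add: abs_le_square_iff[symmetric])
  have 2: "s\<^sup>2 < 1" using assms by (simp add: abs_square_less_1)
  show "calib_y s X x \<ge> sqrt (1 - s\<^sup>2)" using 1 by (simp add: calib_y_def)
  show "(calib_x s X x)\<^sup>2 < 1" using 1 2 by simp
  then show "calib_y s X x > 0" "(calib_x s X x)\<^sup>2 + (calib_y s X x)\<^sup>2 = 1" by (auto simp: calib_y_def)
qed

lemma calib_y_X: "0 < X \<Longrightarrow> calib_y s X X = sqrt (1 - s\<^sup>2)" "0 < X \<Longrightarrow> calib_y s X (-X) = sqrt (1 - s\<^sup>2)"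
  by (simp_all add: calib_y_def calib_x_def)

lemma DERIV_calib_x: "(calib_x s X has_real_derivative s / X) (at x within S)"
  unfolding calib_x_def[abs_def]
  by (rule DERIV_cong[OF DERIV_cdivide[OF DERIV_cmult[OF DERIV_ident]]]) simp

lemma DERIV_calib_y:
  assumes "(calib_x s X x)\<^sup>2 < 1"
  shows "(calib_y s X has_real_derivative - (calib_x s X x * (s / X)) / calib_y s X x) (at x within S)"
proof -
  have "((\<lambda>x. 1 - (calib_x s X x)\<^sup>2) has_real_derivative - (2 * calib_x s X x * (s / X))) (at x within S)"
    by (rule derivative_eq_intros DERIV_calib_x refl)+ simp
  from DERIV_chain2[OF DERIV_real_sqrt this] assms show ?thesis
    unfolding calib_y_def[abs_def] by (auto simp: divide_simps mult.commute)
qed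

lemma continuous_on_calib_y: "continuous_on S (calib_y s X)"
  unfolding calib_y_def[abs_def] calib_x_def by (cases "X = 0") (auto intro!: continuous_intros)

lemma continuous_on_calib_x: "continuous_on S (calib_x s X)"
  using DERIV_calib_x by (rule DERIV_continuous_on)

lemma integral_weight_calib_y:
  assumes "X > 0"
  shows "integral {-X..X} (\<lambda>x. \<bar>x\<bar> ^ m * calib_y s X x) = X ^ (m + 1) * weight_moment m s"
proof -
  have "((\<lambda>t. X *\<^sub>R (\<bar>X * t\<bar> ^ m * calib_y s X (X * t))) has_integral
      integral {X * -1..X * 1} (\<lambda>x. \<bar>x\<bar> ^ m * calib_y s X x)) {-1..1}"
  proof (rule has_integral_substitution[where g="\<lambda>t. X * t" and g'="\<lambda>_. X"
          and f="\<lambda>x. \<bar>x\<bar> ^ m * calib_y s X x" and a="-1" and b=1 and c="-X" and d=X])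
    show "(\<lambda>t. X * t) ` {-1..1} \<subseteq> {-X..X}"
    proof clarify
      fix t :: real assume "t \<in> {-1..1}"
      then have "X * \<bar>t\<bar> \<le> X * 1" using assms by (intro mult_left_mono) auto
      then have "\<bar>X * t\<bar> \<le> X" using assms by (simp add: abs_mult)
      then show "X * t \<in> {-X..X}" by (simp add: abs_le_iff)
    qed
    show "continuous_on {-X..X} (\<lambda>x. \<bar>x\<bar> ^ m * calib_y s X x)"
      by (intro continuous_intros continuous_on_calib_y)
    show "((\<lambda>t. X * t) has_real_derivative X) (at t within {-1..1})" for t
      by (auto intro!: derivative_eq_intros)
  qed (use assms in auto)
  moreover have eq: "X *\<^sub>R (\<bar>X * t\<bar> ^ m * calib_y s X (X * t)) = X ^ (m + 1) * (\<bar>t\<bar> ^ m * sqrt (1 - (s * t)\<^sup>2))" for t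
    using assms by (simp add: calib_y_def calib_x_def abs_mult power_mult_distrib)
  ultimately have "((\<lambda>t. X ^ (m + 1) * (\<bar>t\<bar> ^ m * sqrt (1 - (s * t)\<^sup>2))) has_integral
      integral {X * -1..X * 1} (\<lambda>x. \<bar>x\<bar> ^ m * calib_y s X x)) {-1..1}"
    by (simp only: eq)
  from integral_unique[OF this] show ?thesis
    unfolding integral_mult_right weight_moment_def[symmetric] by simp
qed

lemma weight_moment_pos:
  assumes "0 < s" "s < 1"
  shows "weight_moment m s > 0"
proof -
  have nn: "0 \<le> \<bar>t\<bar> ^ m * sqrt (1 - (s * t)\<^sup>2)" if "t \<in> {-1..1}" for t
  proof -
    have "\<bar>s * t\<bar> \<le> 1" using that assms by (auto simp: abs_mult intro!: mult_le_one)
    then show ?thesis by (simp add: abs_square_le_1 del: abs_mult)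
  qed
  have "weight_moment m s \<noteq> 0"
  proof
    assume "weight_moment m s = 0"
    then have "((\<lambda>t. \<bar>t\<bar> ^ m * sqrt (1 - (s * t)\<^sup>2)) has_integral 0) (cbox (-1) 1)"
      unfolding weight_moment_def by (simp add: has_integral_iff integrable_continuous_interval continuous_intros)
    \<comment> \<open>A continuous nonnegative function with integral 0 vanishes. It is tested at
      \<open>t = 1\<close>, where the weight is 1 for every \<open>m\<close>.\<close>
    then have "\<bar>1\<bar> ^ m * sqrt (1 - (s * 1)\<^sup>2) = 0"
      by (rule has_integral_0_cbox_imp_0[rotated 2])
         (use nn in \<open>auto intro!: continuous_intros\<close>)
    moreover have "s\<^sup>2 < 1" using assms by (simp add: abs_square_less_1)
    ultimately show False by simp
  qed
  moreover have "weight_moment m s \<ge> 0"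
    unfolding weight_moment_def by (rule integral_nonneg) (use nn in \<open>auto intro!: integrable_continuous_interval continuous_intros\<close>)
  ultimately show ?thesis by simp
qed

lemma weight_moment_0:
  assumes "0 < s" "s < 1"
  shows "weight_moment 0 s = (arcsin s + s * sqrt (1 - s\<^sup>2)) / s"
proof -
  let ?F = "\<lambda>t. (arcsin (s * t) + s * t * sqrt (1 - (s * t)\<^sup>2)) / (2 * s)"
  have "((\<lambda>t. sqrt (1 - (s * t)\<^sup>2)) has_integral ?F 1 - ?F (-1)) {-1..1}"
  proof (rule fundamental_theorem_of_calculus)
    fix t :: real assume t: "t \<in> {-1..1}"
    define u where "u = sqrt (1 - (s * t)\<^sup>2)"
    have "\<bar>s * t\<bar> \<le> \<bar>s\<bar> * 1" unfolding abs_mult using t by (intro mult_left_mono) auto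
    then have st: "\<bar>s * t\<bar> < 1" using assms by simp
    then have lt: "(s * t)\<^sup>2 < 1" by (simp add: abs_square_less_1 del: abs_mult)
    then have u: "u > 0" "u\<^sup>2 = 1 - (s * t)\<^sup>2" by (auto simp: u_def)
    have d1: "((\<lambda>t. arcsin (s * t)) has_real_derivative inverse u * s) (at t)"
      unfolding u_def by (rule DERIV_chain2[OF DERIV_arcsin]) (use st in \<open>auto intro!: derivative_eq_intros\<close>)
    have d0: "((\<lambda>t. 1 - (s * t)\<^sup>2) has_real_derivative - (2 * (s * t) * s)) (at t)"
      by (auto intro!: derivative_eq_intros)
    have d2: "((\<lambda>t. sqrt (1 - (s * t)\<^sup>2)) has_real_derivative inverse u / 2 * - (2 * (s * t) * s)) (at t)"
      unfolding u_def by (rule DERIV_chain2[OF DERIV_real_sqrt d0]) (use lt in simp)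
    have d3: "((\<lambda>t. s * t) has_real_derivative s) (at t)" by (auto intro!: derivative_eq_intros)
    have eq: "(inverse u * s + (s * u + inverse u / 2 * - (2 * (s * t) * s) * (s * t))) / (2 * s) = u"
    proof -
      have "inverse u * s + (s * u + inverse u / 2 * - (2 * (s * t) * s) * (s * t))
         = s * (u + inverse u * (1 - (s * t)\<^sup>2))" by (simp add: algebra_simps power2_eq_square)
      also have "\<dots> = s * (2 * u)" unfolding u(2)[symmetric] using u(1) by (simp add: power2_eq_square)
      finally have *: "inverse u * s + (s * u + inverse u / 2 * - (2 * (s * t) * s) * (s * t)) = s * (2 * u)" .
      show ?thesis unfolding * using assms by simp
    qed
    have "(?F has_real_derivative u) (at t)"
      by (rule DERIV_cong[OF DERIV_cdivide[OF DERIV_add[OF d1 DERIV_mult[OF d3 d2]]]])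
         (use eq in \<open>simp add: u_def\<close>)
    then show "(?F has_vector_derivative sqrt (1 - (s * t)\<^sup>2)) (at t within {-1..1})"
      unfolding u_def has_real_derivative_iff_has_vector_derivative[symmetric]
      by (rule has_field_derivative_at_within)
  qed simp
  then have "weight_moment 0 s = ?F 1 - ?F (-1)" by (simp add: weight_moment_def has_integral_iff)
  also have "\<dots> = (arcsin s + s * sqrt (1 - s\<^sup>2)) / s"
    using assms arcsin_minus[of s] by (simp add: field_simps)
  finally show ?thesis .
qed

lemma weight_moment_1:
  assumes "0 < s" "s < 1"
  shows "weight_moment 1 s = 2 / 3 * (1 - (sqrt (1 - s\<^sup>2)) ^ 3) / s\<^sup>2"
proof -
  let ?u = "\<lambda>t. sqrt (1 - (s * t)\<^sup>2)"
  let ?f = "\<lambda>t. \<bar>t\<bar> * ?u t"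
  \<comment> \<open>On the right half the absolute value disappears and the integrand has an
    elementary primitive; the left half follows by reflection.\<close>
  have half: "(?f has_integral 1 / (3 * s\<^sup>2) - ?u 1 ^ 3 / (3 * s\<^sup>2)) {0..1}"
  proof -
    have "((\<lambda>t. \<bar>t\<bar> * ?u t) has_integral - (?u 1 ^ 3) / (3 * s\<^sup>2) - - (?u 0 ^ 3) / (3 * s\<^sup>2)) {0..1}"
    proof (rule fundamental_theorem_of_calculus)
      fix t :: real assume t: "t \<in> {0..1}"
      have "\<bar>s * t\<bar> \<le> \<bar>s\<bar> * 1" unfolding abs_mult using t by (intro mult_left_mono) auto
      then have st: "\<bar>s * t\<bar> < 1" using assms by simp
      then have lt: "(s * t)\<^sup>2 < 1" by (simp add: abs_square_less_1 del: abs_mult)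
      then have u: "?u t > 0" by simp
      have d0: "((\<lambda>t. 1 - (s * t)\<^sup>2) has_real_derivative - (2 * (s * t) * s)) (at t)"
        by (auto intro!: derivative_eq_intros)
      have d2: "(?u has_real_derivative inverse (?u t) / 2 * - (2 * (s * t) * s)) (at t)"
        by (rule DERIV_chain2[OF DERIV_real_sqrt d0]) (use lt in simp)
      have "((\<lambda>t. - (?u t ^ 3) / (3 * s\<^sup>2)) has_real_derivative \<bar>t\<bar> * ?u t) (at t)"
        by (rule DERIV_cong[OF DERIV_cdivide[OF DERIV_minus[OF DERIV_power[OF d2]]]])
           (use u t assms in \<open>simp add: power2_eq_square field_simps\<close>)
      then show "((\<lambda>t. - (?u t ^ 3) / (3 * s\<^sup>2)) has_vector_derivative \<bar>t\<bar> * ?u t) (at t within {0..1})"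
        unfolding has_real_derivative_iff_has_vector_derivative[symmetric]
        by (rule has_field_derivative_at_within)
    qed simp
    then show ?thesis by simp
  qed
  have "((\<lambda>t. ?f (- t)) has_integral 1 / (3 * s\<^sup>2) - ?u 1 ^ 3 / (3 * s\<^sup>2)) {-1..-0}"
    using half has_integral_reflect_real[where f="?f" and a=0 and b=1] by simp
  then have "(?f has_integral 1 / (3 * s\<^sup>2) - ?u 1 ^ 3 / (3 * s\<^sup>2)) {-1..0}" by simp
  from has_integral_combine[OF _ _ this half]
  have "weight_moment 1 s = 2 * (1 / (3 * s\<^sup>2) - ?u 1 ^ 3 / (3 * s\<^sup>2))"
    by (auto simp: weight_moment_def has_integral_iff)
  then show ?thesis using assms by (simp add: field_simps)
qed

section \<open>Extremal graphs and their perimeter\<close>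

definition extremal :: "nat \<Rightarrow> real \<Rightarrow> real \<Rightarrow> real \<Rightarrow> real \<Rightarrow> real" where
  "extremal m s X h x = (X / s) ^ (m + 1) * (profile (real m) (x / (X / s)) - profile (real m) s) + h"

text \<open>\<open>X / s\<close> is the parameter lambda, and the rescaled abscissa of the right
  side is \<open>s\<close>. Subtracting \<open>profile (real m) s\<close> is what fixes the height
  \<open>h\<close> at the sides.\<close>

lemma extremal_X:
  assumes "0 < s" "0 < X"
  shows "extremal m s X h X = h" "extremal m s X h (-X) = h"
  using assms profile_uminus[of "real m" s] by (simp_all add: extremal_def)

lemma extremal_even: "extremal m s X h (- x) = extremal m s X h x"
  using profile_uminus[of "real m" "x / (X / s)"] by (simp add: extremal_def)

lemma extremal_ge:
  assumes "0 < s" "s < 1" "0 < X" "x \<in> {-X..X}"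
  shows "h \<le> extremal m s X h x"
proof -
  have "\<bar>x / (X / s)\<bar> \<le> \<bar>s\<bar>" using abs_calib_x_le[OF assms(1,3,4)] assms by (simp add: calib_x_def mult.commute)
  then have "profile (real m) s \<le> profile (real m) (x / (X / s))"
    by (rule profile_mono) (use assms in simp)
  then show ?thesis using assms by (simp add: extremal_def)
qed

text \<open>With \<open>f'\<close> for the slope, \<open>(- f', \<bar>x\<bar> ^ m)\<close> is a
  nonnegative multiple of \<open>(calib_x, calib_y)\<close>: the case of equality in Cauchy-Schwarz.
  That \<open>calib_x\<close> has constant slope is the Euler-Lagrange equation under the area
  constraint.\<close>

lemma DERIV_extremal:
  assumes "0 < s" "s < 1" "0 < X" "x \<in> {-X..X}"
  shows "(extremal m s X h has_real_derivative - (\<bar>x\<bar> ^ m * calib_x s X x / calib_y s X x)) (at x within S)"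
proof -
  define L where "L = X / s"
  have L: "L > 0" using assms by (simp add: L_def)
  have g: "x / L = calib_x s X x" by (simp add: calib_x_def L_def mult.commute)
  have "(calib_x s X x)\<^sup>2 < 1" by (rule calib_y_ge(4)[OF assms])
  then have z: "\<bar>x / L\<bar> < 1" unfolding g by (simp add: abs_square_less_1)
  have "((\<lambda>x. profile (real m) (x / L)) has_real_derivative
     - (\<bar>x / L\<bar> ^ m * (x / L) / sqrt (1 - (x / L)\<^sup>2)) * (1 / L)) (at x)"
    by (rule DERIV_chain2[of "profile (real m)" _ "\<lambda>x. x / L", OF DERIV_profile[OF z]]) (use L in \<open>auto intro!: derivative_eq_intros\<close>)
  then have "((\<lambda>x. L ^ (m + 1) * (profile (real m) (x / L) - profile (real m) s) + h) has_real_derivative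
     L ^ (m + 1) * (- (\<bar>x / L\<bar> ^ m * (x / L) / sqrt (1 - (x / L)\<^sup>2)) * (1 / L))) (at x)"
    by (auto intro!: derivative_eq_intros)
  moreover have "L ^ (m + 1) * (- (\<bar>x / L\<bar> ^ m * (x / L) / sqrt (1 - (x / L)\<^sup>2)) * (1 / L))
     = - (\<bar>x\<bar> ^ m * calib_x s X x / calib_y s X x)"
    using L unfolding calib_y_def g[symmetric] by (simp add: power_divide)
  ultimately show ?thesis
    unfolding extremal_def[abs_def] L_def by (auto intro: has_field_derivative_at_within)
qed

lemma continuous_on_extremal:
  assumes "0 < s" "s < 1" "0 < X"
  shows "continuous_on {-X..X} (extremal m s X h)"
  using DERIV_extremal[OF assms] by (rule DERIV_continuous_on)

text \<open>Alignment with the field turns the length density into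
  \<open>\<bar>x\<bar> ^ m * k - g * f'\<close>, and integration by parts turns
  \<open>g * f'\<close> into the area. The length is never evaluated; the result is the expression
  that \<open>calib_value\<close> gives as a lower bound.\<close>

lemma perimeter_extremal_le:
  assumes s: "0 < s" "s < 1" and X: "0 < X" and h: "0 < h"
  shows "perimeter (real m) (subgraph X (extremal m s X h))
    \<le> ereal (2 * (2 * (1 - s) * h + s / X * integral {-X..X} (extremal m s X h) + X ^ (m + 1) * weight_moment m s))"
proof -
  let ?I = "{-X..X}" and ?f = "extremal m s X h" and ?g = "calib_x s X" and ?k = "calib_y s X"
  define f' where "f' x = - (\<bar>x\<bar> ^ m * ?g x / ?k x)" for x
  have df: "(?f has_real_derivative f' x) (at x within ?I)" if "x \<in> ?I" for x
    unfolding f'_def by (rule DERIV_extremal[OF s X that])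
  have k: "?k x > 0" "(?g x)\<^sup>2 + (?k x)\<^sup>2 = 1" if "x \<in> ?I" for x using calib_y_ge[OF s X that] by auto
  have cf': "continuous_on ?I f'"
    unfolding f'_def[abs_def] using k(1)
    by (intro continuous_intros continuous_on_calib_x continuous_on_calib_y) force
  have cf: "continuous_on ?I ?f" by (rule continuous_on_extremal[OF s X])
  have "integral ?I (\<lambda>x. sqrt ((f' x)\<^sup>2 + (\<bar>x\<bar> ^ m)\<^sup>2)) = integral ?I (\<lambda>x. \<bar>x\<bar> ^ m * ?k x - ?g x * f' x)"
  proof (rule integral_cong)
    fix x assume x: "x \<in> ?I"
    let ?w = "\<bar>x\<bar> ^ m"
    have "(f' x)\<^sup>2 + ?w\<^sup>2 = (?w / ?k x)\<^sup>2 * ((?g x)\<^sup>2 + (?k x)\<^sup>2)"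
      using k(1)[OF x] by (simp add: f'_def power_divide power_mult_distrib field_simps)
    then have "sqrt ((f' x)\<^sup>2 + ?w\<^sup>2) = ?w / ?k x" using k[OF x] by simp
    moreover have "?w * ?k x - ?g x * f' x = ?w * ((?g x)\<^sup>2 + (?k x)\<^sup>2) / ?k x"
      using k(1)[OF x] by (simp add: f'_def power2_eq_square field_simps)
    ultimately show "sqrt ((f' x)\<^sup>2 + ?w\<^sup>2) = ?w * ?k x - ?g x * f' x" using k(2)[OF x] by simp
  qed
  also have "\<dots> = integral ?I (\<lambda>x. \<bar>x\<bar> ^ m * ?k x) - integral ?I (\<lambda>x. ?g x * f' x)"
    by (intro integral_diff integrable_continuous_interval continuous_intros continuous_on_calib_y continuous_on_calib_x cf')
  also have "integral ?I (\<lambda>x. ?g x * f' x) = 2 * s * h - s / X * integral ?I ?f"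
  proof -
    have "((\<lambda>x. s / X * ?f x + f' x * ?g x) has_integral ?g X * ?f X - ?g (-X) * ?f (-X)) ?I"
    proof (rule fundamental_theorem_of_calculus)
      fix x assume "x \<in> ?I"
      from DERIV_mult[OF DERIV_calib_x df[OF this]]
      show "((\<lambda>x. ?g x * ?f x) has_vector_derivative s / X * ?f x + f' x * ?g x) (at x within ?I)"
        unfolding has_real_derivative_iff_has_vector_derivative .
    qed (use X in simp)
    moreover have "?g X * ?f X - ?g (-X) * ?f (-X) = 2 * s * h"
      using extremal_X[OF s(1) X] X by (simp add: calib_x_def)
    ultimately have "integral ?I (\<lambda>x. s / X * ?f x + f' x * ?g x) = 2 * s * h"
      by (simp only: has_integral_iff)
    moreover have "integral ?I (\<lambda>x. s / X * ?f x + f' x * ?g x)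
        = integral ?I (\<lambda>x. s / X * ?f x) + integral ?I (\<lambda>x. f' x * ?g x)"
      by (intro integral_add integrable_continuous_interval continuous_intros continuous_on_calib_x cf' cf)
    ultimately show ?thesis by (simp only: integral_mult_right mult.commute[of "f' _"])
  qed
  also have "integral ?I (\<lambda>x. \<bar>x\<bar> ^ m * ?k x) = X ^ (m + 1) * weight_moment m s" by (rule integral_weight_calib_y[OF X])
  finally have eq: "integral ?I (\<lambda>x. sqrt ((f' x)\<^sup>2 + (\<bar>x\<bar> ^ m)\<^sup>2))
      = X ^ (m + 1) * weight_moment m s - (2 * s * h - s / X * integral ?I ?f)" .
  have "?f x > 0" if "x \<in> ?I" for x using extremal_ge[OF s X that, of h m] h by simp
  then have "perimeter (real m) (subgraph X ?f)
    \<le> ereal (2 * (?f X + ?f (-X) + integral ?I (\<lambda>x. sqrt ((f' x)\<^sup>2 + (\<bar>x\<bar> ^ m)\<^sup>2))))"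
    by (intro perimeter_subgraph_le[OF X df cf'])
  then show ?thesis
    unfolding eq extremal_X[OF s(1) X] by (simp add: algebra_simps)
qed

text \<open>The condition on \<open>X\<close> is stationarity of the functional with respect to moving the
  vertical sides.\<close>

lemma integral_extremal:
  assumes s: "0 < s" "s < 1" and X: "0 < X" and st: "X ^ (m + 1) * sqrt (1 - s\<^sup>2) = h * s"
  shows "s * integral {-X..X} (extremal m s X h) = (real m + 1) * X ^ (m + 2) * weight_moment m s"
proof -
  let ?I = "{-X..X}" and ?f = "extremal m s X h" and ?g = "calib_x s X" and ?k = "calib_y s X"
  have cf: "continuous_on ?I ?f" by (rule continuous_on_extremal[OF s X])
  \<comment> \<open>In the derivative of \<open>?T\<close> the term with the derivative of
    \<open>?k\<close> equals the term with the derivative of \<open>?f\<close>, and the two cancel.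
    At the sides \<open>?T\<close> vanishes by \<open>st\<close>.\<close>
  let ?T = "\<lambda>x. x * \<bar>x\<bar> ^ m * ?k x - ?g x * ?f x"
  have "((\<lambda>x. (real m + 1) * (\<bar>x\<bar> ^ m * ?k x) - s / X * ?f x) has_integral ?T X - ?T (-X)) ?I"
  proof (rule fundamental_theorem_of_calculus)
    fix x assume x: "x \<in> ?I"
    have k: "?k x > 0" "(?g x)\<^sup>2 < 1" using calib_y_ge[OF s X x] by auto
    have gx: "x * (s / X) = ?g x" by (simp add: calib_x_def)
    have "(?T has_real_derivative ((real m + 1) * \<bar>x\<bar> ^ m * ?k x + - (?g x * (s / X)) / ?k x * (x * \<bar>x\<bar> ^ m))
       - (s / X * ?f x + - (\<bar>x\<bar> ^ m * ?g x / ?k x) * ?g x)) (at x within ?I)"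
      by (intro DERIV_diff DERIV_mult has_field_derivative_at_within[OF DERIV_mult_abs_power]
          DERIV_calib_y DERIV_calib_x DERIV_extremal s X x k)
    moreover have "- (?g x * (s / X)) / ?k x * (x * \<bar>x\<bar> ^ m) = - (\<bar>x\<bar> ^ m * ?g x / ?k x) * ?g x"
      unfolding gx[symmetric] by (simp add: mult_ac)
    ultimately show "(?T has_vector_derivative (real m + 1) * (\<bar>x\<bar> ^ m * ?k x) - s / X * ?f x) (at x within ?I)"
      unfolding has_real_derivative_iff_has_vector_derivative[symmetric] by (simp add: mult.assoc)
  qed (use X in simp)
  moreover have "?T X = 0" "?T (-X) = 0"
    using st X extremal_X[OF s(1) X] by (simp_all add: calib_y_X calib_x_def mult.commute)
  ultimately have "integral ?I (\<lambda>x. (real m + 1) * (\<bar>x\<bar> ^ m * ?k x) - s / X * ?f x) = 0"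
    by (simp add: has_integral_iff)
  moreover have "integral ?I (\<lambda>x. (real m + 1) * (\<bar>x\<bar> ^ m * ?k x) - s / X * ?f x)
     = integral ?I (\<lambda>x. (real m + 1) * (\<bar>x\<bar> ^ m * ?k x)) - integral ?I (\<lambda>x. s / X * ?f x)"
    by (intro integral_diff integrable_continuous_interval continuous_intros continuous_on_calib_y cf)
  ultimately have "(real m + 1) * (X ^ (m + 1) * weight_moment m s) = s / X * integral ?I ?f"
    by (simp only: integral_mult_right integral_weight_calib_y[OF X])
  then show ?thesis using X by (simp add: field_simps)
qed

text \<open>With \<open>s = sin t\<close> the first equation gives \<open>X\<close>, and the second one becomes, after squaring
  if \<open>m = 1\<close> and cancelling positive factors, the equation \<open>F t = 0\<close> for the angle \<open>t\<close>.\<close>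

lemma exists_parameters:
  assumes "m = 0 \<or> m = 1" and v: "v > 0" and h: "h > 0"
  obtains s X where "0 < s" "s < 1" "0 < X" "X ^ (m + 1) * sqrt (1 - s\<^sup>2) = h * s"
    "s * (v / 2) = (real m + 1) * X ^ (m + 2) * weight_moment m s"
  using assms(1)
proof
  assume m: "m = 0"
  \<comment> \<open>Inserting \<open>X = h * s / c\<close> with \<open>c = cos t\<close> and the
    formula for \<open>weight_moment 0 s\<close>, the second equation becomes \<open>F t = 0\<close>
    after multiplication by \<open>c ^ 2 / s\<close>.\<close>
  define F where "F t = h\<^sup>2 * (t + sin t * cos t) - v / 2 * (cos t)\<^sup>2" for t
  have "\<exists>t\<ge>0. t \<le> pi / 2 \<and> F t = 0"
    by (rule IVT') (use v h in \<open>auto simp: F_def intro!: continuous_intros\<close>)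
  then obtain t where t: "0 \<le> t" "t \<le> pi / 2" "F t = 0" by blast
  have "F (pi / 2) \<noteq> 0" "F 0 \<noteq> 0" using v h by (simp_all add: F_def)
  then have "t \<noteq> 0" "t \<noteq> pi / 2" using t(3) by blast+
  then have t': "0 < t" "t < pi / 2" using t by auto
  let ?s = "sin t" and ?c = "cos t"
  have c: "?c > 0" "?s > 0" using t' by (auto intro: cos_gt_zero sin_gt_zero_02 sin_gt_zero)
  have s1: "?s < 1" using sin_monotone_2pi[of t "pi / 2"] t' by simp
  have sq: "sqrt (1 - ?s\<^sup>2) = ?c" using c by (simp add: cos_squared_eq[symmetric])
  have as: "arcsin ?s = t" using t' by (intro arcsin_sin) auto
  show thesis
  proof (rule that)
    show "(h * ?s / ?c) ^ (m + 1) * sqrt (1 - ?s\<^sup>2) = h * ?s" using c by (simp add: m sq)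
    have "v / 2 = h\<^sup>2 * (t + ?s * ?c) / ?c\<^sup>2"
      using t(3) c by (simp add: F_def eq_divide_eq)
    then have "?s * (v / 2) = ?s * (h\<^sup>2 * (t + ?s * ?c) / ?c\<^sup>2)" by (simp only:)
    also have "\<dots> = (h * ?s / ?c)\<^sup>2 * ((t + ?s * ?c) / ?s)"
      using c by (simp add: power2_eq_square)
    also have "(t + ?s * ?c) / ?s = weight_moment m ?s"
      using weight_moment_0[OF c(2) s1] unfolding m as sq by simp
    finally show "?s * (v / 2) = (real m + 1) * (h * ?s / ?c) ^ (m + 2) * weight_moment m ?s"
      by (simp add: m power2_eq_square)
  qed (use c s1 h in auto)
next
  assume m: "m = 1"
  \<comment> \<open>The second equation reads \<open>X ^ 3 * (1 - c ^ 3) = 3 / 8 * v * s ^ 3\<close>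
    with \<open>c = cos t\<close>, hence \<open>9 / 64\<close> after squaring. With
    \<open>X ^ 2 = h * s / c\<close> and \<open>s ^ 2 = (1 - c) * (1 + c)\<close>, the common factor
    \<open>s ^ 2 * (1 - c) ^ 2\<close> drops out.\<close>
  define F where "F t = h ^ 3 * sin t * (1 + cos t + (cos t)\<^sup>2)\<^sup>2 - 9 / 64 * v\<^sup>2 * (1 + cos t)\<^sup>2 * cos t ^ 3" for t
  have "\<exists>t\<ge>0. t \<le> pi / 2 \<and> F t = 0"
    by (rule IVT') (use v h in \<open>auto simp: F_def intro!: continuous_intros\<close>)
  then obtain t where t: "0 \<le> t" "t \<le> pi / 2" "F t = 0" by blast
  have "F (pi / 2) \<noteq> 0" "F 0 \<noteq> 0" using v h by (simp_all add: F_def)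
  then have "t \<noteq> 0" "t \<noteq> pi / 2" using t(3) by blast+
  then have t': "0 < t" "t < pi / 2" using t by auto
  let ?s = "sin t" and ?c = "cos t"
  have c: "?c > 0" "?s > 0" using t' by (auto intro: cos_gt_zero sin_gt_zero_02 sin_gt_zero)
  have s1: "?s < 1" using sin_monotone_2pi[of t "pi / 2"] t' by simp
  have sq: "sqrt (1 - ?s\<^sup>2) = ?c" using c by (simp add: cos_squared_eq[symmetric])
  define X where "X = sqrt (h * ?s / ?c)"
  have X: "X > 0" "X\<^sup>2 = h * ?s / ?c" using h c by (auto simp: X_def)
  have c3: "?c ^ 3 \<le> 1" using c by (intro power_le_one) auto
  have key: "X ^ 3 * (1 - ?c ^ 3) = 3 / 8 * v * ?s ^ 3"
  proof (rule power2_eq_imp_eq)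
    have s2: "?s\<^sup>2 = (1 - ?c) * (1 + ?c)" using sin_squared_eq[of t] by (simp add: power2_eq_square algebra_simps)
    have "(X ^ 3 * (1 - ?c ^ 3))\<^sup>2 = (X\<^sup>2) ^ 3 * (1 - ?c ^ 3)\<^sup>2"
      by (simp add: power_mult_distrib flip: power_mult)
    also have "\<dots> = (h ^ 3 * ?s * (1 + ?c + ?c\<^sup>2)\<^sup>2) * ?s\<^sup>2 * (1 - ?c)\<^sup>2 / ?c ^ 3"
      unfolding X(2) using c by (simp add: field_simps power2_eq_square power3_eq_cube)
    also have "h ^ 3 * ?s * (1 + ?c + ?c\<^sup>2)\<^sup>2 = 9 / 64 * v\<^sup>2 * (1 + ?c)\<^sup>2 * ?c ^ 3"
      using t(3) by (simp add: F_def)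
    also have "9 / 64 * v\<^sup>2 * (1 + ?c)\<^sup>2 * ?c ^ 3 * ?s\<^sup>2 * (1 - ?c)\<^sup>2 / ?c ^ 3
       = 9 / 64 * v\<^sup>2 * ?s\<^sup>2 * ((1 - ?c) * (1 + ?c))\<^sup>2"
      using c by (simp add: power_mult_distrib)
    also have "\<dots> = (3 / 8 * v * ?s ^ 3)\<^sup>2"
      unfolding s2[symmetric] by (simp add: power_mult_distrib power2_eq_square power3_eq_cube)
    finally show "(X ^ 3 * (1 - ?c ^ 3))\<^sup>2 = (3 / 8 * v * ?s ^ 3)\<^sup>2" .
  qed (use X c v c3 in auto)
  show thesis
  proof (rule that)
    have "X\<^sup>2 * ?c = h * ?s" unfolding X(2) using c by simp
    then show "X ^ (m + 1) * sqrt (1 - ?s\<^sup>2) = h * ?s" unfolding sq m by (simp add: power2_eq_square)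
    have "weight_moment m ?s = 2 / 3 * (1 - ?c ^ 3) / ?s\<^sup>2"
      using weight_moment_1[OF c(2) s1] unfolding m sq .
    then have "(real m + 1) * X ^ (m + 2) * weight_moment m ?s = 4 / 3 * (X ^ 3 * (1 - ?c ^ 3)) / ?s\<^sup>2"
      by (simp add: m eval_nat_numeral)
    also have "\<dots> = ?s * (v / 2)"
      unfolding key using c by (simp add: power2_eq_square power3_eq_cube)
    finally show "?s * (v / 2) = (real m + 1) * X ^ (m + 2) * weight_moment m ?s" ..
  qed (use c s1 X in auto)
qed

section \<open>Rigidity and the shape of the center\<close>

text \<open>The calibration \<open>(g, k)\<close> is perturbed to \<open>(g + t e, k - t e g / k)\<close>, divided by \<open>1 + t\<^sup>2 B\<^sup>2\<close> to keep
  its length at most \<open>1\<close>. Since \<open>calib\<close> is linear in the field, optimality of \<open>t = 0\<close> forces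
  the first variation to vanish, and for \<open>e' = f - c\<close>, where \<open>c\<close> is the extremal graph, this
  variation is the integral of \<open>(f - c)\<^sup>2\<close>.\<close>

lemma subgraph_calibration_rigid:
  assumes s: "0 < s" "s < 1" and X: "0 < X" and h: "0 < h"
    and f: "continuous_on {-X..X} f" and fh: "\<And>x. x \<in> {-X..X} \<Longrightarrow> h \<le> f x" "f X = h" "f (-X) = h"
    and P: "perimeter (real m) (subgraph X f)
      \<le> ereal (2 * (2 * h + calib m X f (calib_x s X) (\<lambda>_. s / X) (calib_y s X)))"
    and x: "x \<in> {-X..X}"
  shows "f x = extremal m s X h x"
proof -
  let ?I = "{-X..X}" and ?g = "calib_x s X" and ?k = "calib_y s X" and ?c = "extremal m s X h"
  define k' where "k' x = - (?g x * (s / X)) / ?k x" for x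
  have k: "?k x > 0" "(?g x)\<^sup>2 < 1" "(?g x)\<^sup>2 + (?k x)\<^sup>2 = 1" if "x \<in> ?I" for x
    using calib_y_ge[OF s X that] by auto
  have k0: "?k x \<noteq> 0" if "x \<in> ?I" for x using k(1)[OF that] by simp
  have dk: "(?k has_real_derivative k' x) (at x within ?I)" if "x \<in> ?I" for x
    unfolding k'_def by (rule DERIV_calib_y[OF k(2)[OF that]])
  have ck': "continuous_on ?I k'"
    unfolding k'_def[abs_def] by (intro continuous_intros continuous_on_calib_x continuous_on_calib_y ballI k0)
  have cc: "continuous_on ?I ?c" by (rule continuous_on_extremal[OF s X])
  define d where "d x = f x - ?c x" for x
  have cd: "continuous_on ?I d" unfolding d_def[abs_def] by (intro continuous_intros f cc)
  \<comment> \<open>\<open>e\<close> may be nonzero at \<open>X\<close>. The boundary terms this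
    creates cancel, because \<open>f\<close> and \<open>?c\<close> have the same height
    \<open>h\<close> there.\<close>
  define e where "e x = integral {-X..x} d" for x
  have de: "(e has_real_derivative d x) (at x within ?I)" if "x \<in> ?I" for x
    unfolding e_def[abs_def] by (rule integral_has_real_derivative[OF cd that])
  have ce: "continuous_on ?I e" using de by (rule DERIV_continuous_on)
  \<comment> \<open>Chosen such that \<open>(e, r)\<close> is orthogonal to \<open>(?g, ?k)\<close>:
    the length of the perturbed field then changes only to second order in \<open>t\<close>.\<close>
  define r where "r x = - (e x * ?g x / ?k x)" for x
  define r' where "r' x = - (((d x * ?g x + s / X * e x) * ?k x - e x * ?g x * k' x) / (?k x * ?k x))" for x
  have dr: "(r has_real_derivative r' x) (at x within ?I)" if "x \<in> ?I" for x
    unfolding r_def[abs_def] r'_def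
    by (intro DERIV_minus DERIV_divide DERIV_mult DERIV_calib_x de dk k0 that)
  have cr': "continuous_on ?I r'"
    unfolding r'_def[abs_def]
    by (intro continuous_intros continuous_on_calib_x continuous_on_calib_y ballI ck' cd ce) (use k0 in simp)
  have cr: "continuous_on ?I r" using dr by (rule DERIV_continuous_on)
  have "bounded ((\<lambda>x. e x / ?k x) ` ?I)"
    by (intro compact_imp_bounded compact_continuous_image compact_Icc continuous_intros ce continuous_on_calib_y ballI k0)
  then obtain B where "\<forall>y\<in>(\<lambda>x. e x / ?k x) ` ?I. norm y \<le> B" unfolding bounded_iff by blast
  then have B: "\<bar>e x / ?k x\<bar> \<le> B" if "x \<in> ?I" for x using that by simp
  define L\<^sub>0 where "L\<^sub>0 = calib m X f ?g (\<lambda>_. s / X) ?k"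
  define L\<^sub>1 where "L\<^sub>1 = calib m X f e d r"
  \<comment> \<open>The variation is linear in \<open>t\<close>, while the normalization costs a
    quadratic term; both signs of \<open>t\<close> are admissible.\<close>
  have var: "t * L\<^sub>1 \<le> t\<^sup>2 * (B\<^sup>2 * L\<^sub>0)" for t
  proof -
    define N where "N = 1 + t\<^sup>2 * B\<^sup>2"
    have N: "N \<ge> 1" by (simp add: N_def)
    define G where "G x = (?g x + t * e x) / N" for x
    define G' where "G' x = (s / X + t * d x) / N" for x
    define K where "K x = (?k x + t * r x) / N" for x
    define K' where "K' x = (k' x + t * r' x) / N" for x
    have "ereal (2 * (f X + f (-X) + calib m X f G G' K)) \<le> perimeter (real m) (subgraph X f)"
    proof (rule perimeter_subgraph_ge[OF X h f fh(1), where k' = K'])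
      fix x assume x: "x \<in> ?I"
      show "(G has_real_derivative G' x) (at x within ?I)"
        unfolding G_def[abs_def] G'_def
        by (intro DERIV_cdivide DERIV_add DERIV_calib_x DERIV_cmult de x)
      show "(K has_real_derivative K' x) (at x within ?I)"
        unfolding K_def[abs_def] K'_def by (intro DERIV_cdivide DERIV_add DERIV_cmult dk dr x)
      have eq: "(?g x + t * e x)\<^sup>2 + (?k x + t * r x)\<^sup>2 = 1 + t\<^sup>2 * (e x / ?k x)\<^sup>2"
      proof -
        have kr: "?k x * r x = - (e x * ?g x)" using k0[OF x] by (simp add: r_def)
        have "(?g x + t * e x)\<^sup>2 + (?k x + t * r x)\<^sup>2
            = ((?g x)\<^sup>2 + (?k x)\<^sup>2) + 2 * t * (e x * ?g x + ?k x * r x) + t\<^sup>2 * ((e x)\<^sup>2 + (r x)\<^sup>2)"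
          by (simp add: power2_eq_square algebra_simps)
        also have "\<dots> = 1 + t\<^sup>2 * ((e x)\<^sup>2 + (r x)\<^sup>2)" unfolding kr k(3)[OF x] by simp
        also have "(e x)\<^sup>2 + (r x)\<^sup>2 = (e x / ?k x)\<^sup>2 * ((?g x)\<^sup>2 + (?k x)\<^sup>2)"
          using k0[OF x] by (simp add: r_def power_divide power_mult_distrib field_simps)
        finally show ?thesis using k(3)[OF x] by simp
      qed
      have "(e x / ?k x)\<^sup>2 \<le> B\<^sup>2"
        using power_mono[OF B[OF x] abs_ge_zero, of 2] unfolding power2_abs .
      then have "1 + t\<^sup>2 * (e x / ?k x)\<^sup>2 \<le> N"
        unfolding N_def by (intro add_left_mono mult_left_mono) auto
      also have "N \<le> N\<^sup>2" using N by (simp add: power2_eq_square)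
      finally show "(G x)\<^sup>2 + (K x)\<^sup>2 \<le> 1"
        \<comment> \<open>Dividing by \<open>N\<close> instead of its square root keeps the
          functional rational in \<open>t\<close>, and \<open>N \<ge> 1\<close> makes this division
          strong enough.\<close>
        using N eq by (simp add: G_def K_def power_divide add_divide_distrib[symmetric] divide_le_eq)
    next
      show "continuous_on ?I G'" "continuous_on ?I K'"
        unfolding G'_def[abs_def] K'_def[abs_def] using N by (auto intro!: continuous_intros cd ck' cr')
    qed
    also note P
    finally have "calib m X f G G' K \<le> L\<^sub>0" unfolding L\<^sub>0_def fh by simp
    moreover have "calib m X f G G' K = (L\<^sub>0 + t * L\<^sub>1) / N"
    proof -
      let ?A = "\<lambda>x. s / X * f x + \<bar>x\<bar> ^ m * ?k x" and ?B = "\<lambda>x. d x * f x + \<bar>x\<bar> ^ m * r x"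
      have i: "?A integrable_on ?I" "?B integrable_on ?I"
        by (intro integrable_continuous_interval continuous_intros f continuous_on_calib_y cd cr)+
      have "integral ?I (\<lambda>x. G' x * f x + \<bar>x\<bar> ^ m * K x) = integral ?I (\<lambda>x. (?A x + t * ?B x) * (1 / N))"
        by (intro integral_cong) (simp add: G'_def K_def add_divide_distrib algebra_simps)
      also have "\<dots> = (integral ?I ?A + t * integral ?I ?B) * (1 / N)"
        using i by (simp only: integral_mult_left integral_mult_right integral_add integrable_on_mult_right)
      finally have "integral ?I (\<lambda>x. G' x * f x + \<bar>x\<bar> ^ m * K x) = (integral ?I ?A + t * integral ?I ?B) / N"
        by simp
      then show ?thesis
        by (simp add: calib_def L\<^sub>0_def L\<^sub>1_def G_def diff_divide_distrib add_divide_distrib algebra_simps)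
    qed
    ultimately have "L\<^sub>0 + t * L\<^sub>1 \<le> L\<^sub>0 * N" using N by (simp add: divide_le_eq)
    then show ?thesis by (simp add: N_def algebra_simps)
  qed
  have "L\<^sub>1 = 0"
  proof (rule ccontr)
    assume L1: "L\<^sub>1 \<noteq> 0"
    define K where "K = 1 + \<bar>B\<^sup>2 * L\<^sub>0\<bar>"
    have K: "K > 0" "B\<^sup>2 * L\<^sub>0 < K" by (auto simp: K_def)
    \<comment> \<open>With \<open>t = L\<^sub>1 / K\<close> the left side is
      \<open>t\<^sup>2 * K\<close>, and \<open>K\<close> exceeds
      \<open>B\<^sup>2 * L\<^sub>0\<close>.\<close>
    have "(L\<^sub>1 / K) * L\<^sub>1 \<le> (L\<^sub>1 / K)\<^sup>2 * (B\<^sup>2 * L\<^sub>0)" by (rule var)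
    also have "\<dots> < (L\<^sub>1 / K)\<^sup>2 * K" using K L1 by (intro mult_strict_left_mono) auto
    also have "\<dots> = (L\<^sub>1 / K) * L\<^sub>1" using K by (simp add: power2_eq_square)
    finally show False by simp
  qed
  moreover have "L\<^sub>1 = integral ?I (\<lambda>x. (d x)\<^sup>2)"
  proof -
    \<comment> \<open>\<open>\<bar>x\<bar> ^ m * r\<close> is \<open>e\<close> times the derivative
      of \<open>?c\<close>, so with \<open>?c\<close> in place of \<open>f\<close> the variation
      consists of boundary terms only. Subtracting it leaves \<open>d * (f - ?c)\<close>.\<close>
    have "((\<lambda>x. d x * ?c x + \<bar>x\<bar> ^ m * r x) has_integral e X * ?c X - e (-X) * ?c (-X)) ?I"
    proof (rule fundamental_theorem_of_calculus)
      fix x assume x: "x \<in> ?I"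
      have "((\<lambda>x. e x * ?c x) has_real_derivative d x * ?c x + - (\<bar>x\<bar> ^ m * ?g x / ?k x) * e x) (at x within ?I)"
        by (intro DERIV_mult de DERIV_extremal s X x)
      then show "((\<lambda>x. e x * ?c x) has_vector_derivative d x * ?c x + \<bar>x\<bar> ^ m * r x) (at x within ?I)"
        by (simp add: has_real_derivative_iff_has_vector_derivative r_def mult_ac)
    qed (use X in simp)
    moreover have "((\<lambda>x. d x * f x + \<bar>x\<bar> ^ m * r x) has_integral integral ?I (\<lambda>x. d x * f x + \<bar>x\<bar> ^ m * r x)) ?I"
      by (intro integrable_integral integrable_continuous_interval continuous_intros f cd cr)
    ultimately have "((\<lambda>x. (d x * f x + \<bar>x\<bar> ^ m * r x) - (d x * ?c x + \<bar>x\<bar> ^ m * r x)) has_integral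
        integral ?I (\<lambda>x. d x * f x + \<bar>x\<bar> ^ m * r x) - (e X * ?c X - e (-X) * ?c (-X))) ?I"
      by (intro has_integral_diff)
    moreover have "(d x * f x + \<bar>x\<bar> ^ m * r x) - (d x * ?c x + \<bar>x\<bar> ^ m * r x) = (d x)\<^sup>2" for x
      by (simp add: d_def power2_eq_square algebra_simps)
    ultimately have "integral ?I (\<lambda>x. (d x)\<^sup>2)
      = integral ?I (\<lambda>x. d x * f x + \<bar>x\<bar> ^ m * r x) - (e X * ?c X - e (-X) * ?c (-X))"
      by (simp add: integral_unique)
    then show ?thesis using extremal_X[OF s(1) X] by (simp add: L\<^sub>1_def calib_def fh)
  qed
  ultimately have "integral ?I (\<lambda>x. (d x)\<^sup>2) = 0" by simp
  moreover have "(\<lambda>x. (d x)\<^sup>2) integrable_on ?I"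
    by (intro integrable_continuous_interval continuous_intros cd)
  ultimately have "((\<lambda>x. (d x)\<^sup>2) has_integral 0) (cbox (-X) X)" by (simp add: has_integral_iff)
  then have "(d x)\<^sup>2 = 0"
    by (rule has_integral_0_cbox_imp_0[rotated 2]) (use x X in \<open>auto intro!: continuous_intros cd\<close>)
  then show ?thesis by (simp add: d_def)
qed

section \<open>From convex centers to graphs\<close>

lemma measure_subgraph:
  assumes X: "X > 0" and f: "continuous_on {-X..X} f" and pos: "\<And>x. x \<in> {-X..X} \<Longrightarrow> 0 \<le> f x"
  shows "emeasure lebesgue (subgraph X f) = ennreal (2 * integral {-X..X} f)"
proof -
  have U: "subgraph X f \<in> sets lebesgue" using open_subgraph[OF f] by (intro sets_completionI_sets) auto
  note i = integral_subgraph[OF X f, of "\<lambda>_. 1", OF continuous_on_const]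
  have fin: "emeasure lebesgue (subgraph X f) \<noteq> \<infinity>"
    using i(1) U by (auto simp: set_integrable_def integrable_indicator_iff less_top)
  have "integral {- f x..f x} (\<lambda>y. 1) = 2 * f x" if "x \<in> {-X..X}" for x
    using pos[OF that] by simp
  then have "integral {-X..X} (\<lambda>x. integral {- f x..f x} (\<lambda>y. 1)) = integral {-X..X} (\<lambda>x. 2 * f x)"
    by (intro integral_cong)
  then have "measure lebesgue (subgraph X f) = 2 * integral {-X..X} f"
    using i(2) U by (simp add: set_lebesgue_integral_def)
  with emeasure_eq_ennreal_measure[of lebesgue "subgraph X f"] fin show ?thesis by simp
qed

text \<open>Convexity and x-symmetry make the sections shrink as \<open>\<bar>x\<bar>\<close> grows,
  so the limiting height at the sides, which the trace says is \<open>h\<close>, bounds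
  \<open>f\<close> from below. Concavity gives continuity inside and the trace gives it at the
  sides. Passing to the interior removes the ambiguity about frontier points.\<close>

lemma center_structure:
  assumes E: "x_symmetric E" "y_symmetric E" "y_convex E" and conv: "convex (center_part E X)"
    and X: "X > 0" and h: "h > 0" and tr: "is_left_trace E X {-h..h}"
  obtains f where "continuous_on {-X..X} f" "f X = h" "f (-X) = h"
    "\<And>x. x \<in> {-X..X} \<Longrightarrow> h \<le> f x" "interior (center_part E X) = subgraph X f"
proof -
  define C where "C = center_part E X"
  have C: "(x, y) \<in> C \<longleftrightarrow> (x, y) \<in> E \<and> \<bar>x\<bar> < X" for x y by (simp add: C_def center_part_def)
  have xs: "(- x, y) \<in> C" if "(x, y) \<in> C" for x y using that E(1) by (auto simp: C x_symmetric_def)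
  have yint: "(x, y) \<in> C" if "(x, b) \<in> C" "\<bar>y\<bar> \<le> b" for x y b
  proof -
    have b: "b \<in> {y. (x, y) \<in> E}" "- b \<in> {y. (x, y) \<in> E}" using that(1) E(2) by (auto simp: C y_symmetric_def)
    have "is_interval {y. (x, y) \<in> E}" using E(3) by (simp add: y_convex_def)
    from mem_is_interval_1_I[OF this b(2,1), of y] that(2)
    have "(x, y) \<in> E" by (simp add: abs_le_iff)
    then show ?thesis using that(1) by (simp add: C)
  qed
  have ysym: "(x, - y) \<in> C" if "(x, y) \<in> C" for x y using that E(2) by (auto simp: C y_symmetric_def)
  have comb: "((1 - t) * a + t * b, (1 - t) * y + t * z) \<in> C"
    if "(a, y) \<in> C" "(b, z) \<in> C" "0 \<le> t" "t \<le> 1" for a b y z t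
  proof -
    have "(1 - t) *\<^sub>R (a, y) + t *\<^sub>R (b, z) \<in> C"
      using conv that unfolding C_def[symmetric] by (intro convexD) auto
    then show ?thesis by simp
  qed
  have xint: "(x, y) \<in> C" if "(z, y) \<in> C" "\<bar>x\<bar> \<le> z" for x y z
  proof (cases "z = 0")
    case False
    then have z: "z > 0" using that by auto
    have "((1 - (x + z) / (2 * z)) * (- z) + (x + z) / (2 * z) * z,
        (1 - (x + z) / (2 * z)) * y + (x + z) / (2 * z) * y) \<in> C"
      using z that by (intro comb xs) (auto simp: divide_le_eq)
    moreover have "(1 - (x + z) / (2 * z)) * (- z) + (x + z) / (2 * z) * z = x" using z by (simp add: field_simps)
    ultimately show ?thesis by (simp add: algebra_simps)
  qed (use that in auto)
  define D where "D x = (\<integral>\<^sup>+ y. ennreal \<bar>indicator E (x, y) - indicator {-h..h} y\<bar> \<partial>lborel)" for x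
  have D0: "(D \<longlongrightarrow> 0) (at_left X)"
    using tr unfolding is_left_trace_def D_def[abs_def] by blast
  \<comment> \<open>An interval on which the section and the trace differ costs at least its
    length.\<close>
  have Dge: "ennreal (b - a) \<le> D x"
    if "\<And>y. a < y \<Longrightarrow> y < b \<Longrightarrow> \<bar>indicator E (x, y) - indicator {-h..h} y\<bar> = (1::real)" "a \<le> b" for a b x
  proof -
    have "ennreal (b - a) = (\<integral>\<^sup>+ y. indicator {a<..<b} y \<partial>lborel)" using that(2) by simp
    also have "\<dots> \<le> D x"
      unfolding D_def using that(1) by (intro nn_integral_mono) (auto split: split_indicator simp del: indicator_simps)
    finally show ?thesis .
  qed
  have "eventually (\<lambda>x. D x < ennreal h) (at_left X)"
    by (rule order_tendstoD(2)[OF D0]) (use h in simp)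
  then obtain x\<^sub>1 where x1: "x\<^sub>1 < X" "\<And>x. x\<^sub>1 < x \<Longrightarrow> x < X \<Longrightarrow> D x < ennreal h"
    unfolding eventually_at_left_field by blast
  \<comment> \<open>A section missing 0 is empty by symmetry and convexity, hence at distance at
    least \<open>h\<close> from the trace.\<close>
  have near0: "(z, 0) \<in> C" if "x\<^sub>1 < z" "0 \<le> z" "z < X" for z
  proof (rule ccontr)
    assume *: "(z, 0) \<notin> C"
    have "(z, y) \<notin> E" for y
    proof
      assume "(z, y) \<in> E"
      then have "(z, y) \<in> C" using that by (simp add: C)
      then have "(z, \<bar>y\<bar>) \<in> C" using ysym[of z y] by (cases "y \<ge> 0") auto
      then show False using yint[of z "\<bar>y\<bar>" 0] * by simp
    qed
    then have "ennreal (h - 0) \<le> D z" using h by (intro Dge) auto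
    with x1(2)[OF that(1,3)] show False by simp
  qed
  \<comment> \<open>A section with a point above \<open>2 * h\<close> contains the interval from
    \<open>h\<close> to \<open>2 * h\<close>, again at distance at least \<open>h\<close>.\<close>
  have nearB: "y \<le> 2 * h" if "x\<^sub>1 < z" "(z, y) \<in> C" for z y
  proof (rule ccontr)
    assume y: "\<not> y \<le> 2 * h"
    have "(z, y') \<in> E" if "h < y'" "y' < 2 * h" for y'
      using yint[OF \<open>(z, y) \<in> C\<close>, of y'] that y h by (auto simp: C)
    then have "ennreal (2 * h - h) \<le> D z" using h by (intro Dge) auto
    moreover have "z < X" using that by (auto simp: C)
    ultimately show False using x1(2)[OF that(1)] by force
  qed
  have mid: "\<exists>z. x\<^sub>1 < z \<and> \<bar>x\<bar> < z \<and> z < X" if "\<bar>x\<bar> < X" for x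
    using dense[of "max x\<^sub>1 \<bar>x\<bar>" X] x1(1) that by auto
  have S0: "(x, 0) \<in> C" if x: "\<bar>x\<bar> < X" for x
  proof -
    obtain z where "x\<^sub>1 < z" "\<bar>x\<bar> < z" "z < X" using mid[OF x] by blast
    then show ?thesis using near0[of z] xint[of z 0 x] by auto
  qed
  have Sb: "bdd_above {y. (x, y) \<in> C}" if x: "\<bar>x\<bar> < X" for x
  proof -
    obtain z where z: "x\<^sub>1 < z" "\<bar>x\<bar> < z" "z < X" using mid[OF x] by blast
    obtain z' where z': "z < z'" "z' < X" using dense z(3) by blast
    \<comment> \<open>By convexity a point of the section over \<open>\<bar>x\<bar>\<close> is
      pulled towards \<open>(z', 0)\<close>; \<open>t\<close> is the weight at which it arrives over
      \<open>z\<close>, where heights are at most \<open>2 * h\<close>.\<close>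
    define t where "t = (z - \<bar>x\<bar>) / (z' - \<bar>x\<bar>)"
    have t: "0 \<le> t" "t < 1" using z z' by (auto simp: t_def divide_less_eq)
    have tz: "(1 - t) * \<bar>x\<bar> + t * z' = z"
    proof -
      have "t * (z' - \<bar>x\<bar>) = z - \<bar>x\<bar>" using z z' by (simp add: t_def)
      then show ?thesis by (simp add: algebra_simps)
    qed
    have "y \<le> 2 * h / (1 - t)" if y: "(x, y) \<in> C" for y
    proof -
      have "(\<bar>x\<bar>, y) \<in> C" using y xs[OF y] by (cases "x \<ge> 0") auto
      moreover have "(z', 0) \<in> C" using S0[of z'] z z' by auto
      ultimately have "((1 - t) * \<bar>x\<bar> + t * z', (1 - t) * y + t * 0) \<in> C" using t by (intro comb) auto
      then have "(1 - t) * y \<le> 2 * h" unfolding tz using nearB[OF z(1)] by simp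
      then show ?thesis using t by (simp add: le_divide_eq mult.commute)
    qed
    then show ?thesis by (auto simp: bdd_above_def)
  qed
  define f where "f x = Sup {y. (x, y) \<in> C}" for x
  have f1: "(x, y) \<in> C" if x: "\<bar>x\<bar> < X" and y: "\<bar>y\<bar> < f x" for x y
  proof -
    have ne: "{y. (x, y) \<in> C} \<noteq> {}" using S0[OF x] by auto
    obtain b where "b \<in> {y. (x, y) \<in> C}" "\<bar>y\<bar> < b"
      using less_cSupE[OF y[unfolded f_def] ne] by blast
    then show ?thesis using yint[of x b y] by simp
  qed
  have f2: "\<bar>y\<bar> \<le> f x" if "(x, y) \<in> C" for x y
  proof -
    have "\<bar>x\<bar> < X" using that by (simp add: C)
    note ub = cSup_upper[OF _ Sb[OF this]]
    have "y \<le> f x" "- y \<le> f x" unfolding f_def using that ysym[OF that] by (auto intro!: ub)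
    then show ?thesis by (simp add: abs_le_iff)
  qed
  have feven: "f (- x) = f x" for x
  proof -
    have "{y. (- x, y) \<in> C} = {y. (x, y) \<in> C}" using xs[of x] xs[of "- x"] by auto
    then show ?thesis by (simp add: f_def)
  qed
  have fmono: "f z \<le> f x" if "\<bar>x\<bar> \<le> z" "z < X" for x z
    unfolding f_def
  proof (rule cSup_subset_mono)
    show "{y. (z, y) \<in> C} \<noteq> {}" using S0[of z] that by auto
    show "bdd_above {y. (x, y) \<in> C}" by (rule Sb) (use that in auto)
    show "{y. (z, y) \<in> C} \<subseteq> {y. (x, y) \<in> C}" using xint that by auto
  qed
  have fD: "ennreal \<bar>f x - h\<bar> \<le> D x" if x: "0 \<le> x" "x < X" for x
  proof (cases "f x \<le> h")
    case True
    have fx: "0 \<le> f x" using f2[OF S0[of x]] x by auto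
    have "(x, y) \<notin> E" if "f x < y" for y
      using f2[of x y] that x by (auto simp: C)
    then have "ennreal (h - f x) \<le> D x" using True fx by (intro Dge) auto
    then show ?thesis using True by (simp add: abs_if)
  next
    case False
    have "(x, y) \<in> E" if "h < y" "y < f x" for y using f1[of x y] x that h by (auto simp: C)
    then have "ennreal (f x - h) \<le> D x" using False h by (intro Dge) auto
    then show ?thesis using False by simp
  qed
  have flim: "(f \<longlongrightarrow> h) (at_left X)"
  proof (rule tendstoI)
    fix e :: real assume e: "e > 0"
    have "eventually (\<lambda>x. D x < ennreal e) (at_left X)"
      by (rule order_tendstoD(2)[OF D0]) (use e in simp)
    moreover have "eventually (\<lambda>x. 0 < x \<and> x < X) (at_left X)"
      unfolding eventually_at_left_field using X by blast
    ultimately show "eventually (\<lambda>x. dist (f x) h < e) (at_left X)"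
    proof eventually_elim
      case (elim x)
      then have "ennreal \<bar>f x - h\<bar> < ennreal e" using fD[of x] by (auto intro: le_less_trans)
      then show ?case using e by (simp add: dist_real_def ennreal_less_iff)
    qed
  qed
  have fh: "h \<le> f x" if x: "\<bar>x\<bar> < X" for x
  proof (rule tendsto_upperbound[OF flim])
    show "eventually (\<lambda>z. f z \<le> f x) (at_left X)"
      unfolding eventually_at_left_field using fmono[of x] x by (intro exI[of _ "\<bar>x\<bar>"]) auto
  qed simp
  have "convex_on {-X<..<X} (\<lambda>x. - f x)"
  proof (rule convex_onI)
    fix t a b :: real assume t: "0 < t" "t < 1" and ab: "a \<in> {-X<..<X}" "b \<in> {-X<..<X}"
    have "(1 - t) * f a + t * f b \<le> f ((1 - t) * a + t * b) + e" if e: "e > 0" for e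
    proof -
      \<comment> \<open>The supremum \<open>f\<close> need not be attained, so heights
        \<open>f - r\<close> are combined instead; \<open>r \<le> h\<close> keeps them nonnegative,
        as needed for \<open>f1\<close>.\<close>
      define r where "r = min e h"
      have r: "0 < r" "r \<le> e" "r \<le> h" using e h by (auto simp: r_def)
      have ab': "\<bar>a\<bar> < X" "\<bar>b\<bar> < X" using ab by auto
      have "(a, f a - r) \<in> C" "(b, f b - r) \<in> C"
        using fh[OF ab'(1)] fh[OF ab'(2)] r ab' by (auto intro!: f1 simp: abs_less_iff)
      from comb[OF this, of t] t
      have "((1 - t) * a + t * b, (1 - t) * (f a - r) + t * (f b - r)) \<in> C" by auto
      from f2[OF this] have "(1 - t) * (f a - r) + t * (f b - r) \<le> f ((1 - t) * a + t * b)" by linarith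
      then show ?thesis using r(2) by (simp add: algebra_simps)
    qed
    then have "(1 - t) * f a + t * f b \<le> f ((1 - t) * a + t * b)" by (rule field_le_epsilon)
    then show "- f ((1 - t) *\<^sub>R a + t *\<^sub>R b) \<le> (1 - t) * - f a + t * - f b" by simp
  qed simp
  from continuous_on_minus[OF convex_on_continuous[OF open_greaterThanLessThan this]]
  have cf: "continuous_on {-X<..<X} f" by simp
  have FX: "\<not> \<bar>X\<bar> < X" "\<not> \<bar>- X\<bar> < X" using X by auto
  \<comment> \<open>At the sides \<open>f\<close> is a supremum over the empty set, so the boundary
    value has to be inserted.\<close>
  define F where "F x = (if \<bar>x\<bar> < X then f x else h)" for x
  have flimX: "(F \<longlongrightarrow> h) (at_left X)"
  proof (rule Lim_transform_eventually[OF flim])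
    show "eventually (\<lambda>x. f x = F x) (at_left X)"
      unfolding eventually_at_left_field using X by (intro exI[of _ 0]) (auto simp: F_def)
  qed
  have Feven: "F (- x) = F x" for x by (simp add: F_def feven)
  have "continuous_on {-X..X} F"
  proof (rule continuous_on_IccI)
    show "(F \<longlongrightarrow> F X) (at_left X)" using flimX FX by (simp add: F_def)
    have "((\<lambda>x. F (- x)) \<longlongrightarrow> h) (at_left X)" using flimX Feven by simp
    then show "(F \<longlongrightarrow> F (- X)) (at_right (- X))"
      unfolding at_right_minus[of "- X"] filterlim_filtermap using FX by (simp add: F_def)
    fix x assume x: "-X < x" "x < X"
    have "isCont f x"
      using cf x by (simp add: continuous_on_eq_continuous_at)
    then have "(f \<longlongrightarrow> F x) (at x)" using x by (simp add: F_def isCont_def abs_less_iff)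
    then show "(F \<longlongrightarrow> F x) (at x)"
    proof (rule Lim_transform_eventually)
      have "eventually (\<lambda>y. y \<in> {-X<..<X}) (at x)"
        using x by (intro eventually_at_in_open') auto
      then show "eventually (\<lambda>y. f y = F y) (at x)"
        by eventually_elim (auto simp: F_def abs_less_iff)
    qed
  qed (use X in simp)
  moreover have "F X = h" "F (-X) = h" using X by (auto simp: F_def)
  moreover have "h \<le> F x" for x using fh by (auto simp: F_def)
  moreover have "interior C = subgraph X F"
  proof (rule antisym)
    have "subgraph X F \<subseteq> C" using f1 by (auto simp: subgraph_def F_def)
    then show "subgraph X F \<subseteq> interior C"
      by (rule interior_maximal) (rule open_subgraph[OF \<open>continuous_on {-X..X} F\<close>])
    show "interior C \<subseteq> subgraph X F"
    proof clarify
      fix x y assume xy: "(x, y) \<in> interior C"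
      then obtain e where e: "e > 0" "ball (x, y) e \<subseteq> C" unfolding mem_interior by blast
      have "(x, y + e / 2) \<in> ball (x, y) e" "(x, y - e / 2) \<in> ball (x, y) e"
        using e(1) by (auto simp: dist_Pair_Pair dist_real_def)
      then have "\<bar>y + e / 2\<bar> \<le> f x" "\<bar>y - e / 2\<bar> \<le> f x" using e(2) by (auto intro!: f2)
      then have "\<bar>y\<bar> < f x" using e(1) by linarith
      moreover have "\<bar>x\<bar> < X" using xy interior_subset[of C] by (auto simp: C)
      ultimately show "(x, y) \<in> subgraph X F" by (simp add: subgraph_def F_def)
    qed
  qed
  ultimately show ?thesis using that unfolding C_def by blast
qed

section \<open>The theorem\<close>

text \<open>With outer volume 0 the outer parts are null sets, and a convex center differs from its
  interior by a null set. The complement and the center thus contribute the same perimeter, and the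
  factor one half leaves one copy of it.\<close>

lemma perimeter_center_le_partition_perimeter:
  assumes E: "E \<in> sets lebesgue" and p: "is_partitioning_point (real m) v 0 h 0 E X"
    and conv: "convex (center_part E X)"
  shows "perimeter (real m) (interior (center_part E X)) \<le> partition_perimeter (real m) E X"
    and "emeasure lebesgue (interior (center_part E X)) = ennreal v"
proof -
  let ?C = "center_part E X" and ?L = "left_part E X" and ?R = "right_part E X"
  define U where "U = interior ?C"
  have sets: "{p :: real \<times> real. \<bar>fst p\<bar> < X} \<in> sets lebesgue" "{p :: real \<times> real. fst p < -X} \<in> sets lebesgue"
     "{p :: real \<times> real. fst p > X} \<in> sets lebesgue"
    by (intro sets_completionI_sets; auto intro!: open_Collect_less continuous_intros borel_open)+
  have "?C = E \<inter> {p. \<bar>fst p\<bar> < X}" "?L = E \<inter> {p. fst p < -X}" "?R = E \<inter> {p. fst p > X}"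
    by (auto simp: center_part_def left_part_def right_part_def)
  with sets E have sC: "?C \<in> sets lebesgue" and sL: "?L \<in> sets lebesgue" and sR: "?R \<in> sets lebesgue" by auto
  have sU: "U \<in> sets lebesgue" by (auto simp: U_def intro!: sets_completionI_sets)
  have UC: "U \<subseteq> ?C" by (simp add: U_def interior_subset)
  have CE: "?C \<subseteq> E" by (auto simp: center_part_def)
  have "negligible (frontier ?C)" by (rule negligible_convex_frontier[OF conv])
  moreover have "?C - U \<subseteq> frontier ?C"
    using closure_subset by (auto simp: U_def frontier_def)
  ultimately have nC: "?C - U \<in> null_sets lebesgue"
    by (metis negligible_iff_null_sets negligible_subset)
  have nLR: "?L \<in> null_sets lebesgue" "?R \<in> null_sets lebesgue"
    using p sL sR by (auto simp: is_partitioning_point_def null_sets_def)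
  have line: "{p :: real \<times> real. fst p = b} \<in> null_sets lebesgue" for b
    using negligible_hyperplane[of "(1, 0) :: real \<times> real" b]
    by (simp add: negligible_iff_null_sets inner_prod_def zero_prod_def)
  \<comment> \<open>The vertical lines through \<open>X\<close> and \<open>-X\<close> belong to none
    of the three parts and have to be removed separately.\<close>
  let ?N = "?L \<union> ?R \<union> (?C - U) \<union> {p. fst p = X} \<union> {p. fst p = -X}"
  have N: "?N \<in> null_sets lebesgue" by (intro null_sets.Un nLR nC line)
  have "E - U \<subseteq> ?N"
    by (auto simp: left_part_def right_part_def center_part_def)
  then have nE: "E - U \<in> null_sets lebesgue"
    using E sU by (intro null_sets_subset[OF N]) auto
  have PE: "perimeter (real m) E = perimeter (real m) U"
    using nE UC CE by (intro perimeter_cong_null E sU) (simp add: Un_absorb2 Diff_eq_empty_iff[THEN iffD2, OF subset_trans])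
  have PC: "perimeter (real m) ?C = perimeter (real m) U"
    using nC UC by (intro perimeter_cong_null sC sU) (simp add: Diff_eq_empty_iff[THEN iffD2])
  have ineq: "a \<le> (a + b + a + c) / 2" if "0 \<le> a" "0 \<le> b" "0 \<le> c" for a b c :: ereal
    using that by (cases a; cases b; cases c) auto
  show "perimeter (real m) (interior ?C) \<le> partition_perimeter (real m) E X"
    unfolding partition_perimeter_def perimeter_Compl[OF E] PE PC U_def[symmetric]
    by (intro ineq perimeter_nonneg)
  have "emeasure lebesgue ?C = emeasure lebesgue (U \<union> (?C - U))" using UC by (simp add: Un_absorb1)
  also have "\<dots> = emeasure lebesgue U" by (rule emeasure_Un_null_set[OF sU nC])
  finally show "emeasure lebesgue (interior ?C) = ennreal v"
    using p by (simp add: is_partitioning_point_def U_def)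
qed

text \<open>Makes the extremal graph a competitor. Its outer parts are empty, so the estimate of the
  functional by the perimeter is an equality here.\<close>

lemma subgraph_in_class_A:
  assumes X: "X > 0" and h: "h > 0" and f: "continuous_on {-X..X} f" and fX: "f X = h"
    and fh: "\<And>x. x \<in> {-X..X} \<Longrightarrow> h \<le> f x" and even: "\<And>x. f (- x) = f x"
    and v: "2 * integral {-X..X} f = v" and P: "perimeter (real m) (subgraph X f) < \<infinity>"
  shows "subgraph X f \<in> class_A (real m) v 0 h 0"
    and "is_partitioning_point (real m) v 0 h 0 (subgraph X f) X"
    and "partition_perimeter (real m) (subgraph X f) X = perimeter (real m) (subgraph X f)"
proof -
  let ?F = "subgraph X f"
  have sF: "?F \<in> sets lebesgue" using open_subgraph[OF f] by (intro sets_completionI_sets) auto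
  have parts: "center_part ?F X = ?F" "left_part ?F X = {}" "right_part ?F X = {}"
    by (auto simp: center_part_def left_part_def right_part_def subgraph_def)
  have tl: "is_left_trace ?F X {-h..h}"
    unfolding is_left_trace_def
  proof
    show "\<exists>b\<ge>0. {-h..h} = {-b..b}" using h by (intro exI[of _ h]) auto
    have lim: "((\<lambda>x. ennreal (2 * (f x - h))) \<longlongrightarrow> ennreal (2 * (h - h))) (at_left X)"
      using continuous_on_Icc_at_leftD[OF f] X fX by (intro tendsto_intros) auto
    show "((\<lambda>x. \<integral>\<^sup>+ y. ennreal \<bar>indicator ?F (x, y) - indicator {-h..h} y\<bar> \<partial>lborel) \<longlongrightarrow> 0) (at_left X)"
    proof (rule tendsto_sandwich[OF _ _ tendsto_const])
      have "(\<integral>\<^sup>+ y. ennreal \<bar>indicator ?F (x, y) - indicator {-h..h} y\<bar> \<partial>lborel) \<le> ennreal (2 * (f x - h))"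
        if x: "0 < x" "x < X" for x
      proof -
        have fx: "h \<le> f x" using fh x by auto
        have "(\<integral>\<^sup>+ y. ennreal \<bar>indicator ?F (x, y) - indicator {-h..h} y\<bar> \<partial>lborel)
           \<le> (\<integral>\<^sup>+ y. indicator ({- f x..-h} \<union> {h..f x}) y \<partial>lborel)"
          using x fx by (intro nn_integral_mono) (auto simp: subgraph_def indicator_def abs_less_iff)
        also have "\<dots> = emeasure lborel ({- f x..-h} \<union> {h..f x})" by simp
        also have "\<dots> \<le> emeasure lborel {- f x..-h} + emeasure lborel {h..f x}"
          by (intro emeasure_subadditive) auto
        also have "\<dots> = ennreal (2 * (f x - h))" using fx by (simp flip: ennreal_plus)
        finally show ?thesis .
      qed
      then show "eventually (\<lambda>x. (\<integral>\<^sup>+ y. ennreal \<bar>indicator ?F (x, y) - indicator {-h..h} y\<bar> \<partial>lborel)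
          \<le> ennreal (2 * (f x - h))) (at_left X)"
        unfolding eventually_at_left_field using X by blast
      show "((\<lambda>x. ennreal (2 * (f x - h))) \<longlongrightarrow> 0) (at_left X)" using lim by simp
    qed simp
  qed
  \<comment> \<open>Beyond \<open>X\<close> the set is empty, and the degenerate trace is a single
    point, hence a null set.\<close>
  have tr: "is_right_trace ?F X {-0..0}"
    unfolding is_right_trace_def
  proof
    show "\<exists>b\<ge>0. {-0..0} = {-b..b::real}" by (intro exI[of _ 0]) auto
    have "(\<integral>\<^sup>+ y. ennreal \<bar>indicator ?F (x, y) - indicator {-0..0} y\<bar> \<partial>lborel) = 0" if "X < x" for x
    proof -
      have "ennreal \<bar>indicator ?F (x, y) - indicator {-0..0::real} y\<bar> = indicator {0} y" for y
        using that by (auto simp: subgraph_def indicator_def)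
      then show ?thesis by simp
    qed
    then show "((\<lambda>x. \<integral>\<^sup>+ y. ennreal \<bar>indicator ?F (x, y) - indicator {-0..0} y\<bar> \<partial>lborel) \<longlongrightarrow> 0) (at_right X)"
      by (intro tendsto_eventually) (auto simp: eventually_at_right_field intro!: exI[of _ "X + 1"])
  qed
  have "emeasure lebesgue ?F = ennreal v"
    unfolding v[symmetric] using fh h by (intro measure_subgraph X f) (meson less_eq_real_def order_trans)
  then show pp: "is_partitioning_point (real m) v 0 h 0 ?F X"
    unfolding is_partitioning_point_def parts using X P tl tr by auto
  have "?F \<in> Sx" using sF even by (auto simp: Sx_def x_symmetric_def subgraph_def)
  moreover have "is_interval {y. (x, y) \<in> ?F}" for x
  proof (cases "\<bar>x\<bar> < X")
    case True
    then have "{y. (x, y) \<in> ?F} = {- f x<..<f x}" by (auto simp: subgraph_def)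
    then show ?thesis by (simp add: is_interval_oo)
  next
    case False
    then have "{y. (x, y) \<in> ?F} = {}" by (auto simp: subgraph_def)
    then show ?thesis by simp
  qed
  then have "?F \<in> Sy_star"
    using sF by (auto simp: Sy_star_def y_Schwarz_symmetric_def y_symmetric_def y_convex_def subgraph_def)
  ultimately show "?F \<in> class_A (real m) v 0 h 0" using pp by (auto simp: class_A_def)
  have half: "(a + 0 + a + 0) / 2 = a" if "0 \<le> a" for a :: ereal
    using that by (cases a) auto
  show "partition_perimeter (real m) ?F X = perimeter (real m) ?F"
    unfolding partition_perimeter_def parts perimeter_Compl[OF sF] perimeter_empty
    by (intro half perimeter_nonneg)
qed

section \<open>Comparison of widths\<close>

text \<open>The graph enters only through its area and its boundary height, so the lower bound is
  the same number for all competitors of a given width.\<close>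

lemma calib_value:
  assumes X: "X > 0" and f: "continuous_on {-X..X} f" "f X = h" "f (-X) = h"
  shows "2 * h + calib m X f (calib_x s X) (\<lambda>_. s / X) (calib_y s X)
    = 2 * (1 - s) * h + s / X * integral {-X..X} f + X ^ (m + 1) * weight_moment m s"
proof -
  have "integral {-X..X} (\<lambda>x. s / X * f x + \<bar>x\<bar> ^ m * calib_y s X x)
     = integral {-X..X} (\<lambda>x. s / X * f x) + integral {-X..X} (\<lambda>x. \<bar>x\<bar> ^ m * calib_y s X x)"
    by (intro integral_add integrable_continuous_interval continuous_intros f continuous_on_calib_y)
  also have "\<dots> = s / X * integral {-X..X} f + X ^ (m + 1) * weight_moment m s"
    by (simp only: integral_mult_right integral_weight_calib_y[OF X])
  finally show ?thesis
    using X f(2,3) by (simp add: calib_def calib_x_def left_diff_distrib)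
qed

text \<open>The two sides of the inequality are values of \<open>z \<mapsto> a / z + z ^ (m + 1) * W\<close>, whose only critical
  point on the positive axis is \<open>X\<close> by the choice of \<open>a\<close>.\<close>

lemma energy_minimizer_unique:
  assumes m: "m = 0 \<or> m = 1" and pos: "X > 0" "Z > 0" "W > (0::real)"
    and a: "a = (real m + 1) * X ^ (m + 2) * W"
    and le: "a / Z + Z ^ (m + 1) * W \<le> a / X + X ^ (m + 1) * W"
  shows "Z = X"
  using m
proof
  assume m: "m = 0"
  have "(X\<^sup>2 / Z + Z) * W \<le> (X\<^sup>2 / X + X) * W" using le pos by (simp add: a m power2_eq_square algebra_simps)
  then have "X\<^sup>2 / Z + Z \<le> 2 * X" using pos by (simp add: power2_eq_square)
  then have "(X\<^sup>2 / Z + Z) * Z \<le> 2 * X * Z" using pos by (intro mult_right_mono) auto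
  then have "(X - Z)\<^sup>2 \<le> 0" using pos by (simp add: power2_eq_square algebra_simps)
  then show ?thesis by simp
next
  assume m: "m = 1"
  have "(2 * X ^ 3 / Z + Z\<^sup>2) * W \<le> (2 * X ^ 3 / X + X\<^sup>2) * W"
    using le pos by (simp add: a m eval_nat_numeral algebra_simps)
  then have "2 * X ^ 3 / Z + Z\<^sup>2 \<le> 3 * X\<^sup>2" using pos by (simp add: eval_nat_numeral)
  then have "(2 * X ^ 3 / Z + Z\<^sup>2) * Z \<le> 3 * X\<^sup>2 * Z" using pos by (intro mult_right_mono) auto
  \<comment> \<open>The cubic \<open>Z ^ 3 - 3 * X\<^sup>2 * Z + 2 * X ^ 3\<close> has the double
    root \<open>X\<close>.\<close>
  then have "(Z - X)\<^sup>2 * (Z + 2 * X) \<le> 0" using pos by (simp add: eval_nat_numeral algebra_simps)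
  then have "(Z - X)\<^sup>2 \<le> 0" using pos by (simp add: mult_le_0_iff)
  then show ?thesis by simp
qed

text \<open>By \<open>st\<close> the constant is
  \<open>(X / s) ^ (m + 1) * (s ^ m * c - profile (real m) s)\<close> with
  \<open>c = sqrt (1 - s\<^sup>2)\<close>. The bracket vanishes for \<open>m = 0\<close>. For
  \<open>m = 1\<close> it is \<open>(s * c - u) / 2\<close> with
  \<open>u = pi / 2 - arcsin s\<close>, which is negative because \<open>c = sin u \<le> u\<close>
  and \<open>s < 1\<close>.\<close>

lemma ybar_sign:
  assumes m: "m = 0 \<or> m = 1" and s: "0 < s" "s < 1" and X: "0 < X"
    and st: "X ^ (m + 1) * sqrt (1 - s\<^sup>2) = h * s"
  shows "h - (X / s) ^ (m + 1) * profile (real m) s \<le> 0"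
    and "h - (X / s) ^ (m + 1) * profile (real m) s = 0 \<longleftrightarrow> m = 0"
proof -
  let ?c = "sqrt (1 - s\<^sup>2)" and ?y = "h - (X / s) ^ (m + 1) * profile (real m) s"
  have hs: "h = X ^ (m + 1) * ?c / s" using st s by (simp add: field_simps)
  have "m = 0 \<Longrightarrow> ?y = 0" using profile_0[of s] s hs by simp
  moreover have "?y < 0" if m1: "m = 1"
  proof -
    have p1: "profile (real m) s = (pi / 2 - arcsin s + s * ?c) / 2" using profile_1[of s] s m1 by simp
    define u where "u = pi / 2 - arcsin s"
    have u: "0 < u" using arcsin_lt_bounded[of s] s by (simp add: u_def)
    have "?c = cos (arcsin s)" using s by (simp add: cos_arcsin)
    also have "\<dots> = sin u" by (simp add: u_def sin_diff)
    also have "\<dots> \<le> u" using u by (intro sin_x_le_x) simp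
    finally have "s * ?c \<le> s * u" using s by (intro mult_left_mono) auto
    also have "s * u < 1 * u" using s u by (intro mult_strict_right_mono) auto
    finally have "s * ?c - u < 0" by simp
    moreover have "?y = (X / s)\<^sup>2 * ((s * ?c - u) / 2)"
      unfolding hs p1 u_def[symmetric] using s by (simp add: m1 power2_eq_square field_simps)
    moreover have "(X / s)\<^sup>2 > 0" using X s by simp
    ultimately show ?thesis by (simp only: mult_less_0_iff) simp
  qed
  ultimately show "?y \<le> 0" "?y = 0 \<longleftrightarrow> m = 0" using m by (auto simp: less_le)
qed

text \<open>Null sets are invisible to the functional, so a solution fixes its center only up to
  frontier points; this is why the interior appears. The bound \<open>x\<^sub>0 \<le> lam\<close>
  keeps the argument of \<open>profile\<close> in its meaningful range. The parameters are
  quantified before \<open>E\<close>, since they depend on the data alone.\<close>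

theorem theorem1p2:
  fixes \<alpha> v\<^sub>1 h\<^sub>1 :: real
  assumes "\<alpha> \<in> {0, 1}" and "v\<^sub>1 > 0" and "h\<^sub>1 > 0"
  shows "\<exists>lam>0. \<exists>ybar\<le>0. (ybar = 0 \<longleftrightarrow> \<alpha> = 0) \<and>
    (\<forall>E x\<^sub>0. regular_solution \<alpha> v\<^sub>1 0 h\<^sub>1 0 E x\<^sub>0 \<and> is_left_trace E x\<^sub>0 {- h\<^sub>1..h\<^sub>1} \<longrightarrow>
       x\<^sub>0 \<le> lam \<and>
       interior (center_part E x\<^sub>0) =
         {(x, y). \<bar>y\<bar> < lam powr (\<alpha> + 1) * profile \<alpha> (x / lam) + ybar \<and> \<bar>x\<bar> < x\<^sub>0})"
proof -
  obtain m :: nat where \<alpha>: "\<alpha> = real m" and m: "m = 0 \<or> m = 1"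
    using assms(1) that[of 0] that[of 1] by auto
  obtain s X where s: "0 < s" "s < 1" and X: "0 < X"
    and st: "X ^ (m + 1) * sqrt (1 - s\<^sup>2) = h\<^sub>1 * s"
    and a: "s * (v\<^sub>1 / 2) = (real m + 1) * X ^ (m + 2) * weight_moment m s"
    using exists_parameters[OF m assms(2,3)] by blast
  define F where "F = extremal m s X h\<^sub>1"
  have cF: "continuous_on {-X..X} F" unfolding F_def by (rule continuous_on_extremal[OF s X])
  have "s * integral {-X..X} F = s * (v\<^sub>1 / 2)"
    unfolding a F_def by (rule integral_extremal[OF s X st])
  then have intF: "integral {-X..X} F = v\<^sub>1 / 2" using s by simp
  \<comment> \<open>The calibration bound as a function of the half-width alone, with the prescribed
    area already inserted.\<close>
  define B where "B Z = 2 * (2 * (1 - s) * h\<^sub>1 + s / Z * (v\<^sub>1 / 2) + Z ^ (m + 1) * weight_moment m s)" for Z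
  have PF: "perimeter (real m) (subgraph X F) \<le> ereal (B X)"
    using perimeter_extremal_le[OF s X assms(3), of m] unfolding B_def F_def[symmetric] intF .
  then have fin: "perimeter (real m) (subgraph X F) < \<infinity>" by (auto simp: less_top[symmetric])
  have Fh: "h\<^sub>1 \<le> F x" if "x \<in> {-X..X}" for x unfolding F_def by (rule extremal_ge[OF s X that])
  have "F X = h\<^sub>1" unfolding F_def by (rule extremal_X[OF s(1) X])
  moreover have "F (- x) = F x" for x unfolding F_def by (rule extremal_even)
  moreover have "2 * integral {-X..X} F = v\<^sub>1" using intF by simp
  ultimately have adm: "subgraph X F \<in> class_A (real m) v\<^sub>1 0 h\<^sub>1 0"
    "is_partitioning_point (real m) v\<^sub>1 0 h\<^sub>1 0 (subgraph X F) X"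
    "partition_perimeter (real m) (subgraph X F) X = perimeter (real m) (subgraph X F)"
    using subgraph_in_class_A[OF X assms(3) cF _ Fh _ _ fin] by auto
  define lam where "lam = X / s"
  define ybar where "ybar = h\<^sub>1 - lam ^ (m + 1) * profile (real m) s"
  have lam: "lam > 0" "X \<le> lam" using s X by (auto simp: lam_def le_divide_eq mult_le_one)
  have yb: "ybar \<le> 0" "ybar = 0 \<longleftrightarrow> \<alpha> = 0"
    unfolding ybar_def lam_def \<alpha> using ybar_sign[OF m s X st] by simp_all
  have "Z \<le> lam \<and> interior (center_part E Z) =
      {(x, y). \<bar>y\<bar> < lam powr (\<alpha> + 1) * profile \<alpha> (x / lam) + ybar \<and> \<bar>x\<bar> < Z}"
    if reg: "regular_solution \<alpha> v\<^sub>1 0 h\<^sub>1 0 E Z" and tr: "is_left_trace E Z {- h\<^sub>1..h\<^sub>1}" for E Z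
  proof -
    from reg have pp: "is_partitioning_point (real m) v\<^sub>1 0 h\<^sub>1 0 E Z" and conv: "convex (center_part E Z)"
      and EA: "E \<in> Sx" "E \<in> Sy_star"
      and min: "partition_perimeter (real m) E Z \<le> partition_perimeter (real m) (subgraph X F) X"
      using adm(1,2) unfolding regular_solution_def class_A_def \<alpha> by auto
    have Z: "Z > 0" using pp by (simp add: is_partitioning_point_def)
    have sE: "E \<in> sets lebesgue" "x_symmetric E" "y_symmetric E" "y_convex E"
      using EA by (auto simp: Sx_def Sy_star_def y_Schwarz_symmetric_def)
    obtain f where f: "continuous_on {-Z..Z} f" "f Z = h\<^sub>1" "f (-Z) = h\<^sub>1"
      "\<And>x. x \<in> {-Z..Z} \<Longrightarrow> h\<^sub>1 \<le> f x" and U: "interior (center_part E Z) = subgraph Z f"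
      using center_structure[OF sE(2-4) conv Z assms(3) tr] by blast
    note pc = perimeter_center_le_partition_perimeter[OF sE(1) pp conv, unfolded U]
    have Pf: "perimeter (real m) (subgraph Z f) \<le> ereal (B X)"
      using pc(1) min PF unfolding adm(3) by (rule order_trans[OF order_trans])
    have f0: "0 \<le> f x" if "x \<in> {-Z..Z}" for x using f(4)[OF that] assms(3) by linarith
    have "0 \<le> integral {-Z..Z} f"
      using f0 by (intro integral_nonneg integrable_continuous_interval f) auto
    moreover have "ennreal (2 * integral {-Z..Z} f) = ennreal v\<^sub>1"
      using pc(2) measure_subgraph[OF Z f(1) f0] by simp
    ultimately have intf: "integral {-Z..Z} f = v\<^sub>1 / 2"
      using assms(2) by (simp add: ennreal_inj)
    have calib: "2 * (2 * h\<^sub>1 + calib m Z f (calib_x s Z) (\<lambda>_. s / Z) (calib_y s Z)) = B Z"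
      unfolding calib_value[OF Z f(1-3)] B_def intf ..
    have "ereal (2 * (f Z + f (-Z) + calib m Z f (calib_x s Z) (\<lambda>_. s / Z) (calib_y s Z)))
      \<le> perimeter (real m) (subgraph Z f)"
    proof (rule perimeter_subgraph_ge[OF Z assms(3) f(1) f(4)])
      fix x assume x: "x \<in> {-Z..Z}"
      note k = calib_y_ge[OF s Z x]
      show "(calib_x s Z has_real_derivative s / Z) (at x within {-Z..Z})" by (rule DERIV_calib_x)
      show "(calib_y s Z has_real_derivative - (calib_x s Z x * (s / Z)) / calib_y s Z x) (at x within {-Z..Z})"
        by (rule DERIV_calib_y[OF k(4)])
      show "(calib_x s Z x)\<^sup>2 + (calib_y s Z x)\<^sup>2 \<le> 1" using k(3) by simp
    next
      have "calib_y s Z x \<noteq> 0" if "x \<in> {-Z..Z}" for x using calib_y_ge(2)[OF s Z that] by simp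
      then show "continuous_on {-Z..Z} (\<lambda>x. - (calib_x s Z x * (s / Z)) / calib_y s Z x)"
        by (intro continuous_intros continuous_on_calib_x continuous_on_calib_y) auto
    qed (simp_all add: continuous_on_const)
    \<comment> \<open>The perimeter of the center lies between \<open>B Z\<close> and
      \<open>B X\<close>. The height terms agree on both sides because \<open>s\<close> does not
      vary with the width.\<close>
    from order_trans[OF this Pf] have "B Z \<le> B X"
      unfolding calib[symmetric] f(2,3) by simp
    then have "s * (v\<^sub>1 / 2) / Z + Z ^ (m + 1) * weight_moment m s \<le> s * (v\<^sub>1 / 2) / X + X ^ (m + 1) * weight_moment m s"
      by (simp add: B_def)
    from energy_minimizer_unique[OF m X Z weight_moment_pos[OF s] a this] have ZX: "Z = X" .
    \<comment> \<open>Once the widths agree, the perimeter is at most the calibration bound for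
      \<open>f\<close> itself, which is what rigidity asks for.\<close>
    have "f x = F x" if "x \<in> {-X..X}" for x
      unfolding F_def
      by (rule subgraph_calibration_rigid[OF s X assms(3) _ _ _ _ _ that])
         (use f Pf calib in \<open>simp_all add: ZX\<close>)
    then have "f x = F x" if "\<bar>x\<bar> < X" for x using that by (simp add: abs_less_iff)
    then have "subgraph Z f = subgraph X F" by (auto simp: subgraph_def ZX)
    moreover have "F x = lam powr (\<alpha> + 1) * profile \<alpha> (x / lam) + ybar" for x
      using powr_realpow[OF lam(1), of "m + 1"]
      by (simp add: F_def extremal_def ybar_def lam_def[symmetric] \<alpha> algebra_simps)
    ultimately show ?thesis
      using lam(2) unfolding U by (auto simp: ZX subgraph_def)
  qed
  then show ?thesis using lam(1) yb by (intro exI[of _ lam] conjI exI[of _ ybar]) auto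
qed

end
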